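(* Let $K$ be a field of characteristic zero and let $\alpha\in K((T^{-1}))$ be algebraic over $K(T)$ of degree $d\ge 2$. For $i\ge 0$ let $q_i$ be the denominator of the $i$-th convergent of the continued fraction expansion of $\alpha$. Then there is a constant $C$, depending only on $\alpha$, such that $$\log\log|q_i|<\frac{C\,i}{\sqrt{\log i}}\qquad\text{for all } i\ge 2.$$
   Context: $K((T^{-1}))$ is the field of formal Laurent series in $T^{-1}$ over $K$, i.e. the completion of $K(T)$ for the ultrametric absolute value $|a/b|=\mu^{\deg a-\deg b}$ (for nonzero $a,b\in K[T]$), $|0|=0$, where $\mu>1$ is a fixed real number; the absolute value is extended to $K((T^{-1}))$. $\log$ denotes the logarithm with base $\mu$. Continued fractions: for nonzero $\alpha=\sum_{i\le k}b_iT^i\in K((T^{-1}))$ with $b_k\neq 0$, put $\lfloor\alpha\rfloor=\sum_{i=0}^k b_iT^i\in K[T]$ if $k\ge 0$ and $\lfloor\alpha\rfloor=0$ otherwise. The continued fraction expansion $\alpha=\alpha_0=[a_0,a_1,\ldots]$ is obtained by $a_i=\lfloor\alpha_i\rfloor$, $\alpha_{i+1}=1/(\alpha_i-a_i)$ for $i\ge 0$ (it is infinite when $\alpha\notin K(T)$). The denominators of the convergents are defined by $q_{-2}=1$, $q_{-1}=0$, $q_i=a_iq_{i-1}+q_{i-2}$ for $i\ge 0$. *)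

theory Defs
  imports Complex_Main "HOL-Computational_Algebra.Computational_Algebra"
begin

text \<open>
  The field \<open>K((T\<^sup>-\<^sup>1))\<close> is the type \<open>'a fls\<close> of formal Laurent series whose formal variable
  \<^const>\<open>fls_X\<close> stands for \<open>T\<^sup>-\<^sup>1\<close>. Hence \<open>T\<close> is \<^const>\<open>fls_X_inv\<close>, and the coefficient of
  \<open>T\<^sup>i\<close> in \<open>f\<close> is \<open>fls_nth f (-i)\<close>.
\<close>

definition fls_of_T_poly :: "'a::comm_ring_1 poly \<Rightarrow> 'a fls" where
  "fls_of_T_poly p = poly (map_poly fls_const p) fls_X_inv"

definition T_rat_funs :: "'a::field fls set" where
  "T_rat_funs = {fls_of_T_poly a / fls_of_T_poly b | a b. b \<noteq> 0}"

text \<open>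
  The largest \<open>i\<close> with a nonzero coefficient of \<open>T\<^sup>i\<close> in \<open>f\<close> is \<open>- fls_subdegree f\<close>.
\<close>

definition fls_abs :: "real \<Rightarrow> 'a::field fls \<Rightarrow> real" where
  "fls_abs \<mu> f = (if f = 0 then 0 else \<mu> powi (- fls_subdegree f))"

text \<open>
  \<^const>\<open>fls_prpart\<close> collects the strictly positive powers of \<open>T\<close> only, so the constant term
  has to be added.
\<close>

definition fls_T_floor :: "'a::field fls \<Rightarrow> 'a poly" where
  "fls_T_floor f = fls_prpart f + [:fls_nth f 0:]"

lemma coeff_fls_T_floor: "coeff (fls_T_floor f) n = fls_nth f (- int n)"
  by (cases n) (simp_all add: fls_T_floor_def)

lemma fls_nth_of_T_poly:
  "fls_nth (fls_of_T_poly p) k = (if k \<le> 0 then coeff p (nat (- k)) else 0)"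
proof -
  have "degree (map_poly fls_const p) = degree p"
    by (rule degree_map_poly) simp
  hence "fls_of_T_poly p = (\<Sum>i\<le>degree p. fls_const (coeff p i) * fls_X_inv ^ i)"
    by (simp add: fls_of_T_poly_def poly_altdef coeff_map_poly)
  hence "fls_nth (fls_of_T_poly p) k = (\<Sum>i\<le>degree p. coeff p i * (if k = - int i then 1 else 0))"
    by (simp add: fls_nth_sum)
  also have "\<dots> = (\<Sum>i\<le>degree p. if i = nat (- k) \<and> k \<le> 0 then coeff p i else 0)"
    by (intro sum.cong) auto
  also have "\<dots> = (if k \<le> 0 then coeff p (nat (- k)) else 0)"
    by (auto simp: sum.delta' coeff_eq_0 not_le)
  finally show ?thesis .
qed

lemma fls_abs_of_T_poly:
  assumes "p \<noteq> 0"
  shows "fls_abs \<mu> (fls_of_T_poly p) = \<mu> ^ degree p"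
proof -
  have nz: "fls_nth (fls_of_T_poly p) (- int (degree p)) \<noteq> 0"
    using assms by (simp add: fls_nth_of_T_poly)
  have "fls_subdegree (fls_of_T_poly p) = - int (degree p)"
    using nz by (intro fls_subdegree_eqI) (auto simp: fls_nth_of_T_poly intro: coeff_eq_0)
  moreover have "fls_of_T_poly p \<noteq> 0"
    using nz by auto
  ultimately show ?thesis
    by (simp add: fls_abs_def)
qed

primrec cf_complete_quotient :: "'a::field fls \<Rightarrow> nat \<Rightarrow> 'a fls" where
  "cf_complete_quotient \<alpha> 0 = \<alpha>"
| "cf_complete_quotient \<alpha> (Suc i) =
     1 / (cf_complete_quotient \<alpha> i - fls_of_T_poly (fls_T_floor (cf_complete_quotient \<alpha> i)))"

definition cf_partial_quotient :: "'a::field fls \<Rightarrow> nat \<Rightarrow> 'a poly" where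
  "cf_partial_quotient \<alpha> i = fls_T_floor (cf_complete_quotient \<alpha> i)"

text \<open>
  Indices are shifted by two: \<open>cf_denom_shifted \<alpha> n\<close> is \<open>q\<^bsub>n-2\<^esub>\<close>, with the initial values
  \<open>q\<^bsub>-2\<^esub> = 1\<close> and \<open>q\<^bsub>-1\<^esub> = 0\<close>.
\<close>

fun cf_denom_shifted :: "'a::field fls \<Rightarrow> nat \<Rightarrow> 'a poly" where
  "cf_denom_shifted \<alpha> 0 = 1"
| "cf_denom_shifted \<alpha> (Suc 0) = 0"
| "cf_denom_shifted \<alpha> (Suc (Suc i)) =
     cf_partial_quotient \<alpha> i * cf_denom_shifted \<alpha> (Suc i) + cf_denom_shifted \<alpha> i"

definition cf_denom :: "'a::field fls \<Rightarrow> nat \<Rightarrow> 'a poly" where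
  "cf_denom \<alpha> i = cf_denom_shifted \<alpha> (i + 2)"

text \<open>Below, \<open>F\<close> is meant to be a subfield of the ambient field, here \<^const>\<open>T_rat_funs\<close>.\<close>

definition is_minimal_poly :: "'b::field set \<Rightarrow> 'b \<Rightarrow> 'b poly \<Rightarrow> bool" where
  "is_minimal_poly F x P \<longleftrightarrow>
     (\<forall>n. coeff P n \<in> F) \<and> lead_coeff P = 1 \<and> poly P x = 0 \<and>
     (\<forall>Q. (\<forall>n. coeff Q n \<in> F) \<longrightarrow> Q \<noteq> 0 \<longrightarrow> poly Q x = 0 \<longrightarrow> degree P \<le> degree Q)"

definition algebraic_of_degree :: "'b::field set \<Rightarrow> 'b \<Rightarrow> nat \<Rightarrow> bool" where
  "algebraic_of_degree F x d \<longleftrightarrow> (\<exists>P. is_minimal_poly F x P \<and> degree P = d)"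

end

theory Submission
  imports Defs "Jordan_Normal_Form.Determinant" "Jordan_Normal_Form.Char_Poly"
    "HOL-Combinatorics.Permutations" "HOL-Algebra.Algebraic_Closure_Type"
begin

text \<open>
  Let \<open>D\<^sub>i\<close> be the degree of \<open>q\<^sub>i\<close>. The theorem follows from an effective form of Roth's theorem over \<open>K(T)\<close>:
  for every \<open>h \<ge> 1\<close>, all \<open>i\<close> satisfy \<open>D\<^sub>i\<^sub>+\<^sub>1 \<le> (1 + 1/h) D\<^sub>i + E(h)\<close>, where \<open>E(h)\<close> grows at most
  exponentially in \<open>h\<close>. Iterating this inequality gives \<open>ln D\<^sub>i = O(i/h + h)\<close>, and the choice of \<open>h\<close> near
  \<open>sqrt (ln i)\<close> gives the claim; this part is \<open>log_growth_from_gaps\<close>.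

  The inequality comes from Steinmetz's Wronskian method. After multiplication by a polynomial, \<open>\<alpha>\<close>
  is a root of a monic polynomial \<open>P\<close> over \<open>K[T]\<close>. Let \<open>x\<^sub>0, \<dots>, x\<^sub>d\<^sub>-\<^sub>1\<close> be all its roots in a differential
  field, where \<open>x\<^sub>0\<close> plays the role of \<open>\<alpha>\<close>, and let \<open>V\<^sub>r\<close> be the space over the constants that is
  spanned by the products of some \<open>T\<^sup>j\<close> with \<open>j < r\<close> and a monomial in the \<open>x\<^sub>i\<close> with all exponents less than
  \<open>d\<close>. Permutations of the roots preserve the set of these products, and \<open>x\<^sub>0 V\<^sub>r\<close> lies in \<open>V\<^sub>r\<^sub>+\<^sub>s\<close> for a
  fixed \<open>s\<close>. Let \<open>n\<close> and \<open>m\<close> be the dimensions of \<open>V\<^sub>r\<^sub>+\<^sub>s\<close> and \<open>V\<^sub>r\<close>. They grow at most linearly in \<open>r\<close>, so that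
  \<open>n/m \<le> 1 + 1/h\<close> for some \<open>r\<close> that is polynomially bounded in \<open>h\<close>.

  For a convergent \<open>p/q\<close>, take the Wronskian of \<open>q v\<close> for \<open>v\<close> in a basis of \<open>V\<^sub>r\<^sub>+\<^sub>s\<close>, followed by \<open>p v\<close> for
  \<open>v\<close> in a basis of \<open>V\<^sub>r\<close>. The sum of the \<open>\<kappa>\<close>-th powers of these Wronskians over all choices of \<open>n + m\<close>
  products is symmetric in the roots, hence a polynomial in \<open>T\<close>, and it is nonzero for some \<open>\<kappa>\<close> unless \<open>q\<close>
  has small degree (\<open>exists_nonzero_wronskian\<close>). On the other hand, since \<open>x\<^sub>0 V\<^sub>r\<close> lies in \<open>V\<^sub>r\<^sub>+\<^sub>s\<close>, column
  operations turn \<open>p v\<close> into \<open>(p - q x\<^sub>0) v\<close>. At the place of \<open>\<alpha>\<close> the \<open>m\<close> last columns become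
  small, of size \<open>-D\<^sub>i\<^sub>+\<^sub>1\<close>, and the \<open>n\<close> first ones have size \<open>D\<^sub>i\<close>, up to bounded errors. A nonzero polynomial
  has nonnegative degree, so \<open>n D\<^sub>i - m D\<^sub>i\<^sub>+\<^sub>1\<close> is bounded from below (\<open>approximation_gap\<close>).

  The differential field is built by extending the constants to an algebraic closure and expanding the
  roots of \<open>P\<close> as power series at a point \<open>T = t\<^sub>0\<close> where they stay distinct (\<open>exists_conjugates\<close>).
  The place at infinity enters through \<open>\<alpha>\<close> alone: every polynomial relation of \<open>x\<^sub>0\<close> over \<open>K[T]\<close> also
  holds for \<open>\<alpha>\<close>, so that the size at infinity of an element of \<open>K[T][x\<^sub>0]\<close> is meaningful.
\<close>

(* The names coeff, monom, smult, degree and lead_coeff denote the operations on the type poly. *)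
hide_const (open) up_ring.coeff up_ring.monom module.smult Polynomials.degree Polynomials.lead_coeff

section \<open>Integer sequences with controlled gaps\<close>

lemma two_power_le_power: "(2::real) ^ j \<le> (1 + 1 / real h) ^ (h * j)" if "h \<ge> 1" for h j
proof -
  have "2 \<le> (1 + 1 / real h) ^ h"
    using Bernoulli_inequality[of "1 / real h" h, OF order_trans[of _ 0]] that by simp
  hence "2 ^ j \<le> ((1 + 1 / real h) ^ h) ^ j" by (rule power_mono) simp
  thus ?thesis by (simp add: power_mult)
qed

text \<open>
  Pigeonhole principle: if every step of length \<open>s\<close> up to \<open>s * L\<close> multiplied \<open>\<rho>\<close> by more than \<open>1 + 1/h\<close>, then
  \<open>\<rho>\<close> would outgrow its linear bound.
\<close>

lemma exists_slow_growth_step: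
  fixes \<rho> :: "nat \<Rightarrow> nat" and K s h L :: nat
  assumes \<rho>: "\<And>r. r \<ge> 1 \<Longrightarrow> 1 \<le> \<rho> r \<and> \<rho> r \<le> K * r" and s: "s \<ge> 1"
    and L: "real (K * (s * (L + 1))) < (1 + 1 / real h) ^ L"
  shows "\<exists>r\<ge>1. r \<le> s * L \<and> real (\<rho> (r + s)) \<le> (1 + 1 / real h) * real (\<rho> r)"
proof (rule ccontr)
  assume "\<not> ?thesis"
  hence *: "real (\<rho> (r + s)) > (1 + 1 / real h) * real (\<rho> r)" if "1 \<le> r" "r \<le> s * L" for r
    using that by (metis not_le)
  have step: "real (\<rho> (s * (t + 1))) \<ge> (1 + 1 / real h) ^ t" if "t \<le> L" for t
    using that
  proof (induction t)
    case 0
    thus ?case using \<rho>[of s] s by simp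
  next
    case (Suc t)
    have "s * (t + 1) \<le> s * L" using Suc.prems by (intro mult_left_mono) auto
    moreover have "1 \<le> s * (t + 1)" using s by simp
    ultimately have "real (\<rho> (s * (t + 1) + s)) > (1 + 1 / real h) * real (\<rho> (s * (t + 1)))"
      using * by blast
    moreover have "(1 + 1 / real h) * real (\<rho> (s * (t + 1))) \<ge> (1 + 1 / real h) * (1 + 1 / real h) ^ t"
      using Suc by (intro mult_left_mono) auto
    ultimately have "(1 + 1 / real h) ^ Suc t \<le> real (\<rho> (s * (t + 1) + s))" by simp
    moreover have "s * (t + 1) + s = s * (Suc t + 1)" by (simp add: algebra_simps)
    ultimately show ?case by (simp only:)
  qed
  have "s * (L + 1) \<ge> 1" using s by simp
  hence "\<rho> (s * (L + 1)) \<le> K * (s * (L + 1))" using \<rho> by blast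
  hence "real (\<rho> (s * (L + 1))) \<le> real (K * (s * (L + 1)))" by (simp only: of_nat_le_iff)
  thus False using step[of L] L by simp
qed

text \<open>
  Supplies an offset \<open>a\<close>, independent of \<open>h\<close>, for which \<open>L = h * (2 * h + a)\<close> satisfies the hypothesis of the
  pigeonhole lemma for all \<open>h\<close>.
\<close>

lemma exists_two_power_gt: "\<exists>a. N * (3 + a) < (2::nat) ^ a"
proof
  define m where "m = 3 * N + 1"
  have "N * (3 + 2 * m) < (3 * N + 1) * (m + 1)" by (simp add: algebra_simps)
  also have "\<dots> \<le> 2 ^ m * 2 ^ m"
    by (intro mult_mono) (simp_all add: m_def less_imp_le[OF less_exp] Suc_leI[OF less_exp] del: power_Suc)
  also have "\<dots> = 2 ^ (2 * m)" by (simp add: mult_2 power_add)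
  finally show "N * (3 + 2 * m) < 2 ^ (2 * m)" .
qed

text \<open>
  Adding \<open>h * E\<close> turns the affine recursion into a linear one.
\<close>

lemma affine_recursion_bound:
  fixes D :: "nat \<Rightarrow> nat" and E :: real
  assumes h: "h \<ge> 1" and E: "E \<ge> 0" and rec: "\<And>i. real (D (Suc i)) \<le> (1 + 1 / real h) * real (D i) + E"
  shows "real (D i) + real h * E \<le> (1 + 1 / real h) ^ i * (real (D 0) + real h * E)"
proof (induction i)
  case (Suc i)
  have "real (D (Suc i)) + real h * E \<le> (1 + 1 / real h) * (real (D i) + real h * E)"
  proof -
    have "(1 / real h) * (real h * E) = E" using h by simp
    hence "(1 + 1 / real h) * (real (D i) + real h * E) = (1 + 1 / real h) * real (D i) + real h * E + E"
      by (simp only: distrib_left distrib_right mult_1_left)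
    thus ?thesis using rec[of i] by linarith
  qed
  also have "\<dots> \<le> (1 + 1 / real h) * ((1 + 1 / real h) ^ i * (real (D 0) + real h * E))"
    by (intro mult_left_mono Suc.IH) simp
  finally show ?case by (simp add: mult_ac)
qed simp

text \<open>
  In the application \<open>D\<close> is the sequence of degrees of the denominators, and \<open>\<rho> r\<close> is the dimension of the space
  \<open>V\<^sub>r\<close>. The pigeonhole principle provides, for each \<open>h\<close>, an \<open>r\<close> with \<open>\<rho> (r + s) \<le> (1 + 1/h) \<rho> r\<close>, which
  turns the hypothesis into \<open>D (Suc i) \<le> (1 + 1/h) D i + E h\<close>. The final bound is optimized over \<open>h\<close>.
\<close>

lemma log_growth_from_gaps:
  fixes D \<rho> :: "nat \<Rightarrow> nat" and K s :: nat
  assumes mono: "\<And>i. D i < D (Suc i)"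
    and \<rho>: "\<And>r. r \<ge> 1 \<Longrightarrow> 1 \<le> \<rho> r \<and> \<rho> r \<le> K * r" and s: "s \<ge> 1"
    and gap: "\<And>r i. r \<ge> 1 \<Longrightarrow> K * (r + 1) < D i \<Longrightarrow> \<rho> r * D (Suc i) \<le> \<rho> (r + s) * D i + K * (r + 1) ^ 2"
  shows "\<exists>c>0. \<forall>i\<ge>2. ln (real (D i)) \<le> c * real i / sqrt (ln (real i))"
proof -
  have D_ge: "i \<le> D i" for i
  proof (induction i)
    case (Suc i)
    thus ?case using mono[of i] by linarith
  qed simp
  obtain a where a: "(K * s) * (3 + a) < 2 ^ a" using exists_two_power_gt by blast
  define L where "L h = h * (2 * h + a)" for h
  define R where "R h = s * L h" for h
  have h4: "h * h \<le> 4 ^ h" for h :: nat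
    using mult_mono[OF less_imp_le[OF less_exp[of h]] less_imp_le[OF less_exp[of h]]]
    by (simp flip: power_mult_distrib)
  have L_le: "L h + 1 \<le> (3 + a) * 4 ^ h" if "h \<ge> 1" for h
  proof -
    have "L h + 1 \<le> (3 + a) * (h * h)" using that
      by (cases h) (auto simp: L_def algebra_simps)
    also have "\<dots> \<le> (3 + a) * 4 ^ h" by (intro mult_left_mono h4) simp
    finally show ?thesis .
  qed
  have slow: "\<exists>r\<ge>1. r \<le> R h \<and> real (\<rho> (r + s)) \<le> (1 + 1 / real h) * real (\<rho> r)" if h: "h \<ge> 1" for h
    unfolding R_def
  proof (rule exists_slow_growth_step[OF \<rho> s])
    have "K * (s * (L h + 1)) \<le> (K * s) * ((3 + a) * 4 ^ h)"
      unfolding mult.assoc by (intro mult_left_mono L_le h) simp_all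
    also have "\<dots> = ((K * s) * (3 + a)) * 4 ^ h" by (simp add: mult.assoc)
    also have "\<dots> < 2 ^ a * 4 ^ h" using a by simp
    also have "\<dots> = 2 ^ (2 * h + a)" by (simp add: power_add power_mult)
    finally have "real (K * (s * (L h + 1))) < real (2 ^ (2 * h + a))" by (simp only: of_nat_less_iff)
    also have "\<dots> \<le> (1 + 1 / real h) ^ L h"
      using two_power_le_power[OF h, of "2 * h + a"] by (simp add: L_def)
    finally show "real (K * (s * (L h + 1))) < (1 + 1 / real h) ^ L h" .
  qed
  have gap_h: "real (D (Suc i)) \<le> (1 + 1 / real h) * real (D i) + real (K * (R h + 1) ^ 2)"
    if h: "h \<ge> 1" and Di: "K * (R h + 1) < D i" for h i
  proof -
    obtain r where r: "r \<ge> 1" "r \<le> R h" "real (\<rho> (r + s)) \<le> (1 + 1 / real h) * real (\<rho> r)"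
      using slow[OF h] by blast
    have "K * (r + 1) \<le> K * (R h + 1)" using r(2) by simp
    hence "\<rho> r * D (Suc i) \<le> \<rho> (r + s) * D i + K * (r + 1) ^ 2"
      by (intro gap[OF r(1)] le_less_trans[OF _ Di])
    also have "K * (r + 1) ^ 2 \<le> K * (R h + 1) ^ 2" using r(2) by (intro mult_left_mono power_mono) auto
    also have "\<dots> \<le> \<rho> r * (K * (R h + 1) ^ 2)" using \<rho>[OF r(1)] by simp
    finally have "\<rho> r * D (Suc i) \<le> \<rho> (r + s) * D i + \<rho> r * (K * (R h + 1) ^ 2)" by simp
    hence "real (\<rho> r) * real (D (Suc i)) \<le> real (\<rho> (r + s)) * real (D i) + real (\<rho> r) * real (K * (R h + 1) ^ 2)"
      by (simp only: of_nat_add[symmetric] of_nat_mult[symmetric] of_nat_le_iff)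
    also have "\<dots> \<le> ((1 + 1 / real h) * real (\<rho> r)) * real (D i) + real (\<rho> r) * real (K * (R h + 1) ^ 2)"
      by (intro add_right_mono mult_right_mono r(3)) simp
    also have "\<dots> = real (\<rho> r) * ((1 + 1 / real h) * real (D i) + real (K * (R h + 1) ^ 2))"
      by (simp add: algebra_simps)
    finally show ?thesis
      using \<rho>[OF r(1)] by (subst (asm) mult_le_cancel_left_pos) auto
  qed

  \<comment> \<open>The case \<open>h = 1\<close> leaves finitely many exceptions, which an additive constant absorbs. The
    resulting bound controls the exceptions for all larger \<open>h\<close>.\<close>
  define T where "T = K * (R 1 + 1)"
  define C2 where "C2 = K * (R 1 + 1) ^ 2 + (\<Sum>i\<le>T. D (Suc i))"
  have crude: "real (D (Suc i)) \<le> 2 * real (D i) + real C2" for i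
  proof (cases "T < D i")
    case True
    hence "real (D (Suc i)) \<le> (1 + 1 / real 1) * real (D i) + real (K * (R 1 + 1) ^ 2)"
      by (intro gap_h) (simp_all add: T_def)
    moreover have "real (K * (R 1 + 1) ^ 2) \<le> real C2" by (simp only: C2_def of_nat_le_iff le_add1)
    ultimately show ?thesis by (simp only: of_nat_1 div_by_1 one_add_one)
  next
    case False
    hence "i \<le> T" using D_ge[of i] by simp
    hence "D (Suc i) \<le> (\<Sum>i\<le>T. D (Suc i))" by (intro member_le_sum[of i _ "\<lambda>i. D (Suc i)"]) auto
    hence "D (Suc i) \<le> 2 * D i + C2" by (simp add: C2_def)
    thus ?thesis by (metis of_nat_add of_nat_le_iff of_nat_mult of_nat_numeral)
  qed
  define E where "E h = K * (R h + 1) ^ 2 + 2 * (K * (R h + 1)) + C2" for h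
  have rec: "real (D (Suc i)) \<le> (1 + 1 / real h) * real (D i) + real (E h)" if h: "h \<ge> 1" for h i
  proof (cases "K * (R h + 1) < D i")
    case True
    have "real (K * (R h + 1) ^ 2) \<le> real (E h)" by (simp only: E_def of_nat_le_iff)
    thus ?thesis using gap_h[OF h True] by linarith
  next
    case False
    hence "real (D i) \<le> real (K * (R h + 1))" by (simp only: of_nat_le_iff not_less)
    moreover have "real (2 * (K * (R h + 1)) + C2) \<le> real (E h)"
      by (simp only: E_def of_nat_le_iff)
    ultimately have "real (D (Suc i)) \<le> real (E h)" using crude[of i] by simp
    also have "\<dots> \<le> (1 + 1 / real h) * real (D i) + real (E h)" by simp
    finally show ?thesis .
  qed
  define B where "B = s * (3 + a) + 1"
  define A where "A = D 0 + K * B ^ 2 + 2 * (K * B) + C2"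
  have E_le: "D 0 + h * E h \<le> A * 32 ^ h" if h: "h \<ge> 1" for h
  proof -
    have "R h + 1 \<le> s * (L h + 1) + 1" by (simp add: R_def)
    also have "\<dots> \<le> s * ((3 + a) * 4 ^ h) + 1 * 4 ^ h"
      by (intro add_mono mult_left_mono L_le h) simp_all
    also have "\<dots> = B * 4 ^ h" by (simp add: B_def algebra_simps)
    finally have R1: "R h + 1 \<le> B * 4 ^ h" .
    have p: "(4::nat) ^ h \<le> 16 ^ h" by (intro power_mono) auto
    have "(R h + 1) ^ 2 \<le> (B * 4 ^ h) ^ 2" by (intro power_mono R1) simp
    also have "\<dots> = B ^ 2 * 16 ^ h"
      by (simp add: power_mult_distrib power_mult[symmetric] mult.commute[of h]) (simp add: power_mult)
    finally have R2: "(R h + 1) ^ 2 \<le> B ^ 2 * 16 ^ h" .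
    have "E h \<le> K * (B ^ 2 * 16 ^ h) + 2 * (K * (B * 16 ^ h)) + C2 * 16 ^ h"
      unfolding E_def using order_trans[OF R1 mult_left_mono[OF p, of B]] R2
      by (intro add_mono mult_left_mono) auto
    hence "E h \<le> (K * B ^ 2 + 2 * (K * B) + C2) * 16 ^ h" by (simp add: algebra_simps)
    moreover have "h \<le> 2 ^ h" by (rule less_imp_le[OF less_exp])
    ultimately have "h * E h \<le> 2 ^ h * ((K * B ^ 2 + 2 * (K * B) + C2) * 16 ^ h)" by (intro mult_mono) auto
    also have "\<dots> = (K * B ^ 2 + 2 * (K * B) + C2) * 32 ^ h"
      by (simp add: power_mult_distrib[symmetric])
    finally have "D 0 + h * E h \<le> D 0 * 32 ^ h + (K * B ^ 2 + 2 * (K * B) + C2) * 32 ^ h"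
      by (intro add_mono) simp_all
    also have "\<dots> = A * 32 ^ h" by (simp add: A_def algebra_simps)
    finally show ?thesis .
  qed
  define c3 where "c3 = ln (real A + 1) + ln 32"
  have c3: "c3 \<ge> 0" by (simp add: c3_def)
  have main: "ln (real (D i)) \<le> real i / real h + c3 * real h" if h: "h \<ge> 1" and i: "i \<ge> 2" for h i
  proof -
    have Dpos: "real (D i) > 0" using D_ge[of i] i by simp
    have "real (D i) \<le> real (D i) + real h * real (E h)" by simp
    also have "\<dots> \<le> (1 + 1 / real h) ^ i * (real (D 0) + real h * real (E h))"
      by (intro affine_recursion_bound rec h) simp
    also have "\<dots> \<le> (1 + 1 / real h) ^ i * ((real A + 1) * 32 ^ h)"
    proof (intro mult_left_mono)
      have "real (D 0 + h * E h) \<le> real (A * 32 ^ h)" using E_le[OF h] by (simp only: of_nat_le_iff)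
      thus "real (D 0) + real h * real (E h) \<le> (real A + 1) * 32 ^ h"
        by (simp add: algebra_simps add_increasing)
    qed simp
    also have "\<dots> \<le> exp (real i / real h) * ((real A + 1) * 32 ^ h)"
    proof (intro mult_right_mono)
      have "(1 + 1 / real h) ^ i \<le> exp (1 / real h) ^ i"
        by (intro power_mono exp_ge_add_one_self) simp
      thus "(1 + 1 / real h) ^ i \<le> exp (real i / real h)" by (simp flip: exp_of_nat_mult)
    qed simp
    finally have "ln (real (D i)) \<le> ln (exp (real i / real h) * ((real A + 1) * 32 ^ h))"
      using Dpos by (subst ln_le_cancel_iff) (auto intro!: mult_pos_pos add_nonneg_pos)
    also have "\<dots> = real i / real h + (ln (real A + 1) + real h * ln 32)"
    proof -
      have "real A + 1 > 0" by simp
      thus ?thesis by (simp add: ln_mult_pos ln_realpow)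
    qed
    also have "\<dots> \<le> real i / real h + c3 * real h"
    proof -
      have "ln (real A + 1) * 1 \<le> ln (real A + 1) * real h" using h by (intro mult_left_mono) auto
      thus ?thesis by (simp add: c3_def algebra_simps)
    qed
    finally show ?thesis .
  qed
  have "ln (real (D i)) \<le> (1 + 3 * c3) * real i / sqrt (ln (real i))" if i: "i \<ge> 2" for i
  proof -
    define y where "y = sqrt (ln (real i))"
    have y: "y > 0" using i by (simp add: y_def)
    have y2: "y ^ 2 = ln (real i)" using i by (simp add: y_def)
    \<comment> \<open>The bound \<open>i / h + c3 * h\<close> is applied with \<open>h\<close> near \<open>sqrt (ln i)\<close>; its second term is then negligible.\<close>
    define h where "h = nat \<lceil>y\<rceil>"
    have h: "h \<ge> 1" "y \<le> real h" "real h \<le> y + 1"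
      using y by (auto simp: h_def) linarith+
    have "y \<le> 1 + y ^ 2"
      using zero_le_power2[of "y - 1"] y by (simp add: power2_eq_square algebra_simps)
    moreover have "ln (real i) \<le> real i - 1" using i by (intro ln_le_minus_one) simp
    ultimately have "y * (y + 1) \<le> 3 * real i"
      using y2 i by (simp add: power2_eq_square algebra_simps)
    hence "y + 1 \<le> 3 * real i / y" using y by (simp add: field_simps)
    have "ln (real (D i)) \<le> real i / real h + c3 * real h" by (rule main[OF h(1) i])
    also have "\<dots> \<le> real i / y + c3 * (3 * real i / y)"
      using h y c3 \<open>y + 1 \<le> 3 * real i / y\<close> by (intro add_mono mult_left_mono divide_left_mono) auto
    also have "\<dots> = (1 + 3 * c3) * real i / y" by (simp add: algebra_simps add_divide_distrib)
    finally show ?thesis by (simp add: y_def)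
  qed
  moreover have "1 + 3 * c3 > 0" using c3 by simp
  ultimately show ?thesis by blast
qed

section \<open>Wronskians\<close>

locale derivation_field =
  fixes D :: "'o::field \<Rightarrow> 'o"
  assumes D_add: "D (x + y) = D x + D y"
    and D_mult: "D (x * y) = D x * y + x * D y"
begin

lemma D_0 [simp]: "D 0 = 0"
  using D_add[of 0 0] by (metis add.right_neutral add_left_cancel)

lemma D_1 [simp]: "D 1 = 0"
  using D_mult[of 1 1] by (metis add.right_neutral add_left_cancel mult.right_neutral mult.left_neutral)

lemma D_sum: "D (sum f A) = (\<Sum>x\<in>A. D (f x))"
  by (induction A rule: infinite_finite_induct) (simp_all add: D_add)

lemma D_uminus: "D (- x) = - D x"
  using D_add[of x "- x"] by (simp add: eq_neg_iff_add_eq_0 add.commute)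

lemma D_const_mult: "D c = 0 \<Longrightarrow> D (c * x) = c * D x"
  by (simp add: D_mult)

lemma Dn_const_mult: "D c = 0 \<Longrightarrow> (D ^^ n) (c * x) = c * (D ^^ n) x"
  by (induction n) (simp_all add: D_const_mult)

lemma Dn_sum: "(D ^^ n) (sum f A) = (\<Sum>x\<in>A. (D ^^ n) (f x))"
  by (induction n) (simp_all add: D_sum)

lemma Dn_add: "(D ^^ n) (x + y) = (D ^^ n) x + (D ^^ n) y"
  by (induction n) (simp_all add: D_add)

definition wr_mat :: "nat \<Rightarrow> (nat \<Rightarrow> 'o) \<Rightarrow> 'o mat" where
  "wr_mat N f = mat N N (\<lambda>(i, j). (D ^^ i) (f j))"

definition wronskian :: "nat \<Rightarrow> (nat \<Rightarrow> 'o) \<Rightarrow> 'o" where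
  "wronskian N f = det (wr_mat N f)"

lemma wronskian_cong: "(\<And>j. j < N \<Longrightarrow> f j = g j) \<Longrightarrow> wronskian N f = wronskian N g"
  unfolding wronskian_def wr_mat_def by (intro arg_cong[of _ _ det] eq_matI) auto

lemma wronskian_eq_0_if_relation:
  assumes const: "\<And>j. j < N \<Longrightarrow> D (c j) = 0"
    and nz: "j0 < N" "c j0 \<noteq> 0"
    and rel: "(\<Sum>j<N. c j * f j) = 0"
  shows "wronskian N f = 0"
proof -
  have "(\<Sum>j<N. (D ^^ i) (f j) * c j) = 0" for i
  proof -
    have "(\<Sum>j<N. (D ^^ i) (f j) * c j) = (\<Sum>j<N. (D ^^ i) (c j * f j))"
      by (intro sum.cong) (simp_all add: Dn_const_mult const mult.commute)
    also have "\<dots> = (D ^^ i) (\<Sum>j<N. c j * f j)"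
      by (simp add: Dn_sum)
    also have "\<dots> = 0"
      unfolding rel by (induction i) auto
    finally show ?thesis .
  qed
  hence "wr_mat N f *\<^sub>v vec N c = 0\<^sub>v N"
    by (intro eq_vecI) (simp_all add: wr_mat_def scalar_prod_def lessThan_atLeast0)
  moreover have "vec N c \<noteq> 0\<^sub>v N"
    using nz by (metis index_vec index_zero_vec(1))
  ultimately show ?thesis unfolding wronskian_def
    by (subst det_0_iff_vec_prod_zero[of _ N]) (auto simp: wr_mat_def intro!: exI[of _ "vec N c"])
qed

text \<open>
  The classical argument: if the first \<open>n\<close> functions are independent, then a linear relation between the columns
  of the matrix for \<open>n + 1\<close> functions can be normalized to have last coefficient 1. Differentiating it shows that
  the derivatives of the other coefficients form a relation between the first \<open>n\<close> columns, so they vanish.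
\<close>

lemma relation_if_wronskian_eq_0:
  assumes "wronskian N f = 0"
  shows "\<exists>c. (\<forall>j<N. D (c j) = 0) \<and> (\<exists>j<N. c j \<noteq> 0) \<and> (\<Sum>j<N. c j * f j) = 0"
  using assms
proof (induction N)
  case 0
  thus ?case by (simp add: wronskian_def wr_mat_def)
next
  case (Suc n)
  show ?case
  proof (cases "wronskian n f = 0")
    case True
    then obtain c where c: "\<forall>j<n. D (c j) = 0" "\<exists>j<n. c j \<noteq> 0" "(\<Sum>j<n. c j * f j) = 0"
      using Suc.IH by blast
    show ?thesis
      by (rule exI[of _ "\<lambda>j. if j < n then c j else 0"]) (use c in \<open>auto simp: less_Suc_eq\<close>)
  next
    case False
    from Suc.prems obtain v where v: "v \<in> carrier_vec (Suc n)" "v \<noteq> 0\<^sub>v (Suc n)"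
        "wr_mat (Suc n) f *\<^sub>v v = 0\<^sub>v (Suc n)"
      unfolding wronskian_def
      by (subst (asm) det_0_iff_vec_prod_zero[of _ "Suc n"]) (auto simp: wr_mat_def)
    have rel: "(\<Sum>j<Suc n. (D ^^ i) (f j) * v $ j) = 0" if "i < Suc n" for i
    proof -
      have "(wr_mat (Suc n) f *\<^sub>v v) $ i = 0"
        using v(3) that by simp
      thus ?thesis using that v(1)
        by (simp add: wr_mat_def scalar_prod_def lessThan_atLeast0)
    qed
    have trivial: "u j = 0" if "\<And>i. i < n \<Longrightarrow> (\<Sum>j<n. (D ^^ i) (f j) * u j) = 0" "j < n" for u j
    proof (rule ccontr)
      assume "u j \<noteq> 0"
      have "wr_mat n f *\<^sub>v vec n u = 0\<^sub>v n"
        using that(1) by (intro eq_vecI) (simp_all add: wr_mat_def scalar_prod_def lessThan_atLeast0)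
      moreover have "vec n u \<noteq> 0\<^sub>v n"
        using \<open>u j \<noteq> 0\<close> \<open>j < n\<close> by (metis index_vec index_zero_vec(1))
      ultimately have "det (wr_mat n f) = 0"
        by (subst det_0_iff_vec_prod_zero[of _ n]) (auto simp: wr_mat_def intro!: exI[of _ "vec n u"])
      thus False using False by (simp add: wronskian_def)
    qed
    have vn: "v $ n \<noteq> 0"
    proof
      assume 0: "v $ n = 0"
      have "v $ j = 0" if "j < n" for j
        by (rule trivial) (use rel 0 that in \<open>auto simp: less_Suc_eq\<close>)
      hence "v = 0\<^sub>v (Suc n)"
        using v(1) 0 by (intro eq_vecI) (auto simp: less_Suc_eq)
      thus False using v(2) by simp
    qed
    define c where "c j = v $ j / v $ n" for j
    have crel: "(\<Sum>j<Suc n. (D ^^ i) (f j) * c j) = 0" if "i < Suc n" for i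
      using rel[OF that] by (simp only: c_def times_divide_eq_right sum_divide_distrib[symmetric]) simp
    have cn: "c n = 1" using vn by (simp add: c_def)
    \<comment> \<open>Differentiate each relation and subtract the next one: only the derivatives of the
      coefficients remain, and the one of the last coefficient is zero.\<close>
    have "D (c j) = 0" if "j < n" for j
    proof (rule trivial)
      fix i assume i: "i < n"
      have "0 = D (\<Sum>j<Suc n. (D ^^ i) (f j) * c j)"
        using crel[of i] i by simp
      also have "\<dots> = (\<Sum>j<Suc n. (D ^^ Suc i) (f j) * c j) + (\<Sum>j<Suc n. (D ^^ i) (f j) * D (c j))"
        by (simp only: D_sum D_mult sum.distrib) simp
      also have "\<dots> = (\<Sum>j<n. (D ^^ i) (f j) * D (c j))"
        using crel[of "Suc i"] i cn by simp
      finally show "(\<Sum>j<n. (D ^^ i) (f j) * D (c j)) = 0" by simp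
    qed (use that in auto)
    moreover have "(\<Sum>j<Suc n. c j * f j) = 0"
      using crel[of 0] by (simp add: mult.commute)
    ultimately show ?thesis
      using cn by (intro exI[of _ c]) (auto simp: less_Suc_eq)
  qed
qed

text \<open>
  A combination with constant coefficients commutes with the derivation, so it acts on the columns of the
  Wronskian matrix by a unipotent matrix.
\<close>

lemma wronskian_column_operation:
  assumes nN: "n \<le> N"
    and const: "\<And>i j. D (C i j) = 0"
    and lo: "\<And>j. j < n \<Longrightarrow> g j = f j"
    and hi: "\<And>j. n \<le> j \<Longrightarrow> j < N \<Longrightarrow> g j = f j + (\<Sum>i<n. C i j * f i)"
  shows "wronskian N g = wronskian N f"
proof -
  define U where "U = mat N N (\<lambda>(i, j). (if i = j then 1 else 0) + (if i < n \<and> n \<le> j then C i j else 0))"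
  have U: "U \<in> carrier_mat N N" by (simp add: U_def)
  have detU: "det U = 1"
  proof -
    have "upper_triangular U" by (auto simp: upper_triangular_def U_def)
    hence "det U = prod_list (diag_mat U)" using U by (rule det_upper_triangular)
    also have "diag_mat U = map (\<lambda>i. 1) [0..<N]"
      unfolding diag_mat_def by (intro map_cong) (auto simp: U_def)
    also have "prod_list \<dots> = 1" by (induction N) auto
    finally show ?thesis .
  qed
  have "wr_mat N g = wr_mat N f * U"
  proof (rule eq_matI)
    fix i j assume "i < dim_row (wr_mat N f * U)" "j < dim_col (wr_mat N f * U)"
    hence ij: "i < N" "j < N" by (auto simp: U_def wr_mat_def)
    have "(wr_mat N f * U) $$ (i, j) =
        (\<Sum>k<N. (D ^^ i) (f k) * ((if k = j then 1 else 0) + (if k < n \<and> n \<le> j then C k j else 0)))"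
      using ij by (simp add: wr_mat_def U_def scalar_prod_def lessThan_atLeast0)
    also have "\<dots> = (\<Sum>k<N. if k = j then (D ^^ i) (f k) else 0) +
        (\<Sum>k<N. if k < n \<and> n \<le> j then (D ^^ i) (f k) * C k j else 0)"
      unfolding sum.distrib[symmetric] by (intro sum.cong) (auto simp: algebra_simps)
    also have "(\<Sum>k<N. if k = j then (D ^^ i) (f k) else 0) = (D ^^ i) (f j)"
      using ij by simp
    also have "(\<Sum>k<N. if k < n \<and> n \<le> j then (D ^^ i) (f k) * C k j else 0) =
        (if n \<le> j then (\<Sum>k<n. C k j * (D ^^ i) (f k)) else 0)"
      using nN by (auto intro!: sum.mono_neutral_cong_right split: if_splits simp: mult.commute)
    also have "(D ^^ i) (f j) + \<dots> = (D ^^ i) (g j)"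
      using ij lo[of j] hi[of j]
      by (auto simp: Dn_add Dn_sum Dn_const_mult[OF const])
    finally show "wr_mat N g $$ (i, j) = (wr_mat N f * U) $$ (i, j)"
      using ij by (simp add: wr_mat_def)
  qed (auto simp: wr_mat_def U_def)
  hence "det (wr_mat N g) = det (wr_mat N f) * det U"
    using U by (simp add: det_mult[of _ N] wr_mat_def)
  thus ?thesis by (simp add: wronskian_def detU)
qed

end

section \<open>Symmetric functions over a filtered ring\<close>

text \<open>
  Newton's identities between power sums and elementary symmetric functions, in the form of the logarithmic
  derivative of the product of all \<open>1 - x i * X\<close>.
\<close>

lemma power_sums_generating_function:
  fixes x :: "'i \<Rightarrow> 'o::field"
  assumes "finite I"
  shows "(\<Prod>i\<in>I. 1 - fps_const (x i) * fps_X) * (\<Sum>i\<in>I. Abs_fps (\<lambda>n. x i ^ n)) =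
    of_nat (card I) * (\<Prod>i\<in>I. 1 - fps_const (x i) * fps_X) -
      fps_X * fps_deriv (\<Prod>i\<in>I. 1 - fps_const (x i) * fps_X)"
  using assms
proof (induction I rule: finite_induct)
  case (insert a I)
  define Q where "Q = (\<Prod>i\<in>I. 1 - fps_const (x i) * fps_X)"
  define G where "G = (\<Sum>i\<in>I. Abs_fps (\<lambda>n. x i ^ n))"
  define Ga where "Ga = Abs_fps (\<lambda>n. x a ^ n)"
  define L where "L = 1 - fps_const (x a) * fps_X"
  have geo: "L * Ga = 1"
  proof (rule fps_ext)
    fix n show "(L * Ga) $ n = 1 $ n"
      by (cases n) (simp_all add: L_def Ga_def algebra_simps mult.assoc fps_X_mult_nth)
  qed
  have dL: "fps_deriv L = - fps_const (x a)"
    by (simp add: L_def)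
  have IH: "Q * G = of_nat (card I) * Q - fps_X * fps_deriv Q"
    using insert.IH by (simp add: Q_def G_def)
  have "(L * Q) * (Ga + G) = (L * Ga) * Q + L * (Q * G)"
    by (simp add: algebra_simps)
  also have "\<dots> = Q + L * (of_nat (card I) * Q - fps_X * fps_deriv Q)"
    by (simp add: geo IH)
  also have "\<dots> = L * Q + fps_X * fps_const (x a) * Q + L * (of_nat (card I) * Q - fps_X * fps_deriv Q)"
    by (simp add: L_def algebra_simps)
  also have "\<dots> = of_nat (Suc (card I)) * (L * Q) - fps_X * fps_deriv (L * Q)"
    by (simp add: dL algebra_simps del: fps_const_neg)
  finally show ?case
    using insert.hyps by (simp add: Q_def G_def L_def Ga_def)
qed simp

text \<open>
  \<open>R t\<close> consists of the elements of size at most \<open>t\<close> in some ring, on a logarithmic scale. Two filtrations are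
  used: the degree on polynomials in \<open>T\<close>, and the size at infinity on polynomials in \<open>T\<close> and \<open>\<alpha>\<close>. In the second one
  the size may be negative.
\<close>

locale weighted_subrings =
  fixes R :: "int \<Rightarrow> 'o::field_char_0 set"
  assumes R_0: "0 \<in> R t"
    and R_rat: "of_rat a \<in> R 0"
    and R_add: "y \<in> R t \<Longrightarrow> z \<in> R t \<Longrightarrow> y + z \<in> R t"
    and R_mult: "y \<in> R s \<Longrightarrow> z \<in> R t \<Longrightarrow> y * z \<in> R (s + t)"
    and R_mono: "s \<le> t \<Longrightarrow> y \<in> R s \<Longrightarrow> y \<in> R t"
begin

lemma R_rat_mult: "y \<in> R t \<Longrightarrow> of_rat a * y \<in> R t"
  using R_mult[OF R_rat[of a], of y t] by simp

lemma R_of_int_mult: "y \<in> R t \<Longrightarrow> of_int a * y \<in> R t"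
  using R_rat_mult[of y t "of_int a"] by simp

lemma R_of_nat: "of_nat n \<in> R 0"
  using R_rat[of "of_nat n"] by simp

lemma R_uminus: "y \<in> R t \<Longrightarrow> - y \<in> R t"
  using R_of_int_mult[of y t "-1"] by simp

lemma R_diff: "y \<in> R t \<Longrightarrow> z \<in> R t \<Longrightarrow> y - z \<in> R t"
  using R_add[of y t "- z"] R_uminus by simp

lemma R_sum: "(\<And>a. a \<in> A \<Longrightarrow> f a \<in> R t) \<Longrightarrow> sum f A \<in> R t"
  by (induction A rule: infinite_finite_induct) (auto simp: R_0 R_add)

lemma R_power: "y \<in> R t \<Longrightarrow> y ^ n \<in> R (int n * t)"
  by (induction n) (use R_of_nat[of 1] in \<open>auto simp: R_mult algebra_simps\<close>)

text \<open>
  Newton's identities express power sums recursively by the coefficients of the polynomial with roots \<open>x i\<close>. The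
  weights say that each root counts as an element of size \<open>c\<close>.
\<close>

lemma power_sum_in_R:
  assumes fin: "finite I"
    and coeffs: "\<And>j. j \<le> card I \<Longrightarrow> coeff (\<Prod>i\<in>I. [:- x i, 1:]) (card I - j) \<in> R (int (c * j))"
  shows "(\<Sum>i\<in>I. x i ^ j) \<in> R (int (c * j))"
proof -
  define Q where "Q = (\<Prod>i\<in>I. 1 - fps_const (x i) * fps_X)"
  define P where "P = (\<Prod>i\<in>I. [:- x i, 1:])"
  have degP: "degree P = card I"
    unfolding P_def using fin by (subst degree_prod_sum_eq) auto
  have reflect: "reflect_poly [:- a, 1:] = [:1, - a:]" for a :: 'o
    by (simp add: reflect_poly_def)
  have "fps_of_poly (reflect_poly P) = (\<Prod>i\<in>I. fps_of_poly [:1, - x i:])"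
    by (simp add: P_def reflect_poly_prod fps_of_poly_prod reflect)
  also have "\<dots> = Q"
    unfolding Q_def by (intro prod.cong) (simp_all add: fps_of_poly_pCons fps_of_poly_const)
  finally have "Q $ j = coeff (reflect_poly P) j" for j
    by (metis fps_of_poly_nth)
  hence Qj: "Q $ j = (if j \<le> card I then coeff P (card I - j) else 0)" for j
    by (auto simp: coeff_reflect_poly degP)
  hence QR: "Q $ j \<in> R (int (c * j))" for j
    using coeffs R_0 by (auto simp: P_def)
  have Q0: "Q $ 0 = 1"
  proof -
    have "lead_coeff P = 1" unfolding P_def by (subst lead_coeff_prod) auto
    thus ?thesis using Qj[of 0] by (simp add: degP)
  qed
  show ?thesis
  proof (induction j rule: less_induct)
    case (less n)
    define p where "p j = (\<Sum>i\<in>I. x i ^ j)" for j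
    have "(Q * (\<Sum>i\<in>I. Abs_fps (\<lambda>n. x i ^ n))) $ n = (of_nat (card I) * Q - fps_X * fps_deriv Q) $ n"
      unfolding Q_def power_sums_generating_function[OF fin] ..
    moreover have "(Q * (\<Sum>i\<in>I. Abs_fps (\<lambda>n. x i ^ n))) $ n = (\<Sum>j=0..n. Q $ j * p (n - j))"
      by (simp add: fps_mult_nth fps_sum_nth p_def)
    moreover have "\<dots> = p n + (\<Sum>j=Suc 0..n. Q $ j * p (n - j))"
      by (subst sum.atLeast_Suc_atMost) (simp_all add: Q0)
    moreover have "(of_nat (card I) * Q - fps_X * fps_deriv Q) $ n = of_int (int (card I) - int n) * Q $ n"
      by (cases n) (simp_all add: algebra_simps fps_mult_of_nat_nth)
    ultimately have "p n = of_int (int (card I) - int n) * Q $ n - (\<Sum>j=Suc 0..n. Q $ j * p (n - j))"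
      by (simp add: algebra_simps)
    also have "\<dots> \<in> R (int (c * n))"
    proof (intro R_diff R_of_int_mult QR R_sum)
      fix j assume j: "j \<in> {Suc 0..n}"
      hence "p (n - j) \<in> R (int (c * (n - j)))"
        unfolding p_def by (intro less) auto
      moreover have "int (c * n) = int (c * j) + int (c * (n - j))"
        using j by (simp add: algebra_simps of_nat_diff)
      ultimately show "Q $ j * p (n - j) \<in> R (int (c * n))"
        using R_mult[OF QR[of j]] by presburger
    qed
    finally show ?case by (simp add: p_def)
  qed
qed

end

locale weighted_symmetric = weighted_subrings R for R :: "int \<Rightarrow> 'o::field_char_0 set" +
  fixes x :: "nat \<Rightarrow> 'o" and I :: "nat set" and c :: nat
  assumes finite_I: "finite I"
    and power_sums: "(\<Sum>i\<in>I. x i ^ j) \<in> R (int (c * j))"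
begin

text \<open>
  Partial permutations of \<open>I\<close>. Sums over these allow an induction on the number of variables that occur in a monomial.
\<close>

definition inj_maps :: "nat set \<Rightarrow> (nat \<Rightarrow> nat) set" where
  "inj_maps A = {\<tau> \<in> A \<rightarrow>\<^sub>E I. inj_on \<tau> A}"

lemma finite_inj_maps: "finite A \<Longrightarrow> finite (inj_maps A)"
  unfolding inj_maps_def using finite_I by (intro finite_subset[OF _ finite_PiE[of A "\<lambda>_. I"]]) auto

lemma sum_inj_maps_insert:
  assumes "a \<notin> A" "finite A"
  shows "(\<Sum>\<tau>\<in>inj_maps (insert a A). F \<tau>) = (\<Sum>\<tau>\<in>inj_maps A. \<Sum>i\<in>I - \<tau> ` A. F (\<tau>(a := i)))"
proof -
  have "(\<Sum>\<tau>\<in>inj_maps A. \<Sum>i\<in>I - \<tau> ` A. F (\<tau>(a := i))) =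
      (\<Sum>(\<tau>, i)\<in>Sigma (inj_maps A) (\<lambda>\<tau>. I - \<tau> ` A). F (\<tau>(a := i)))"
    using assms finite_I by (subst sum.Sigma) (auto simp: finite_inj_maps)
  also have "\<dots> = (\<Sum>\<tau>\<in>inj_maps (insert a A). F \<tau>)"
  proof (rule sum.reindex_bij_witness[of _ "\<lambda>\<tau>. (\<tau>(a := undefined), \<tau> a)" "\<lambda>(\<tau>, i). \<tau>(a := i)"], goal_cases)
    case (1 p)
    then obtain \<tau> i where p: "p = (\<tau>, i)" "\<tau> \<in> A \<rightarrow>\<^sub>E I"
      by (auto simp: inj_maps_def)
    have "\<tau> a = undefined" using p(2) assms(1) by (rule PiE_arb)
    thus ?case using p(1) by (simp add: fun_upd_idem)
  next
    case (2 p)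
    then obtain \<tau> i where p: "p = (\<tau>, i)" "\<tau> \<in> A \<rightarrow>\<^sub>E I" "inj_on \<tau> A" "i \<in> I" "i \<notin> \<tau> ` A"
      by (auto simp: inj_maps_def)
    have "inj_on (\<tau>(a := i)) (insert a A)"
      using p(3,5) assms(1) by (auto simp: inj_on_def)
    moreover have "\<tau>(a := i) \<in> insert a A \<rightarrow>\<^sub>E I"
      using p(2,4) by (simp add: PiE_fun_upd)
    ultimately show ?case using p(1) by (simp add: inj_maps_def)
  next
    case (3 \<tau>)
    thus ?case by simp
  next
    case (4 \<tau>)
    hence \<tau>: "inj_on \<tau> (insert a A)" "\<tau> \<in> insert a A \<rightarrow>\<^sub>E I" by (simp_all add: inj_maps_def)
    have im: "\<tau>(a := undefined) ` A = \<tau> ` A"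
      using assms(1) by (intro image_cong) auto
    have "inj_on (\<tau>(a := undefined)) A"
      using \<tau>(1) assms(1) by (subst inj_on_cong[of _ _ \<tau>]) auto
    moreover have "\<tau>(a := undefined) \<in> A \<rightarrow>\<^sub>E I"
      using assms(1) \<tau>(2) by (rule fun_upd_in_PiE)
    moreover have "\<tau> a \<in> I - \<tau> ` A"
      using \<tau> assms(1) by auto
    ultimately show ?case by (simp only: inj_maps_def im mem_Sigma_iff mem_Collect_eq simp_thms)
  next
    case (5 p)
    show ?case by (cases p) simp
  qed
  finally show ?thesis ..
qed

text \<open>
  Summing the last variable over all unused roots gives a full power sum minus the terms where the last variable
  coincides with an earlier one; such a term is a monomial in fewer variables.
\<close>

lemma monomial_inj_sum:
  assumes "finite A"
  shows "(\<Sum>\<tau>\<in>inj_maps A. \<Prod>a\<in>A. x (\<tau> a) ^ k a) \<in> R (int (c * (\<Sum>a\<in>A. k a)))"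
  using assms
proof (induction A arbitrary: k rule: finite_induct)
  case empty
  have "inj_maps {} = {\<lambda>_. undefined}" by (auto simp: inj_maps_def)
  thus ?case using R_of_nat[of 1] by simp
next
  case (insert a A)
  define S where "S k = (\<Sum>\<tau>\<in>inj_maps A. \<Prod>b\<in>A. x (\<tau> b) ^ k b)" for k
  have SR: "S k \<in> R (int (c * (\<Sum>b\<in>A. k b)))" for k
    unfolding S_def by (rule insert.IH)
  define p where "p = (\<Sum>i\<in>I. x i ^ k a)"
  have "(\<Sum>\<tau>\<in>inj_maps (insert a A). \<Prod>b\<in>insert a A. x (\<tau> b) ^ k b) =
      (\<Sum>\<tau>\<in>inj_maps A. \<Sum>i\<in>I - \<tau> ` A. \<Prod>b\<in>insert a A. x ((\<tau>(a := i)) b) ^ k b)"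
    using insert.hyps by (rule_tac sum_inj_maps_insert)
  also have "\<dots> = (\<Sum>\<tau>\<in>inj_maps A. (p - (\<Sum>b\<in>A. x (\<tau> b) ^ k a)) * (\<Prod>b\<in>A. x (\<tau> b) ^ k b))"
  proof (rule sum.cong)
    fix \<tau> assume \<tau>: "\<tau> \<in> inj_maps A"
    have "(\<Sum>i\<in>I - \<tau> ` A. \<Prod>b\<in>insert a A. x ((\<tau>(a := i)) b) ^ k b) =
        (\<Sum>i\<in>I - \<tau> ` A. x i ^ k a * (\<Prod>b\<in>A. x (\<tau> b) ^ k b))"
    proof (rule sum.cong)
      fix i
      have "(\<Prod>b\<in>A. x ((\<tau>(a := i)) b) ^ k b) = (\<Prod>b\<in>A. x (\<tau> b) ^ k b)"
        using insert.hyps by (intro prod.cong) auto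
      thus "(\<Prod>b\<in>insert a A. x ((\<tau>(a := i)) b) ^ k b) = x i ^ k a * (\<Prod>b\<in>A. x (\<tau> b) ^ k b)"
        using insert.hyps by simp
    qed simp
    also have "\<dots> = (\<Sum>i\<in>I - \<tau> ` A. x i ^ k a) * (\<Prod>b\<in>A. x (\<tau> b) ^ k b)"
      by (simp add: sum_distrib_right)
    also have "(\<Sum>i\<in>I - \<tau> ` A. x i ^ k a) = p - (\<Sum>i\<in>\<tau> ` A. x i ^ k a)"
      unfolding p_def using \<tau> finite_I by (subst sum_diff) (auto simp: inj_maps_def)
    also have "(\<Sum>i\<in>\<tau> ` A. x i ^ k a) = (\<Sum>b\<in>A. x (\<tau> b) ^ k a)"
      using \<tau> by (subst sum.reindex) (auto simp: inj_maps_def)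
    finally show "(\<Sum>i\<in>I - \<tau> ` A. \<Prod>b\<in>insert a A. x ((\<tau>(a := i)) b) ^ k b) =
       (p - (\<Sum>b\<in>A. x (\<tau> b) ^ k a)) * (\<Prod>b\<in>A. x (\<tau> b) ^ k b)" .
  qed simp
  also have "\<dots> = p * S k - (\<Sum>\<tau>\<in>inj_maps A. \<Sum>b\<in>A. x (\<tau> b) ^ k a * (\<Prod>b\<in>A. x (\<tau> b) ^ k b))"
    by (simp add: S_def sum_distrib_left sum_distrib_right sum_subtractf left_diff_distrib)
  also have "(\<Sum>\<tau>\<in>inj_maps A. \<Sum>b\<in>A. x (\<tau> b) ^ k a * (\<Prod>b\<in>A. x (\<tau> b) ^ k b)) =
      (\<Sum>b\<in>A. S (k(b := k b + k a)))"
    unfolding S_def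
  proof (subst sum.swap, intro sum.cong refl)
    fix b \<tau> assume b: "b \<in> A"
    have "(\<Prod>b'\<in>A - {b}. x (\<tau> b') ^ (k(b := k b + k a)) b') = (\<Prod>b'\<in>A - {b}. x (\<tau> b') ^ k b')"
      by (intro prod.cong) auto
    thus "x (\<tau> b) ^ k a * (\<Prod>b\<in>A. x (\<tau> b) ^ k b) = (\<Prod>b'\<in>A. x (\<tau> b') ^ (k(b := k b + k a)) b')"
      using b insert.hyps(1) by (simp add: prod.remove[of A b] power_add mult_ac)
  qed
  also have "p * S k - (\<Sum>b\<in>A. S (k(b := k b + k a))) \<in> R (int (c * (\<Sum>b\<in>insert a A. k b)))"
  proof (intro R_diff R_sum)
    have "p * S k \<in> R (int (c * k a) + int (c * (\<Sum>b\<in>A. k b)))"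
      unfolding p_def by (intro R_mult power_sums SR)
    thus "p * S k \<in> R (int (c * (\<Sum>b\<in>insert a A. k b)))"
      using insert.hyps by (simp add: algebra_simps)
  next
    fix b assume b: "b \<in> A"
    have "(\<Sum>b'\<in>A. (k(b := k b + k a)) b') = k b + k a + (\<Sum>b'\<in>A - {b}. (k(b := k b + k a)) b')"
      using b insert.hyps(1) by (simp add: sum.remove)
    also have "(\<Sum>b'\<in>A - {b}. (k(b := k b + k a)) b') = (\<Sum>b'\<in>A - {b}. k b')"
      by (intro sum.cong) auto
    also have "k b + k a + \<dots> = (\<Sum>b\<in>insert a A. k b)"
      using b insert.hyps by (simp add: sum.remove[of A b])
    finally show "S (k(b := k b + k a)) \<in> R (int (c * (\<Sum>b\<in>insert a A. k b)))"
      using SR[of "k(b := k b + k a)"] by (simp only:)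
  qed
  finally show ?case .
qed

lemma monomial_sym_sum:
  "(\<Sum>\<tau> | \<tau> permutes I. \<Prod>i\<in>I. x (\<tau> i) ^ k i) \<in> R (int (c * (\<Sum>i\<in>I. k i)))"
proof -
  have "(\<Sum>\<tau> | \<tau> permutes I. \<Prod>i\<in>I. x (\<tau> i) ^ k i) = (\<Sum>\<tau>\<in>inj_maps I. \<Prod>i\<in>I. x (\<tau> i) ^ k i)"
  proof (rule sum.reindex_bij_witness[of _ "\<lambda>\<tau> i. if i \<in> I then \<tau> i else i" "\<lambda>\<tau>. restrict \<tau> I"], goal_cases)
    case (1 \<tau>)
    thus ?case by (auto simp: permutes_def fun_eq_iff)
  next
    case (2 \<tau>)
    hence \<tau>: "\<tau> permutes I" by simp
    thus ?case using permutes_in_image[OF \<tau>] permutes_inj_on[OF \<tau>] by (auto simp: inj_maps_def inj_on_def)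
  next
    case (3 \<tau>)
    thus ?case by (auto simp: inj_maps_def PiE_def extensional_def fun_eq_iff)
  next
    case (4 \<tau>)
    hence inj: "inj_on \<tau> I" and im: "\<tau> ` I \<subseteq> I" by (auto simp: inj_maps_def)
    hence "\<tau> ` I = I" using finite_I by (metis endo_inj_surj)
    hence "bij_betw \<tau> I I" using inj by (simp add: bij_betw_def)
    hence "bij_betw (\<lambda>i. if i \<in> I then \<tau> i else i) I I"
      by (subst bij_betw_cong[of _ _ \<tau>]) auto
    thus ?case by (auto intro: bij_imp_permutes)
  next
    case (5 \<tau>)
    show ?case by (intro prod.cong) auto
  qed
  thus ?thesis using monomial_inj_sum[OF finite_I, of k] by simp
qed

text \<open>
  Polynomials over \<open>R\<close> in the roots, represented as functions of a permutation \<open>\<tau>\<close> that substitutes \<open>x (\<tau> i)\<close>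
  for the \<open>i\<close>-th variable. The index \<open>t\<close> bounds the weighted degree, where each variable has weight \<open>c\<close>. Only the
  values at permutations of \<open>I\<close> matter, which is the purpose of the last rule: a root with index outside of \<open>I\<close> counts
  as a constant.
\<close>

inductive poly_fun :: "int \<Rightarrow> ((nat \<Rightarrow> nat) \<Rightarrow> 'o) \<Rightarrow> bool" where
  monom: "r \<in> R s \<Longrightarrow> s + int (c * (\<Sum>i\<in>I. k i)) \<le> t \<Longrightarrow> poly_fun t (\<lambda>\<tau>. r * (\<Prod>i\<in>I. x (\<tau> i) ^ k i))"
| add: "poly_fun t F \<Longrightarrow> poly_fun t G \<Longrightarrow> poly_fun t (\<lambda>\<tau>. F \<tau> + G \<tau>)"
| on_perms: "poly_fun t F \<Longrightarrow> (\<And>\<tau>. \<tau> permutes I \<Longrightarrow> G \<tau> = F \<tau>) \<Longrightarrow> poly_fun t G"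

lemma poly_fun_mono: "poly_fun s F \<Longrightarrow> s \<le> t \<Longrightarrow> poly_fun t F"
proof (induction rule: poly_fun.induct)
  case (monom r s k t')
  show ?case by (rule poly_fun.monom[OF monom(1)]) (use monom in linarith)
next
  case (add t' F G)
  thus ?case by (blast intro: poly_fun.add)
next
  case (on_perms t' F G)
  show ?case by (rule poly_fun.on_perms[OF on_perms(3)[OF on_perms(4)] on_perms(2)])
qed

lemma poly_fun_const: "r \<in> R t \<Longrightarrow> poly_fun t (\<lambda>_. r)"
  using monom[of r t "\<lambda>_. 0" t] by simp

lemma poly_fun_var:
  assumes "i \<in> I"
  shows "poly_fun (int c) (\<lambda>\<tau>. x (\<tau> i))"
proof -
  have "(\<Prod>j\<in>I. x (\<tau> j) ^ (if j = i then 1 else 0)) = x (\<tau> i)" for \<tau>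
    using assms finite_I by (subst prod.remove[of I i]) (auto intro!: prod.neutral)
  moreover have "(\<Sum>j\<in>I. if j = i then 1 else 0) = (1::nat)"
    using assms finite_I by simp
  ultimately show ?thesis
    using poly_fun.monom[OF R_of_nat[of 1], of "\<lambda>j. if j = i then 1 else 0" "int c"]
    by (simp only: ) simp
qed

lemma poly_fun_mult:
  assumes "poly_fun s F" "poly_fun t G"
  shows "poly_fun (s + t) (\<lambda>\<tau>. F \<tau> * G \<tau>)"
  using assms
proof (induction rule: poly_fun.induct)
  case (monom r s k s')
  from monom(3) show ?case
  proof (induction rule: poly_fun.induct)
    case (monom r2 s2 k2 t2)
    have "(r * (\<Prod>i\<in>I. x (\<tau> i) ^ k i)) * (r2 * (\<Prod>i\<in>I. x (\<tau> i) ^ k2 i)) =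
        (r * r2) * (\<Prod>i\<in>I. x (\<tau> i) ^ (k i + k2 i))" for \<tau>
      by (simp add: power_add prod.distrib mult_ac)
    moreover have "(s + s2) + int (c * (\<Sum>i\<in>I. k i + k2 i)) \<le> s' + t2"
      using \<open>s + int (c * sum k I) \<le> s'\<close> monom(2) by (simp add: sum.distrib algebra_simps)
    ultimately show ?case
      using poly_fun.monom[OF R_mult[OF \<open>r \<in> R s\<close> \<open>r2 \<in> R s2\<close>], of "\<lambda>i. k i + k2 i" "s' + t2"]
      by (simp only:)
  next
    case (add t F G)
    thus ?case by (simp add: distrib_left poly_fun.add)
  next
    case (on_perms t F G)
    show ?case by (rule poly_fun.on_perms[OF on_perms(3)]) (simp add: on_perms(2))
  qed
next
  case (add t F G)
  thus ?case by (simp add: distrib_right poly_fun.add)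
next
  case (on_perms t F G)
  show ?case by (rule poly_fun.on_perms[OF on_perms(3)[OF on_perms(4)]]) (simp add: on_perms(2))
qed

lemma poly_fun_sum: "(\<And>a. a \<in> A \<Longrightarrow> poly_fun t (F a)) \<Longrightarrow> poly_fun t (\<lambda>\<tau>. \<Sum>a\<in>A. F a \<tau>)"
  by (induction A rule: infinite_finite_induct) (auto intro: poly_fun_const R_0 add)

lemma poly_fun_prod:
  "(\<And>a. a \<in> A \<Longrightarrow> poly_fun (w a) (F a)) \<Longrightarrow> poly_fun (sum w A) (\<lambda>\<tau>. \<Prod>a\<in>A. F a \<tau>)"
  by (induction A rule: infinite_finite_induct)
     (use R_of_nat[of 1] in \<open>auto intro: poly_fun_const poly_fun_mult\<close>)

lemma poly_fun_power: "poly_fun t F \<Longrightarrow> poly_fun (int n * t) (\<lambda>\<tau>. F \<tau> ^ n)"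
  using poly_fun_prod[of "{..<n}" "\<lambda>_. t" "\<lambda>_. F"] by simp

lemma poly_fun_R_mult: "r \<in> R s \<Longrightarrow> poly_fun t F \<Longrightarrow> poly_fun (s + t) (\<lambda>\<tau>. r * F \<tau>)"
  by (intro poly_fun_mult poly_fun_const)

lemma poly_fun_of_int_mult: "poly_fun t F \<Longrightarrow> poly_fun t (\<lambda>\<tau>. of_int n * F \<tau>)"
  using poly_fun_R_mult[OF R_rat[of "of_int n"]] by fastforce

lemma poly_fun_sym_sum:
  assumes "poly_fun t F"
  shows "(\<Sum>\<tau> | \<tau> permutes I. F \<tau>) \<in> R t"
  using assms
proof (induction rule: poly_fun.induct)
  case (monom r s k t)
  have "(\<Sum>\<tau> | \<tau> permutes I. r * (\<Prod>i\<in>I. x (\<tau> i) ^ k i)) \<in> R (s + int (c * (\<Sum>i\<in>I. k i)))"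
    unfolding sum_distrib_left[symmetric] by (intro R_mult monom monomial_sym_sum)
  thus ?case using monom(2) R_mono by blast
next
  case (add t F G)
  thus ?case by (simp add: sum.distrib R_add)
next
  case (on_perms t F G)
  thus ?case by simp
qed

text \<open>
  The fundamental theorem on symmetric functions in the form that is applied below: the average over all
  permutations is a sum of monomial symmetric functions.
\<close>

lemma poly_fun_invariant:
  assumes F: "poly_fun t F" and inv: "\<And>\<tau>. \<tau> permutes I \<Longrightarrow> F \<tau> = y"
  shows "y \<in> R t"
proof -
  define N where "N = card {\<tau>. \<tau> permutes I}"
  have "N > 0" unfolding N_def using finite_permutations[OF finite_I] permutes_id[of I]
    by (subst card_gt_0_iff) blast
  have "(\<Sum>\<tau> | \<tau> permutes I. F \<tau>) = of_nat N * y"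
    using inv by (simp add: N_def)
  hence "of_nat N * y \<in> R t" using poly_fun_sym_sum[OF F] by simp
  from R_rat_mult[OF this, of "1 / of_nat N"] show ?thesis
    using \<open>N > 0\<close> by (simp add: of_rat_divide)
qed

lemma poly_fun_comp:
  assumes "poly_fun t F" and \<sigma>: "\<sigma> permutes I"
  shows "poly_fun t (\<lambda>\<rho>. F (\<rho> \<circ> \<sigma>))"
  using assms(1)
proof (induction rule: poly_fun.induct)
  case (monom r s k t)
  have "(\<Prod>i\<in>I. x ((\<rho> \<circ> \<sigma>) i) ^ k i) = (\<Prod>i\<in>I. x (\<rho> i) ^ (k \<circ> inv_into UNIV \<sigma>) i)" for \<rho>
    using \<sigma> by (intro prod.reindex_bij_witness[of _ "inv_into UNIV \<sigma>" \<sigma>])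
      (auto simp: permutes_in_image permutes_inv permutes_inverses)
  moreover have "(\<Sum>i\<in>I. (k \<circ> inv_into UNIV \<sigma>) i) = (\<Sum>i\<in>I. k i)"
    using \<sigma> by (intro sum.reindex_bij_witness[of _ \<sigma> "inv_into UNIV \<sigma>"])
      (auto simp: permutes_in_image permutes_inv permutes_inverses)
  ultimately show ?case
    using poly_fun.monom[OF monom(1), of "k \<circ> inv_into UNIV \<sigma>" t] monom(2) by simp
next
  case (add t F G)
  from add(3,4) show ?case by (rule poly_fun.add)
next
  case (on_perms t F G)
  show ?case
    by (rule poly_fun.on_perms[OF on_perms(3)]) (use \<sigma> on_perms(2) permutes_compose in blast)
qed

end

text \<open>
  A derivation that raises sizes by at most \<open>\<delta>\<close>.
\<close>

locale weighted_differential = weighted_symmetric R x I c + derivation_field D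
  for R :: "int \<Rightarrow> 'o::field_char_0 set" and x I c and D :: "'o \<Rightarrow> 'o" +
  fixes \<delta> :: nat
  assumes DR: "r \<in> R t \<Longrightarrow> D r \<in> R (t + int \<delta>)"
    and Dx: "i \<in> I \<Longrightarrow> poly_fun (int c + int \<delta>) (\<lambda>\<tau>. D (x (\<tau> i)))"
begin

lemma poly_fun_deriv:
  assumes F: "poly_fun t F"
  shows "poly_fun (t + int \<delta>) (\<lambda>\<tau>. D (F \<tau>))"
proof -
  \<comment> \<open>The functions that satisfy the claim form a graded ring, which contains the generators.\<close>
  define good where "good s F \<longleftrightarrow> poly_fun s F \<and> poly_fun (s + int \<delta>) (\<lambda>\<tau>. D (F \<tau>))" for s F
  have good_mult: "good (s + t) (\<lambda>\<tau>. F \<tau> * G \<tau>)" if "good s F" "good t G" for s t F G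
    using that poly_fun_mult[of "s + \<delta>" "\<lambda>\<tau>. D (F \<tau>)" t G] poly_fun_mult[of s F "t + \<delta>" "\<lambda>\<tau>. D (G \<tau>)"]
      poly_fun_mult[of s F t G]
    unfolding good_def D_mult by (auto intro: poly_fun.add simp: algebra_simps)
  have good_const: "good t (\<lambda>_. r)" if "r \<in> R t" for r t
    using that DR[OF that] by (simp add: good_def poly_fun_const)
  have good_power: "good (int n * t) (\<lambda>\<tau>. F \<tau> ^ n)" if "good t F" for n t F
  proof (induction n)
    case 0
    thus ?case using good_const[OF R_of_nat[of 1]] by simp
  next
    case (Suc n)
    have "int (Suc n) * t = t + int n * t" by (simp add: algebra_simps)
    thus ?case using good_mult[OF that Suc.IH] by (simp only: power_Suc)
  qed
  have good_prod: "good (\<Sum>a\<in>A. w a) (\<lambda>\<tau>. \<Prod>a\<in>A. F a \<tau>)" if "finite A" "\<And>a. a \<in> A \<Longrightarrow> good (w a) (F a)"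
    for A :: "nat set" and w F
    using that good_const[OF R_of_nat[of 1]] good_mult
    by (induction A rule: finite_induct) auto
  show ?thesis
    using F
  proof (induction rule: poly_fun.induct)
    case (monom r s k t)
    have "good (s + (\<Sum>i\<in>I. int (k i) * int c)) (\<lambda>\<tau>. r * (\<Prod>i\<in>I. x (\<tau> i) ^ k i))"
      by (intro good_mult good_const good_prod good_power monom finite_I)
         (auto simp: good_def poly_fun_var Dx)
    hence "poly_fun (s + int (c * (\<Sum>i\<in>I. k i)) + int \<delta>) (\<lambda>\<tau>. D (r * (\<Prod>i\<in>I. x (\<tau> i) ^ k i)))"
      by (simp add: good_def sum_distrib_left algebra_simps)
    thus ?case by (rule poly_fun_mono) (use monom in auto)
  next
    case (add t F G)
    thus ?case by (simp add: D_add poly_fun.add)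
  next
    case (on_perms t F G)
    show ?case by (rule poly_fun.on_perms[OF on_perms(3)]) (simp add: on_perms(2))
  qed
qed

lemma poly_fun_Dn: "poly_fun t F \<Longrightarrow> poly_fun (t + int (\<delta> * i)) (\<lambda>\<tau>. (D ^^ i) (F \<tau>))"
proof (induction i)
  case (Suc i)
  from poly_fun_deriv[OF Suc.IH[OF Suc.prems]] show ?case
    by (simp add: algebra_simps)
qed simp

lemma poly_fun_wronskian:
  assumes F: "\<And>j. j < N \<Longrightarrow> poly_fun (w j) (F j)"
  shows "poly_fun ((\<Sum>j<N. w j) + int (\<delta> * N * N)) (\<lambda>\<tau>. wronskian N (\<lambda>j. F j \<tau>))"
proof -
  have det: "wronskian N (\<lambda>j. F j \<tau>) = (\<Sum>p | p permutes {0..<N}. of_int (sign p) * (\<Prod>i<N. (D ^^ i) (F (p i) \<tau>)))" for \<tau>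
    unfolding wronskian_def wr_mat_def
    by (subst det_def'[of _ N])
       (auto intro!: sum.cong prod.cong simp: sign_def lessThan_atLeast0 permutes_in_image)
  have summand: "poly_fun ((\<Sum>j<N. w j) + int (\<delta> * N * N)) (\<lambda>\<tau>. of_int (sign p) * (\<Prod>i<N. (D ^^ i) (F (p i) \<tau>)))"
    if p: "p permutes {0..<N}" for p
  proof (intro poly_fun_of_int_mult poly_fun_mono[OF poly_fun_prod])
    fix i assume "i \<in> {..<N}"
    hence "p i < N" "i \<le> N" using permutes_in_image[OF p, of i] by auto
    show "poly_fun (w (p i) + int (\<delta> * N)) (\<lambda>\<tau>. (D ^^ i) (F (p i) \<tau>))"
      by (rule poly_fun_mono[OF poly_fun_Dn[OF F[OF \<open>p i < N\<close>], of i]]) (use \<open>i \<le> N\<close> in \<open>auto intro!: mult_left_mono\<close>)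
  next
    have "(\<Sum>i<N. w (p i)) = (\<Sum>i<N. w i)"
      using sum.permute[OF p, of w] by (simp add: lessThan_atLeast0 comp_def)
    thus "(\<Sum>i<N. w (p i) + int (\<delta> * N)) \<le> (\<Sum>j<N. w j) + int (\<delta> * N * N)"
      by (simp add: sum.distrib algebra_simps)
  qed
  show ?thesis unfolding det by (rule poly_fun_sum, rule summand) simp
qed

end

section \<open>Conjugate roots and the spaces spanned by their monomials\<close>

lemma exists_power_sum_nonzero:
  fixes f :: "'i \<Rightarrow> 'o::field_char_0"
  assumes fin: "finite A" and nz: "a \<in> A" "f a \<noteq> 0"
  shows "\<exists>\<kappa>\<ge>1. (\<Sum>i\<in>A. f i ^ \<kappa>) \<noteq> 0"
proof (rule ccontr)
  assume "\<not> ?thesis"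
  hence 0: "(\<Sum>i\<in>A. f i ^ \<kappa>) = 0" if "\<kappa> \<ge> 1" for \<kappa> using that by blast
  define y where "y = f a"
  \<comment> \<open>A polynomial that vanishes at all values except for \<open>y\<close>, and at zero.\<close>
  define h where "h = (\<Prod>v\<in>insert 0 (f ` A) - {y}. [:- v, 1:])"
  have hv: "poly h (f i) = 0" if "i \<in> A" "f i \<noteq> y" for i
    using that fin by (auto simp: h_def poly_prod)
  have hy: "poly h y \<noteq> 0" using fin by (auto simp: h_def poly_prod)
  have h0: "coeff h 0 = 0"
    using fin nz by (auto simp: h_def poly_prod y_def simp flip: poly_0_coeff_0)
  have "(\<Sum>i\<in>A. poly h (f i)) = (\<Sum>i\<in>A. \<Sum>j\<le>degree h. coeff h j * f i ^ j)"
    by (simp add: poly_altdef)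
  also have "\<dots> = (\<Sum>j\<le>degree h. coeff h j * (\<Sum>i\<in>A. f i ^ j))"
    by (subst sum.swap) (simp add: sum_distrib_left)
  also have "\<dots> = 0"
  proof (rule sum.neutral, safe)
    fix j show "coeff h j * (\<Sum>i\<in>A. f i ^ j) = 0"
      using h0 0[of j] by (cases "j = 0") auto
  qed
  finally have "(\<Sum>i\<in>A. poly h (f i)) = 0" .
  moreover have "(\<Sum>i\<in>A. poly h (f i)) = (\<Sum>i\<in>{i\<in>A. f i = y}. poly h y)"
    using fin hv by (intro sum.mono_neutral_cong_right) auto
  ultimately have "of_nat (card {i\<in>A. f i = y}) * poly h y = 0" by simp
  hence "card {i\<in>A. f i = y} = 0" using hy by simp
  thus False using fin nz by (auto simp: y_def)
qed

lemma dvd_power_mult_cancel: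
  fixes q :: "'a::comm_ring_1"
  assumes bez: "u * p + v * q = 1" and "q dvd p ^ n * b"
  shows "q dvd b"
  using assms(2)
proof (induction n)
  case (Suc n)
  have "p ^ n * b = u * (p ^ Suc n * b) + q * (v * p ^ n * b)"
  proof -
    have "p ^ n * b = (u * p + v * q) * (p ^ n * b)" using bez by simp
    thus ?thesis by (simp add: algebra_simps)
  qed
  hence "q dvd p ^ n * b" using Suc.prems by (metis dvd_add dvd_mult dvd_triv_left)
  thus ?case by (rule Suc.IH)
qed simp

lemma of_rat_eq_poly_hom:
  fixes \<iota> :: "'k::field_char_0 poly \<Rightarrow> 'o::field_char_0"
  assumes "inj_idom_hom \<iota>"
  shows "of_rat a = \<iota> [:of_rat a:]"
proof -
  interpret inj_idom_hom \<iota> by fact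
  show ?thesis
  proof (cases a)
    case (Fract m n)
    hence a: "a = of_int m / of_int n" by (simp add: Fract_of_int_quotient)
    have n: "(of_int n :: 'o) \<noteq> 0" "(of_int n :: 'k) \<noteq> 0" using Fract by auto
    have "\<iota> [:of_rat a:] * of_int n = \<iota> ([:of_rat a:] * of_int n)"
      by (simp only: hom_mult hom_of_int)
    also have "[:of_rat a:] * of_int n = [:of_int m :: 'k:]"
      using n by (simp add: a of_rat_divide of_int_poly)
    also have "\<iota> \<dots> = of_int m" by (simp add: hom_of_int flip: of_int_poly)
    finally show ?thesis using n by (simp add: a of_rat_divide field_simps)
  qed
qed

text \<open>
  \<open>\<iota>\<close> embeds \<open>k[T]\<close> into a differential field whose constants are those of \<open>k\<close>, and \<open>x 0, \<dots>, x (d - 1)\<close> are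
  the roots of the monic polynomial \<open>P\<close>. The derivation is \<open>d/dT\<close> multiplied by \<open>\<Delta>\<close>; for a suitable choice of
  this factor, the derivative of each root is again a polynomial \<open>g\<close> over \<open>k[T]\<close> in the root.

  \<open>S t\<close> contains the elements of \<open>k[T][x 0]\<close> that have size at most \<open>t\<close> at the place where rational functions
  approximate \<open>x 0\<close>. The last assumption is the product formula for polynomials in \<open>T\<close>.
\<close>

locale conjugates = inj_idom_hom \<iota> + derivation_field D
  for \<iota> :: "'k::field_char_0 poly \<Rightarrow> 'o::field_char_0" and D :: "'o \<Rightarrow> 'o" +
  fixes x :: "nat \<Rightarrow> 'o" and d c \<delta> :: nat and P g :: "'k poly poly" and \<Delta> :: "'k poly"
    and S :: "int \<Rightarrow> 'o set"
  assumes D_\<iota>: "D (\<iota> p) = \<iota> (\<Delta> * pderiv p)"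
    and D_const: "D y = 0 \<Longrightarrow> \<exists>a. y = \<iota> [:a:]"
    and map_P: "map_poly \<iota> P = (\<Prod>i<d. [:- x i, 1:])"
    and D_x: "i < d \<Longrightarrow> D (x i) = poly (map_poly \<iota> g) (x i)"
    and d_pos: "d \<ge> 1" and c_pos: "c \<ge> 1"
    and weight_P: "j \<le> d \<Longrightarrow> degree (coeff P (d - j)) \<le> c * j"
    and weight_g: "coeff g j \<noteq> 0 \<Longrightarrow> degree (coeff g j) + c * j \<le> c + \<delta>"
    and weight_\<Delta>: "degree \<Delta> \<le> \<delta>"
    and S_subrings: "weighted_subrings S"
    and S_\<iota>: "\<iota> p \<in> S (int (degree p))"
    and S_x0: "x 0 \<in> S (int c)"
    and S_D: "y \<in> S t \<Longrightarrow> D y \<in> S (t + int \<delta>)"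
    and S_nonneg: "\<iota> p \<in> S t \<Longrightarrow> p \<noteq> 0 \<Longrightarrow> t \<ge> 0"
begin

text \<open>
  The filtration of \<open>k[T]\<close> by degree. The zero polynomial belongs to every member, also for negative \<open>t\<close>.
\<close>

definition R :: "int \<Rightarrow> 'o set" where
  "R t = \<iota> ` {p. p = 0 \<or> int (degree p) \<le> t}"

lemma R_\<iota>I: "p = 0 \<or> int (degree p) \<le> t \<Longrightarrow> \<iota> p \<in> R t"
  by (auto simp: R_def)

sublocale R: weighted_subrings R
proof
  fix t s y z and a :: rat
  show "0 \<in> R t" using R_\<iota>I[of 0] by simp
  show "of_rat a \<in> R 0" unfolding of_rat_eq_poly_hom[OF inj_idom_hom_axioms] by (rule R_\<iota>I) simp
  show "y + z \<in> R t" if yz: "y \<in> R t" "z \<in> R t"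
  proof -
    from yz obtain p q where pq: "y = \<iota> p" "z = \<iota> q" "p = 0 \<or> int (degree p) \<le> t" "q = 0 \<or> int (degree q) \<le> t"
      by (auto simp: R_def)
    have "p + q = 0 \<or> int (degree (p + q)) \<le> t"
      using pq(3,4) degree_add_le_max[of p q] by auto
    thus ?thesis using R_\<iota>I[of "p + q" t] pq by (simp add: hom_add)
  qed
  show "y * z \<in> R (s + t)" if yz: "y \<in> R s" "z \<in> R t"
  proof -
    from yz obtain p q where pq: "y = \<iota> p" "z = \<iota> q" "p = 0 \<or> int (degree p) \<le> s" "q = 0 \<or> int (degree q) \<le> t"
      by (auto simp: R_def)
    have "p * q = 0 \<or> int (degree (p * q)) \<le> s + t"
      using pq(3,4) degree_mult_le[of p q] by auto
    thus ?thesis using R_\<iota>I[of "p * q"] pq by (simp add: hom_mult)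
  qed
  show "s \<le> t \<Longrightarrow> y \<in> R s \<Longrightarrow> y \<in> R t" by (force simp: R_def)
qed

sublocale S: weighted_subrings S by (fact S_subrings)

lemma R_subset_S: "y \<in> R t \<Longrightarrow> y \<in> S t"
  using S_\<iota> S.R_mono S.R_0 by (fastforce simp: R_def)

lemma R_power_sums: "(\<Sum>i\<in>{..<d}. x i ^ j) \<in> R (int (c * j))"
proof (rule R.power_sum_in_R)
  fix j assume "j \<le> card {..<d}"
  thus "coeff (\<Prod>i\<in>{..<d}. [:- x i, 1:]) (card {..<d} - j) \<in> R (int (c * j))"
    using weight_P[of j] by (auto simp flip: map_P simp del: of_nat_mult intro!: R_\<iota>I)
qed simp

sublocale R: weighted_symmetric R x "{..<d}" c
  by standard (use R_power_sums in auto)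

lemma S_power_sums: "(\<Sum>i\<in>{1..<d}. x i ^ j) \<in> S (int (c * j))"
proof -
  have "(\<Sum>i\<in>{1..<d}. x i ^ j) = (\<Sum>i\<in>{..<d}. x i ^ j) - x 0 ^ j"
    using d_pos by (subst sum.remove[of "{..<d}" 0]) (auto intro!: sum.cong)
  thus ?thesis
    using R_subset_S[OF R_power_sums[of j]] S.R_power[OF S_x0, of j]
    by (simp add: S.R_diff mult.commute)
qed

sublocale S: weighted_symmetric S x "{1..<d}" c
  by standard (use S_power_sums in auto)

lemma S_permutes: "\<tau> permutes {1..<d} \<Longrightarrow> \<tau> permutes {..<d} \<and> \<tau> 0 = 0"
  using permutes_subset[of \<tau> "{1..<d}" "{..<d}", OF _ subsetI] permutes_not_in[of \<tau> "{1..<d}" 0] by simp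

text \<open>
  Fixing the root \<open>x 0\<close> turns a polynomial in all roots into a polynomial in the other ones whose coefficients
  involve \<open>x 0\<close>. Its weight does not increase because \<open>x 0\<close> has size at most \<open>c\<close>.
\<close>

lemma S_poly_fun_if_R_poly_fun:
  assumes "R.poly_fun t F"
  shows "S.poly_fun t F"
  using assms
proof (induction rule: R.poly_fun.induct)
  case (monom r s k t)
  have "S.poly_fun (s + int (k 0) * int c + int (c * (\<Sum>i\<in>{1..<d}. k i)))
      (\<lambda>\<tau>. (r * x 0 ^ k 0) * (\<Prod>i\<in>{1..<d}. x (\<tau> i) ^ k i))"
    by (intro S.poly_fun.monom[OF S.R_mult[OF R_subset_S[OF monom(1)] S.R_power[OF S_x0]]]) simp
  moreover have eq: "{..<d} = insert 0 {1..<d}" using d_pos by auto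
  have "s + int (k 0) * int c + int (c * (\<Sum>i\<in>{1..<d}. k i)) \<le> t"
    using monom(2) unfolding eq by (simp add: algebra_simps)
  ultimately have "S.poly_fun t (\<lambda>\<tau>. (r * x 0 ^ k 0) * (\<Prod>i\<in>{1..<d}. x (\<tau> i) ^ k i))"
    by (rule S.poly_fun_mono)
  thus ?case
  proof (rule S.poly_fun.on_perms)
    fix \<tau> assume "\<tau> permutes {1..<d}"
    hence "\<tau> 0 = 0" using S_permutes by blast
    thus "r * (\<Prod>i<d. x (\<tau> i) ^ k i) = (r * x 0 ^ k 0) * (\<Prod>i\<in>{1..<d}. x (\<tau> i) ^ k i)"
      by (simp add: eq)
  qed
next
  case (add t F G)
  thus ?case by (intro S.poly_fun.add)
next
  case (on_perms t F G)
  show ?case by (rule S.poly_fun.on_perms[OF on_perms(3)]) (use S_permutes on_perms(2) in blast)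
qed

lemma R_deriv:
  assumes "y \<in> R t"
  shows "D y \<in> R (t + int \<delta>)"
proof -
  from assms obtain p where p: "y = \<iota> p" "p = 0 \<or> int (degree p) \<le> t" by (auto simp: R_def)
  have "degree (\<Delta> * pderiv p) \<le> \<delta> + degree p"
    using degree_mult_le[of \<Delta> "pderiv p"] weight_\<Delta> degree_pderiv_le[of p] by linarith
  thus ?thesis using p by (auto simp: D_\<iota> intro!: R_\<iota>I)
qed

lemma R_deriv_root:
  assumes i: "i \<in> {..<d}"
  shows "R.poly_fun (int c + int \<delta>) (\<lambda>\<tau>. D (x (\<tau> i)))"
proof (rule R.poly_fun.on_perms)
  show "R.poly_fun (int c + int \<delta>) (\<lambda>\<tau>. \<Sum>j\<le>degree g. \<iota> (coeff g j) * x (\<tau> i) ^ j)"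
  proof (rule R.poly_fun_sum)
    fix j
    show "R.poly_fun (int c + int \<delta>) (\<lambda>\<tau>. \<iota> (coeff g j) * x (\<tau> i) ^ j)"
    proof (cases "coeff g j = 0")
      case True
      thus ?thesis by (simp add: R.poly_fun_const R.R_0)
    next
      case False
      have "R.poly_fun (int (degree (coeff g j)) + int j * int c) (\<lambda>\<tau>. \<iota> (coeff g j) * x (\<tau> i) ^ j)"
        by (intro R.poly_fun_R_mult R.poly_fun_power R.poly_fun_var i R_\<iota>I) auto
      moreover have "int (degree (coeff g j)) + int j * int c \<le> int c + int \<delta>"
        using weight_g[OF False] by (simp add: mult.commute flip: of_nat_mult of_nat_add)
      ultimately show ?thesis by (rule R.poly_fun_mono)
    qed
  qed
next
  fix \<tau> assume "\<tau> permutes {..<d}"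
  hence "\<tau> i < d" using i permutes_in_image[of \<tau> "{..<d}" i] by auto
  thus "D (x (\<tau> i)) = (\<Sum>j\<le>degree g. \<iota> (coeff g j) * x (\<tau> i) ^ j)"
    by (simp add: D_x poly_altdef)
qed

sublocale R: weighted_differential R x "{..<d}" c D \<delta>
  by standard (use R_deriv R_deriv_root in auto)

sublocale S: weighted_differential S x "{1..<d}" c D \<delta>
  by standard (use S_D S_poly_fun_if_R_poly_fun[OF R_deriv_root] in auto)

text \<open>
  The pair \<open>(j, k)\<close> stands for the product of \<open>T\<^sup>j\<close> and all \<open>x i ^ k i\<close>.
\<close>

definition monomials :: "nat \<Rightarrow> (nat \<times> (nat \<Rightarrow> nat)) set" where
  "monomials r = {..<r} \<times> ({..<d} \<rightarrow>\<^sub>E {..<d})"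

definition mono_val :: "nat \<times> (nat \<Rightarrow> nat) \<Rightarrow> (nat \<Rightarrow> nat) \<Rightarrow> 'o" where
  "mono_val = (\<lambda>(j, k) \<tau>. \<iota> (monom 1 j) * (\<Prod>i<d. x (\<tau> i) ^ k i))"

definition permute_exps :: "(nat \<Rightarrow> nat) \<Rightarrow> nat \<times> (nat \<Rightarrow> nat) \<Rightarrow> nat \<times> (nat \<Rightarrow> nat)" where
  "permute_exps \<tau> = (\<lambda>(j, k). (j, k \<circ> inv_into UNIV \<tau>))"

lemma finite_monomials: "finite (monomials r)"
  by (auto simp: monomials_def intro: finite_PiE)

lemma card_monomials: "card (monomials r) = d ^ d * r"
  by (simp add: monomials_def card_cartesian_product card_PiE)

lemma permute_exps_in_monomials: 
  assumes "\<tau> permutes {..<d}" "v \<in> monomials r"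
  shows "permute_exps \<tau> v \<in> monomials r"
  using assms permutes_in_image[OF permutes_inv[OF assms(1)]] permutes_not_in[OF permutes_inv[OF assms(1)]]
  by (fastforce simp: permute_exps_def monomials_def PiE_def Pi_def extensional_def)

lemma permute_exps_inv1: "\<tau> permutes {..<d} \<Longrightarrow> permute_exps (inv_into UNIV \<tau>) (permute_exps \<tau> v) = v"
  and permute_exps_inv2: "\<tau> permutes {..<d} \<Longrightarrow> permute_exps \<tau> (permute_exps (inv_into UNIV \<tau>) v) = v"
  by (auto simp: permute_exps_def comp_assoc permutes_inv_o permutes_inv_inv split: prod.splits)

lemma mono_val_permute:
  assumes \<tau>: "\<tau> permutes {..<d}"
  shows "mono_val v \<tau> = mono_val (permute_exps \<tau> v) id"
proof -
  have "(\<Prod>i<d. x (\<tau> i) ^ k i) = (\<Prod>i<d. x i ^ k (inv_into UNIV \<tau> i))" for k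
    using \<tau> permutes_in_image[OF \<tau>] permutes_in_image[OF permutes_inv[OF \<tau>]] 
    by (intro prod.reindex_bij_witness[of _ "inv_into UNIV \<tau>" \<tau>]) (auto simp: permutes_inverses)
  thus ?thesis by (simp add: mono_val_def permute_exps_def split: prod.splits)
qed

lemma poly_fun_mono_val:
  assumes "v \<in> monomials r"
  shows "R.poly_fun (int (r + c * d * d)) (mono_val v)"
proof -
  obtain j k where v: "v = (j, k)" "j < r" "k \<in> {..<d} \<rightarrow>\<^sub>E {..<d}"
    using assms by (auto simp: monomials_def)
  have "(\<Sum>i<d. k i) \<le> (\<Sum>i<d. d)" using v(3) by (intro sum_mono) (auto simp: PiE_def Pi_def less_imp_le)
  hence "c * (\<Sum>i<d. k i) \<le> c * (d * d)" by (intro mult_left_mono) auto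
  hence "int j + int (c * (\<Sum>i<d. k i)) \<le> int (r + c * d * d)"
    using \<open>j < r\<close> by (simp only: mult.assoc of_nat_add[symmetric] of_nat_le_iff)
  moreover have "\<iota> (monom 1 j) \<in> R (int j)" by (rule R_\<iota>I) (simp add: degree_monom_eq)
  ultimately show ?thesis unfolding mono_val_def v(1) prod.case
    by (intro R.poly_fun.monom)
qed

lemma D_\<iota>_const [simp]: "D (\<iota> [:a:]) = 0"
  by (simp add: D_\<iota>)

lemma const_in_R: "D y = 0 \<Longrightarrow> y \<in> R 0"
  using D_const[of y] by (auto intro!: R_\<iota>I)

text \<open>
  The dimension over the constants of the space spanned by the monomials in \<open>monomials r\<close>. It is defined by
  Wronskians, so that permutations of the roots can be applied to the monomials directly.
\<close>

definition rk :: "nat \<Rightarrow> nat" where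
  "rk r = Max {N. \<exists>v. (\<forall>j<N. v j \<in> monomials r) \<and> wronskian N (\<lambda>j. mono_val (v j) id) \<noteq> 0}"

lemma independent_le_card:
  assumes v: "\<And>j. j < N \<Longrightarrow> v j \<in> monomials r" and nz: "wronskian N (\<lambda>j. mono_val (v j) id) \<noteq> 0"
  shows "N \<le> card (monomials r)"
proof -
  have "inj_on v {..<N}"
  proof (rule inj_onI, rule ccontr)
    fix a b assume ab: "a \<in> {..<N}" "b \<in> {..<N}" "v a = v b" "a \<noteq> b"
    let ?C = "\<lambda>j. if j = a then 1 else if j = b then -1 else (0::'o)"
    have "(\<Sum>j<N. ?C j * mono_val (v j) id) = (\<Sum>j\<in>{a,b}. ?C j * mono_val (v j) id)"
      using ab by (intro sum.mono_neutral_right) auto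
    also have "\<dots> = 0" using ab by simp
    finally have "(\<Sum>j<N. ?C j * mono_val (v j) id) = 0" .
    hence "wronskian N (\<lambda>j. mono_val (v j) id) = 0"
      using ab by (intro wronskian_eq_0_if_relation[of N ?C a]) (auto simp: D_uminus)
    thus False using nz by simp
  qed
  hence "card {..<N} \<le> card (monomials r)"
    using v by (intro card_inj_on_le[of v]) (auto simp: finite_monomials)
  thus ?thesis by simp
qed

lemma wronskian_0 [simp]: "wronskian 0 f = 1"
  by (simp add: wronskian_def wr_mat_def)

lemma rk_set_finite: "finite {N. \<exists>v. (\<forall>j<N. v j \<in> monomials r) \<and> wronskian N (\<lambda>j. mono_val (v j) id) \<noteq> 0}"
  by (rule finite_subset[of _ "{..card (monomials r)}"]) (use independent_le_card in auto)

lemma le_rk: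
  assumes "\<And>j. j < N \<Longrightarrow> v j \<in> monomials r" and "wronskian N (\<lambda>j. mono_val (v j) id) \<noteq> 0"
  shows "N \<le> rk r"
  unfolding rk_def using assms by (intro Max_ge rk_set_finite) auto

lemma rk_witness:
  obtains v where "\<And>j. j < rk r \<Longrightarrow> v j \<in> monomials r" "wronskian (rk r) (\<lambda>j. mono_val (v j) id) \<noteq> 0"
proof -
  have "rk r \<in> {N. \<exists>v. (\<forall>j<N. v j \<in> monomials r) \<and> wronskian N (\<lambda>j. mono_val (v j) id) \<noteq> 0}"
    unfolding rk_def by (rule Max_in[OF rk_set_finite]) (auto intro!: exI[of _ 0])
  thus ?thesis using that by blast
qed

lemma rk_le: "rk r \<le> d ^ d * r"
  by (rule rk_witness[of r]) (metis independent_le_card card_monomials)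

lemma rk_ge_1:
  assumes "r \<ge> 1"
  shows "rk r \<ge> 1"
proof (rule le_rk)
  show "(0, restrict (\<lambda>_. 0) {..<d}) \<in> monomials r" using assms d_pos by (auto simp: monomials_def)
  have "(\<Prod>i<d. x i ^ restrict (\<lambda>_. 0) {..<d} i) = 1" by (intro prod.neutral) auto
  thus "wronskian 1 (\<lambda>j. mono_val (0, restrict (\<lambda>_. 0) {..<d}) id) \<noteq> 0"
    by (subst wronskian_def, subst det_single) (auto simp: wr_mat_def mono_val_def)
qed

text \<open>
  Maximality makes the Wronskian with one more monomial vanish, and the resulting relation involves the new monomial.
\<close>

lemma maximal_independent_spans:
  assumes v: "\<And>j. j < rk r \<Longrightarrow> v j \<in> monomials r"
    and nz: "wronskian (rk r) (\<lambda>j. mono_val (v j) id) \<noteq> 0" and w: "w \<in> monomials r"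
  shows "\<exists>C. (\<forall>j. D (C j) = 0) \<and> mono_val w id = (\<Sum>j<rk r. C j * mono_val (v j) id)"
proof -
  define n where "n = rk r"
  define v' where "v' = v(n := w)"
  have same: "mono_val (v' j) id = mono_val (v j) id" if "j < n" for j using that by (simp add: v'_def)
  have "wronskian (Suc n) (\<lambda>j. mono_val (v' j) id) = 0"
  proof (rule ccontr)
    assume "wronskian (Suc n) (\<lambda>j. mono_val (v' j) id) \<noteq> 0"
    hence "Suc n \<le> rk r" by (intro le_rk[of _ v']) (use v w in \<open>auto simp: v'_def n_def less_Suc_eq\<close>)
    thus False by (simp add: n_def)
  qed
  then obtain C where C: "\<forall>j<Suc n. D (C j) = 0" "\<exists>j<Suc n. C j \<noteq> 0" "(\<Sum>j<Suc n. C j * mono_val (v' j) id) = 0"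
    using relation_if_wronskian_eq_0 by blast
  have sum0: "(\<Sum>j<n. C j * mono_val (v j) id) + C n * mono_val w id = 0"
    using C(3) same by (simp add: v'_def)
  have Cn: "C n \<noteq> 0"
  proof
    assume 0: "C n = 0"
    then obtain j where j: "j < n" "C j \<noteq> 0" using C(2) by (auto simp: less_Suc_eq)
    have "wronskian n (\<lambda>j. mono_val (v j) id) = 0"
      by (rule wronskian_eq_0_if_relation[of n C j]) (use C(1) j sum0 0 in auto)
    thus False using nz by (simp add: n_def)
  qed
  obtain a where a: "C n = \<iota> [:a:]" using D_const C(1) by blast
  have an0: "a \<noteq> 0" using Cn a by auto
  define B where "B j = (if j < n then - \<iota> [:1 / a:] * C j else 0)" for j
  have inv: "\<iota> [:1 / a:] * C n = 1"
    using an0 by (simp add: a flip: hom_mult)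
  have "D (B j) = 0" for j using C(1) by (simp add: B_def D_mult D_uminus)
  moreover have "mono_val w id = (\<Sum>j<n. B j * mono_val (v j) id)"
  proof -
    have "(\<Sum>j<n. B j * mono_val (v j) id) = - \<iota> [:1 / a:] * (\<Sum>j<n. C j * mono_val (v j) id)"
      by (simp add: B_def sum_distrib_left mult.assoc)
    also have "(\<Sum>j<n. C j * mono_val (v j) id) = - (C n * mono_val w id)"
      using sum0 by (simp add: eq_neg_iff_add_eq_0)
    also have "- \<iota> [:1 / a:] * - (C n * mono_val w id) = (\<iota> [:1 / a:] * C n) * mono_val w id"
      by (simp add: mult.assoc)
    finally show ?thesis by (simp only: inv mult_1_left)
  qed
  ultimately show ?thesis unfolding n_def by blast
qed

end

context conjugates
begin

definition span :: "nat \<Rightarrow> 'o set" where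
  "span r = {\<Sum>v\<in>monomials r. C v * mono_val v id | C. \<forall>v. D (C v) = 0}"

lemma span_base:
  assumes "v \<in> monomials r"
  shows "mono_val v id \<in> span r"
proof -
  have "(\<Sum>w\<in>monomials r. (if w = v then 1 else 0) * mono_val w id) = (\<Sum>w\<in>monomials r. if w = v then mono_val w id else 0)"
    by (intro sum.cong) auto
  also have "\<dots> = mono_val v id" using assms finite_monomials by simp
  finally have "mono_val v id = (\<Sum>w\<in>monomials r. (if w = v then 1 else 0) * mono_val w id)" ..
  moreover have "\<forall>w. D (if w = v then 1 else 0) = 0" by simp
  ultimately show ?thesis unfolding span_def
    by (intro CollectI exI[of _ "\<lambda>w. if w = v then 1 else 0"] conjI)
qed

lemma span_scale:
  assumes "y \<in> span r" "D b = 0"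
  shows "b * y \<in> span r"
proof -
  obtain C where C: "\<forall>v. D (C v) = 0" "y = (\<Sum>v\<in>monomials r. C v * mono_val v id)"
    using assms(1) by (auto simp: span_def)
  have "b * y = (\<Sum>v\<in>monomials r. (b * C v) * mono_val v id)"
    by (simp add: C(2) sum_distrib_left mult.assoc)
  moreover have "\<forall>v. D (b * C v) = 0" using C(1) assms(2) by (simp add: D_mult)
  ultimately show ?thesis by (auto simp: span_def)
qed

lemma span_add:
  assumes "y \<in> span r" "z \<in> span r"
  shows "y + z \<in> span r"
proof -
  obtain C where C: "\<forall>v. D (C v) = 0" "y = (\<Sum>v\<in>monomials r. C v * mono_val v id)"
    using assms(1) by (auto simp: span_def)
  obtain B where B: "\<forall>v. D (B v) = 0" "z = (\<Sum>v\<in>monomials r. B v * mono_val v id)"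
    using assms(2) by (auto simp: span_def)
  have "y + z = (\<Sum>v\<in>monomials r. (C v + B v) * mono_val v id)"
    by (simp add: C(2) B(2) sum.distrib algebra_simps)
  moreover have "\<forall>v. D (C v + B v) = 0" using C(1) B(1) by (simp add: D_add)
  ultimately show ?thesis by (auto simp: span_def)
qed

lemma span_0: "0 \<in> span r"
  unfolding span_def by (rule CollectI, rule exI[of _ "\<lambda>_. 0"]) simp

lemma span_sum: "(\<And>a. a \<in> A \<Longrightarrow> f a \<in> span r) \<Longrightarrow> sum f A \<in> span r"
  by (induction A rule: infinite_finite_induct) (auto simp: span_0 span_add)

lemma maximal_independent_generates_span:
  assumes v: "\<And>j. j < rk r \<Longrightarrow> v j \<in> monomials r"
    and nz: "wronskian (rk r) (\<lambda>j. mono_val (v j) id) \<noteq> 0" and y: "y \<in> span r"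
  shows "\<exists>C. (\<forall>j. D (C j) = 0) \<and> y = (\<Sum>j<rk r. C j * mono_val (v j) id)"
proof -
  obtain B where B: "\<forall>w. D (B w) = 0" "y = (\<Sum>w\<in>monomials r. B w * mono_val w id)"
    using y by (auto simp: span_def)
  have "\<forall>w\<in>monomials r. \<exists>C. (\<forall>j. D (C j) = 0) \<and> mono_val w id = (\<Sum>j<rk r. C j * mono_val (v j) id)"
    using maximal_independent_spans[OF v nz] by blast
  then obtain C where C: "\<And>w j. w \<in> monomials r \<Longrightarrow> D (C w j) = 0"
    "\<And>w. w \<in> monomials r \<Longrightarrow> mono_val w id = (\<Sum>j<rk r. C w j * mono_val (v j) id)"
    by metis
  have "y = (\<Sum>w\<in>monomials r. B w * (\<Sum>j<rk r. C w j * mono_val (v j) id))"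
    unfolding B(2) by (intro sum.cong refl arg_cong2[where f = "(*)"] C(2))
  also have "\<dots> = (\<Sum>j<rk r. (\<Sum>w\<in>monomials r. B w * C w j) * mono_val (v j) id)"
    by (subst sum_distrib_left, subst sum.swap) (simp add: sum_distrib_right mult.assoc)
  finally have "y = (\<Sum>j<rk r. (\<Sum>w\<in>monomials r. B w * C w j) * mono_val (v j) id)" .
  moreover have "D (\<Sum>w\<in>monomials r. B w * C w j) = 0" for j
  proof -
    have "D (B w) = 0" for w using B(1) by blast
    thus ?thesis using C(1) by (simp add: D_sum D_mult)
  qed
  ultimately show ?thesis
    by (intro exI[of _ "\<lambda>j. \<Sum>w\<in>monomials r. B w * C w j"] conjI allI)
qed

lemma x0_power_d: "x 0 ^ d = (\<Sum>l<d. - \<iota> (coeff P l) * x 0 ^ l)"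
proof -
  have deg: "degree (map_poly \<iota> P) = d"
    unfolding map_P by (subst degree_prod_sum_eq) auto
  hence degP: "degree P = d" by simp
  have "lead_coeff (map_poly \<iota> P) = 1"
    unfolding map_P by (subst lead_coeff_prod) simp
  hence lead: "coeff P d = 1" by (simp add: degP)
  have "0 = poly (map_poly \<iota> P) (x 0)"
    unfolding map_P using d_pos by (auto simp: poly_prod)
  also have "\<dots> = (\<Sum>l\<le>d. \<iota> (coeff P l) * x 0 ^ l)"
    by (simp add: poly_altdef degP)
  also have "\<dots> = (\<Sum>l<d. \<iota> (coeff P l) * x 0 ^ l) + x 0 ^ d"
    by (simp add: lead lessThan_Suc_atMost[symmetric])
  finally have "x 0 ^ d = - (\<Sum>l<d. \<iota> (coeff P l) * x 0 ^ l)"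
    by (simp add: eq_neg_iff_add_eq_0 add.commute)
  thus ?thesis by (simp add: sum_negf)
qed

text \<open>
  If the exponent of \<open>x 0\<close> would become \<open>d\<close>, the equation \<open>P (x 0) = 0\<close> reduces it at the cost of the degree in \<open>T\<close>
  of the coefficients of \<open>P\<close>, which is at most \<open>c * d\<close>.
\<close>

lemma x0_mult_in_span:
  assumes "w \<in> monomials r"
  shows "x 0 * mono_val w id \<in> span (r + c * d)"
proof -
  obtain j k where w: "w = (j, k)" "j < r" "k \<in> {..<d} \<rightarrow>\<^sub>E {..<d}"
    using assms by (auto simp: monomials_def)
  define \<pi> where "\<pi> = (\<Prod>i\<in>{1..<d}. x i ^ k i)"
  have eq: "{..<d} = insert 0 {1..<d}" using d_pos by auto
  have k_upd: "k(0 := l) \<in> {..<d} \<rightarrow>\<^sub>E {..<d}" if "l < d" for l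
    using w(3) that d_pos by (auto simp: PiE_def Pi_def extensional_def)
  have val: "mono_val (j', k(0 := l)) id = \<iota> (monom 1 j') * (x 0 ^ l * \<pi>)" for j' l
  proof -
    have "(\<Prod>i\<in>{1..<d}. x i ^ (k(0 := l)) i) = \<pi>" unfolding \<pi>_def by (intro prod.cong) auto
    thus ?thesis by (simp add: mono_val_def eq del: fun_upd_apply) simp
  qed
  have w_eq: "mono_val w id = \<iota> (monom 1 j) * (x 0 ^ k 0 * \<pi>)"
    using val[of j "k 0"] by (simp add: w(1))
  have k0: "k 0 < d" using w(3) d_pos by (auto simp: PiE_def Pi_def)
  show ?thesis
  proof (cases "k 0 + 1 < d")
    case True
    have "x 0 * mono_val w id = mono_val (j, k(0 := k 0 + 1)) id"
      unfolding val w_eq by (simp add: mult_ac)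
    also have "\<dots> \<in> span (r + c * d)"
      by (rule span_base) (use True w(2) k_upd in \<open>auto simp: monomials_def\<close>)
    finally show ?thesis .
  next
    case False
    hence "d = Suc (k 0)" using k0 by simp
    hence "x 0 * x 0 ^ k 0 = x 0 ^ d" by simp
    hence "x 0 * mono_val w id = \<iota> (monom 1 j) * \<pi> * x 0 ^ d"
      unfolding w_eq by (simp add: mult_ac)
    also have "\<dots> = (\<Sum>l<d. -1 * (\<iota> (coeff P l * monom 1 j) * (x 0 ^ l * \<pi>)))"
      unfolding x0_power_d sum_distrib_left by (intro sum.cong) (simp_all add: hom_mult mult_ac)
    also have "\<dots> \<in> span (r + c * d)"
    proof (rule span_sum, rule span_scale)
      fix l assume l: "l \<in> {..<d}"
      define a where "a = coeff P l"
      have "degree a \<le> c * d"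
      proof -
        have "c * (d - l) \<le> c * d" by (rule mult_left_mono) auto
        from le_trans[OF weight_P[of "d - l", OF diff_le_self] this] show ?thesis
          using l by (simp add: a_def)
      qed
      have "\<iota> (a * monom 1 j) = \<iota> (\<Sum>i\<le>degree a. [:coeff a i:] * monom 1 (i + j))"
        by (subst (1) poly_as_sum_of_monoms[of a, symmetric])
           (simp add: sum_distrib_right mult_monom smult_monom)
      also have "\<dots> * (x 0 ^ l * \<pi>) = (\<Sum>i\<le>degree a. \<iota> [:coeff a i:] * mono_val (i + j, k(0 := l)) id)"
        by (simp only: hom_sum hom_mult val sum_distrib_right mult.assoc)
      also have "\<dots> \<in> span (r + c * d)"
      proof (intro span_sum span_scale span_base)
        fix i assume "i \<in> {..degree a}"
        thus "(i + j, k(0 := l)) \<in> monomials (r + c * d)"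
          using \<open>degree a \<le> c * d\<close> w(2) k_upd[of l] l by (auto simp: monomials_def)
      qed simp
      finally show "\<iota> (coeff P l * monom 1 j) * (x 0 ^ l * \<pi>) \<in> span (r + c * d)"
        by (simp add: a_def)
    qed (simp add: D_uminus)
    finally show ?thesis .
  qed
qed

section \<open>Nonvanishing of the Wronskian\<close>

text \<open>
  Substitute for a norm. Some of the conjugates \<open>b \<sigma>\<close> may vanish, because a permutation of the roots need not
  come from an automorphism. If \<open>m\<close> of them are nonzero, then the product of these is the \<open>m\<close>-th elementary
  symmetric function of all conjugates, and hence a polynomial in \<open>T\<close>.
\<close>

lemma nonzero_multiple_in_base:
  assumes b: "R.poly_fun t b" and "t \<ge> 0" and b0: "b id \<noteq> 0"
  obtains \<beta> B t' where "\<beta> \<noteq> 0" "int (degree \<beta>) \<le> int (fact d) * t" "R.poly_fun t' B"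
    "\<iota> \<beta> = b id * B id"
proof -
  define perms where "perms = {\<sigma>. \<sigma> permutes {..<d}}"
  have fin: "finite perms" by (simp add: perms_def finite_permutations)
  have card: "card perms = fact d" unfolding perms_def by (rule card_permutations) auto
  define X0 where "X0 = {\<sigma>\<in>perms. b \<sigma> \<noteq> 0}"
  define m where "m = card X0"
  have X0: "X0 \<subseteq> perms" "finite X0" "id \<in> X0"
    using fin b0 by (auto simp: X0_def perms_def permutes_id)
  have "m \<le> fact d" using card_mono[OF fin X0(1)] by (simp add: m_def card)
  define e where "e \<rho> = (\<Sum>U\<in>{U. U \<subseteq> perms \<and> card U = m}. \<Prod>\<sigma>\<in>U. b (\<rho> \<circ> \<sigma>))" for \<rho>
  have e_poly: "R.poly_fun (int m * t) e"
    unfolding e_def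
  proof (rule R.poly_fun_sum)
    fix U assume U: "U \<in> {U. U \<subseteq> perms \<and> card U = m}"
    have "R.poly_fun (\<Sum>\<sigma>\<in>U. t) (\<lambda>\<tau>. \<Prod>\<sigma>\<in>U. b (\<tau> \<circ> \<sigma>))"
      using U by (intro R.poly_fun_prod R.poly_fun_comp b) (auto simp: perms_def)
    thus "R.poly_fun (int m * t) (\<lambda>\<tau>. \<Prod>\<sigma>\<in>U. b (\<tau> \<circ> \<sigma>))" using U by simp
  qed
  have e_inv: "e \<rho> = e id" if \<rho>: "\<rho> permutes {..<d}" for \<rho>
  proof -
    have inj: "inj ((\<circ>) \<rho>)"
      using permutes_inj[OF \<rho>] by (auto simp: inj_def fun_eq_iff)
    have inj': "inj ((\<circ>) (inv_into UNIV \<rho>))"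
      using permutes_inj[OF permutes_inv[OF \<rho>]] by (auto simp: inj_def fun_eq_iff)
    show ?thesis unfolding e_def
    proof (rule sum.reindex_bij_witness[of _ "\<lambda>U. (\<circ>) (inv_into UNIV \<rho>) ` U" "\<lambda>U. (\<circ>) \<rho> ` U"], goal_cases)
      case (1 U)
      show ?case by (simp add: image_image comp_assoc[symmetric] permutes_inv_o[OF \<rho>])
    next
      case (2 U)
      thus ?case using \<rho> by (auto simp: perms_def card_image[OF inj_on_subset[OF inj subset_UNIV]] intro!: permutes_compose)
    next
      case (3 U)
      show ?case by (simp add: image_image comp_assoc[symmetric] permutes_inv_o[OF \<rho>])
    next
      case (4 U)
      thus ?case using permutes_inv[OF \<rho>]
        by (auto simp: perms_def card_image[OF inj_on_subset[OF inj' subset_UNIV]] intro!: permutes_compose)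
    next
      case (5 U)
      show ?case by (subst prod.reindex[OF inj_on_subset[OF inj subset_UNIV]]) auto
    qed
  qed
  have e_id: "e id = (\<Prod>\<sigma>\<in>X0. b \<sigma>)"
  proof -
    have "e id = (\<Sum>U\<in>{X0}. \<Prod>\<sigma>\<in>U. b \<sigma>)"
      unfolding e_def id_o
    proof (rule sum.mono_neutral_right)
      show "\<forall>U\<in>{U. U \<subseteq> perms \<and> card U = m} - {X0}. (\<Prod>\<sigma>\<in>U. b \<sigma>) = 0"
      proof
        fix U assume U: "U \<in> {U. U \<subseteq> perms \<and> card U = m} - {X0}"
        hence finX: "finite U" using fin finite_subset by blast
        have "\<not> U \<subseteq> X0"
          using U card_subset_eq[OF X0(2), of U] by (auto simp: m_def)
        then obtain \<sigma> where "\<sigma> \<in> U" "b \<sigma> = 0" using U by (auto simp: X0_def)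
        thus "(\<Prod>\<sigma>\<in>U. b \<sigma>) = 0" using finX by (intro prod_zero) auto
      qed
    qed (use fin X0 in \<open>auto simp: m_def\<close>)
    thus ?thesis by simp
  qed
  have "e id \<in> R (int m * t)"
    by (rule R.poly_fun_invariant[OF e_poly]) (rule e_inv)
  then obtain \<beta> where \<beta>: "e id = \<iota> \<beta>" "\<beta> = 0 \<or> int (degree \<beta>) \<le> int m * t"
    by (auto simp: R_def)
  define B where "B = (\<lambda>\<rho>. \<Prod>\<sigma>\<in>X0 - {id}. b (\<rho> \<circ> \<sigma>))"
  have "e id = b id * B id"
    unfolding e_id B_def using X0 by (subst prod.remove[of X0 id]) auto
  moreover have "e id \<noteq> 0" unfolding e_id using X0 by (auto simp: X0_def)
  moreover have "R.poly_fun (\<Sum>\<sigma>\<in>X0 - {id}. t) B"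
    unfolding B_def using X0 by (intro R.poly_fun_prod R.poly_fun_comp b) (auto simp: perms_def)
  moreover have "int m * t \<le> int (fact d) * t"
    using \<open>m \<le> fact d\<close> \<open>t \<ge> 0\<close> by (intro mult_right_mono) (simp only: of_nat_le_iff, auto)
  ultimately show ?thesis using \<beta> that[of \<beta> _ B] by fastforce
qed

text \<open>
  The quotient \<open>- u / q\<close> equals \<open>y id\<close>, which is integral over \<open>k[T]\<close>. The proof multiplies all conjugates of the
  relation \<open>u + q * y = 0\<close>: the product is zero, congruent to a power of \<open>u\<close> modulo \<open>q\<close>, and its remaining part
  is symmetric.
\<close>

lemma dvd_power_if_integral_quotient:
  assumes y: "R.poly_fun t y" and rel: "\<iota> u + \<iota> q * y id = 0" and q: "q \<noteq> 0"
  shows "q dvd u ^ fact d"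
proof -
  define perms where "perms = {\<sigma>. \<sigma> permutes {..<d}}"
  have fin: "finite perms" by (simp add: perms_def finite_permutations)
  have card: "card perms = fact d" unfolding perms_def by (rule card_permutations) auto
  have "\<exists>\<Psi> t'. R.poly_fun t' \<Psi> \<and> (\<forall>\<rho>. (\<Prod>\<sigma>\<in>A. \<iota> u + \<iota> q * y (\<rho> \<circ> \<sigma>)) = \<iota> u ^ card A + \<iota> q * \<Psi> \<rho>)"
    if "finite A" "A \<subseteq> perms" for A
    using that
  proof (induction A rule: finite_induct)
    case empty
    show ?case by (rule exI[of _ "\<lambda>_. 0"], rule exI[of _ 0]) (auto intro: R.poly_fun_const R.R_0)
  next
    case (insert \<sigma> A)
    obtain \<Psi> t' where \<Psi>: "R.poly_fun t' \<Psi>"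
      "\<And>\<rho>. (\<Prod>\<sigma>\<in>A. \<iota> u + \<iota> q * y (\<rho> \<circ> \<sigma>)) = \<iota> u ^ card A + \<iota> q * \<Psi> \<rho>"
      using insert.IH insert.prems by blast
    define \<Psi>' where "\<Psi>' \<rho> = \<iota> u * \<Psi> \<rho> + \<iota> (u ^ card A) * y (\<rho> \<circ> \<sigma>) + \<iota> q * (y (\<rho> \<circ> \<sigma>) * \<Psi> \<rho>)" for \<rho>
    have y\<sigma>: "R.poly_fun t (\<lambda>\<rho>. y (\<rho> \<circ> \<sigma>))"
      using insert.prems by (intro R.poly_fun_comp y) (auto simp: perms_def)
    have R\<iota>: "\<iota> p \<in> R (int (degree p))" for p by (rule R_\<iota>I) auto
    define T where "T = Max {int (degree u) + t', int (degree (u ^ card A)) + t, int (degree q) + (t + t')}"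
    have "R.poly_fun T \<Psi>'"
      unfolding \<Psi>'_def
    proof (intro R.poly_fun.add)
      show "R.poly_fun T (\<lambda>\<rho>. \<iota> u * \<Psi> \<rho>)"
        by (rule R.poly_fun_mono[OF R.poly_fun_R_mult[OF R\<iota> \<Psi>(1)]]) (simp add: T_def)
      show "R.poly_fun T (\<lambda>\<rho>. \<iota> (u ^ card A) * y (\<rho> \<circ> \<sigma>))"
        by (rule R.poly_fun_mono[OF R.poly_fun_R_mult[OF R\<iota> y\<sigma>]]) (simp add: T_def)
      show "R.poly_fun T (\<lambda>\<rho>. \<iota> q * (y (\<rho> \<circ> \<sigma>) * \<Psi> \<rho>))"
        by (rule R.poly_fun_mono[OF R.poly_fun_R_mult[OF R\<iota> R.poly_fun_mult[OF y\<sigma> \<Psi>(1)]]]) (simp add: T_def)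
    qed
    moreover have "(\<Prod>\<sigma>\<in>insert \<sigma> A. \<iota> u + \<iota> q * y (\<rho> \<circ> \<sigma>)) = \<iota> u ^ card (insert \<sigma> A) + \<iota> q * \<Psi>' \<rho>" for \<rho>
      using insert.hyps by (simp add: \<Psi>(2) \<Psi>'_def hom_power algebra_simps)
    ultimately show ?case by blast
  qed
  from this[OF fin subset_refl] obtain \<Psi> t' where \<Psi>: "R.poly_fun t' \<Psi>"
    "\<And>\<rho>. (\<Prod>\<sigma>\<in>perms. \<iota> u + \<iota> q * y (\<rho> \<circ> \<sigma>)) = \<iota> u ^ fact d + \<iota> q * \<Psi> \<rho>" by (auto simp: card)
  have zero: "(\<Prod>\<sigma>\<in>perms. \<iota> u + \<iota> q * y (\<rho> \<circ> \<sigma>)) = 0" if \<rho>: "\<rho> permutes {..<d}" for \<rho>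
  proof (rule prod_zero[OF fin])
    show "\<exists>\<sigma>\<in>perms. \<iota> u + \<iota> q * y (\<rho> \<circ> \<sigma>) = 0"
      using rel permutes_inv[OF \<rho>] by (intro bexI[of _ "inv_into UNIV \<rho>"]) (auto simp: perms_def permutes_inv_o[OF \<rho>])
  qed
  have "\<iota> q \<noteq> 0" using q by simp
  hence "\<Psi> \<rho> = - (\<iota> u ^ fact d) / \<iota> q" if "\<rho> permutes {..<d}" for \<rho>
    using zero[OF that] \<Psi>(2)[of \<rho>] by (simp add: field_simps eq_neg_iff_add_eq_0)
  hence "- (\<iota> u ^ fact d) / \<iota> q \<in> R t'"
    using R.poly_fun_invariant[OF \<Psi>(1)] by blast
  then obtain \<psi> where "- (\<iota> u ^ fact d) / \<iota> q = \<iota> \<psi>" by (auto simp: R_def)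
  hence "- (\<iota> u ^ fact d) = \<iota> q * \<iota> \<psi>" using \<open>\<iota> q \<noteq> 0\<close> by (simp add: field_simps)
  hence "\<iota> (u ^ fact d) = \<iota> (q * (- \<psi>))"
    by (simp add: hom_mult hom_power hom_uminus) (metis minus_minus)
  hence "u ^ fact d = q * (- \<psi>)" by simp
  thus ?thesis by simp
qed

end

lemma sum_lessThan_add:
  fixes f :: "nat \<Rightarrow> 'a::comm_monoid_add"
  shows "(\<Sum>j<n + m. f j) = (\<Sum>j<n. f j) + (\<Sum>j<m. f (n + j))"
  by (induction m) (simp_all add: add.assoc)

context conjugates
begin

text \<open>
  The columns of the Wronskian matrix in its two forms. The first form is rational in the sense that \<open>\<iota> p\<close> and
  \<open>\<iota> q\<close> are fixed by all permutations of the roots; in the second form, the columns from \<open>n\<close> on are small when \<open>p / q\<close>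
  is close to \<open>x 0\<close>.
\<close>

definition rational_cols :: "'k poly \<Rightarrow> 'k poly \<Rightarrow> nat \<Rightarrow> (nat \<Rightarrow> nat \<times> (nat \<Rightarrow> nat)) \<Rightarrow> (nat \<Rightarrow> nat) \<Rightarrow> nat \<Rightarrow> 'o" where
  "rational_cols p q n v \<tau> j = (if j < n then \<iota> q else \<iota> p) * mono_val (v j) \<tau>"

definition small_cols :: "'k poly \<Rightarrow> 'k poly \<Rightarrow> nat \<Rightarrow> (nat \<Rightarrow> nat \<times> (nat \<Rightarrow> nat)) \<Rightarrow> (nat \<Rightarrow> nat) \<Rightarrow> nat \<Rightarrow> 'o" where
  "small_cols p q n v \<tau> j = (if j < n then \<iota> q else \<iota> p - \<iota> q * x 0) * mono_val (v j) \<tau>"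

lemma rational_cols_act: "\<tau> permutes {..<d} \<Longrightarrow> rational_cols p q n v \<tau> = rational_cols p q n (permute_exps \<tau> \<circ> v) id"
  by (rule ext) (simp only: rational_cols_def mono_val_permute[of \<tau>] comp_apply)

lemma small_cols_act: "\<tau> permutes {..<d} \<Longrightarrow> small_cols p q n v \<tau> = small_cols p q n (permute_exps \<tau> \<circ> v) id"
  by (rule ext) (simp only: small_cols_def mono_val_permute[of \<tau>] comp_apply)

text \<open>
  If the first \<open>n\<close> monomials are dependent, then both Wronskians vanish. Otherwise these span \<open>V\<^sub>r\<^sub>+\<^sub>s\<close> with
  \<open>s = c * d\<close>, which contains all products \<open>x 0 * v\<close> with \<open>v\<close> in \<open>V\<^sub>r\<close>, so that the terms \<open>q * x 0 * v\<close> can be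
  removed by column operations.
\<close>

lemma wronskian_rational_cols_eq_small_cols:
  fixes r :: nat
  defines "n \<equiv> rk (r + c * d)"
  assumes lo: "\<And>j. j < n \<Longrightarrow> v j \<in> monomials (r + c * d)" and hi: "\<And>j. n \<le> j \<Longrightarrow> j < N \<Longrightarrow> v j \<in> monomials r" and N: "n \<le> N"
  shows "wronskian N (rational_cols p q n v id) = wronskian N (small_cols p q n v id)"
proof (cases "wronskian n (\<lambda>j. mono_val (v j) id) = 0")
  case True
  then obtain C where C: "\<forall>j<n. D (C j) = 0" "\<exists>j<n. C j \<noteq> 0" "(\<Sum>j<n. C j * mono_val (v j) id) = 0"
    using relation_if_wronskian_eq_0 by blast
  then obtain j0 where j0: "j0 < n" "C j0 \<noteq> 0" by blast
  define C' where "C' j = (if j < n then C j else 0)" for j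
  have zero: "wronskian N f = 0" if f: "\<And>j. j < n \<Longrightarrow> f j = \<iota> q * mono_val (v j) id" for f
  proof (rule wronskian_eq_0_if_relation[of N C' j0])
    have "(\<Sum>j<N. C' j * f j) = (\<Sum>j<n. \<iota> q * (C j * mono_val (v j) id))"
      using N f by (intro sum.mono_neutral_cong_right) (auto simp: C'_def)
    also have "\<dots> = 0" using C(3) by (simp flip: sum_distrib_left)
    finally show "(\<Sum>j<N. C' j * f j) = 0" .
  qed (use C(1) j0 N in \<open>auto simp: C'_def\<close>)
  have "wronskian N (rational_cols p q n v id) = 0" by (rule zero) (simp add: rational_cols_def)
  moreover have "wronskian N (small_cols p q n v id) = 0" by (rule zero) (simp add: small_cols_def)
  ultimately show ?thesis by simp
next
  case False
  have "\<exists>C. (\<forall>i. D (C i) = 0) \<and> (n \<le> j \<longrightarrow> j < N \<longrightarrow>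
      x 0 * mono_val (v j) id = (\<Sum>i<n. C i * mono_val (v i) id))" (is "\<exists>C. ?Q j C") for j
  proof (cases "n \<le> j \<and> j < N")
    case j: True
    have "\<exists>C. (\<forall>i. D (C i) = 0) \<and> x 0 * mono_val (v j) id = (\<Sum>i<n. C i * mono_val (v i) id)"
    proof (rule maximal_independent_generates_span[where r = "r + c * d", folded n_def])
      show "x 0 * mono_val (v j) id \<in> span (r + c * d)"
        by (rule x0_mult_in_span) (rule hi[OF conjunct1[OF j] conjunct2[OF j]])
    qed (fact lo False)+
    then obtain C where "\<forall>i. D (C i) = 0" "x 0 * mono_val (v j) id = (\<Sum>i<n. C i * mono_val (v i) id)"
      by (elim exE conjE)
    thus ?thesis by (intro exI[of _ C] conjI impI)
  next
    case False
    thus ?thesis by (intro exI[of _ "\<lambda>_. 0"]) simp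
  qed
  hence "\<forall>j. \<exists>C. ?Q j C" by (rule allI)
  from choice[OF this] obtain C' where C': "\<forall>j. ?Q j (C' j)" by (rule exE)
  define C where "C i j = C' j i" for i j
  have C1: "D (C i j) = 0" for i j
    unfolding C_def by (rule C'[THEN spec, THEN conjunct1, THEN spec])
  have C2: "x 0 * mono_val (v j) id = (\<Sum>i<n. C i j * mono_val (v i) id)" if "n \<le> j" "j < N" for j
    unfolding C_def by (rule C'[THEN spec, THEN conjunct2, rule_format, OF that])
  show ?thesis
  proof (rule wronskian_column_operation[OF N C1])
    fix j assume j: "n \<le> j" "j < N"
    define y where "y = mono_val (v j) id"
    have "(\<Sum>i<n. C i j * small_cols p q n v id i) = (\<Sum>i<n. \<iota> q * (C i j * mono_val (v i) id))"
      by (rule sum.cong) (simp_all add: small_cols_def)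
    also have "\<dots> = \<iota> q * (x 0 * y)"
      unfolding sum_distrib_left[symmetric] C2[OF j, symmetric] y_def ..
    finally have "(\<Sum>i<n. C i j * small_cols p q n v id i) = \<iota> q * (x 0 * y)" .
    moreover have "rational_cols p q n v id j = \<iota> p * y" "small_cols p q n v id j = (\<iota> p - \<iota> q * x 0) * y"
      using j(1) by (simp_all add: rational_cols_def small_cols_def y_def)
    ultimately show "rational_cols p q n v id j = small_cols p q n v id j + (\<Sum>i<n. C i j * small_cols p q n v id i)"
      by (simp only: algebra_simps)
  qed (simp add: rational_cols_def small_cols_def)
qed

text \<open>
  Choose bases of both spaces. If the Wronskian were zero, there would be a relation \<open>p * b + q * s = 0\<close> with \<open>b\<close>
  nonzero in \<open>V\<^sub>r\<close>. Multiplying \<open>b\<close> up to a polynomial \<open>\<beta>\<close> of bounded degree shows that \<open>p * \<beta> / q\<close> is integral over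
  \<open>k[T]\<close>. Since \<open>q\<close> is coprime to \<open>p\<close> up to the factor \<open>a\<close>, it divides a power of \<open>a * \<beta>\<close>, against the
  assumption on its degree.
\<close>

lemma exists_nonzero_wronskian:
  fixes r :: nat
  defines "n \<equiv> rk (r + c * d)" and "m \<equiv> rk r"
  assumes q: "q \<noteq> 0" and p: "p = a * p0" "a \<noteq> 0" and bez: "u * p0 + u' * q = 1"
    and large: "degree q > fact d * (degree a + fact d * (r + c * d * d))"
  shows "\<exists>v. (\<forall>j<n. v j \<in> monomials (r + c * d)) \<and> (\<forall>j. n \<le> j \<longrightarrow> j < n + m \<longrightarrow> v j \<in> monomials r) \<and>
    wronskian (n + m) (rational_cols p q n v id) \<noteq> 0"
proof -
  obtain v1 where v1: "\<And>j. j < n \<Longrightarrow> v1 j \<in> monomials (r + c * d)" "wronskian n (\<lambda>j. mono_val (v1 j) id) \<noteq> 0"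
    using rk_witness[of "r + c * d"] unfolding n_def by blast
  obtain v2 where v2: "\<And>j. j < m \<Longrightarrow> v2 j \<in> monomials r" "wronskian m (\<lambda>j. mono_val (v2 j) id) \<noteq> 0"
    using rk_witness[of r] unfolding m_def by blast
  define v where "v j = (if j < n then v1 j else v2 (j - n))" for j
  have "wronskian (n + m) (rational_cols p q n v id) \<noteq> 0"
  proof
    assume "wronskian (n + m) (rational_cols p q n v id) = 0"
    then obtain C where C: "\<forall>j<n+m. D (C j) = 0" "\<exists>j<n+m. C j \<noteq> 0" "(\<Sum>j<n+m. C j * rational_cols p q n v id j) = 0"
      using relation_if_wronskian_eq_0 by blast
    define s where "s \<tau> = (\<Sum>j<n. C j * mono_val (v1 j) \<tau>)" for \<tau>
    define b where "b \<tau> = (\<Sum>j<m. C (n + j) * mono_val (v2 j) \<tau>)" for \<tau>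
    have "(\<Sum>j<n+m. C j * rational_cols p q n v id j) =
        (\<Sum>j<n. C j * rational_cols p q n v id j) + (\<Sum>j<m. C (n + j) * rational_cols p q n v id (n + j))"
      by (rule sum_lessThan_add)
    also have "\<dots> = \<iota> q * s id + \<iota> p * b id"
      by (simp add: rational_cols_def s_def b_def v_def sum_distrib_left mult_ac)
    finally have rel: "\<iota> q * s id + \<iota> p * b id = 0" using C(3) by simp
    have b0: "b id \<noteq> 0"
    proof
      assume b0: "b id = 0"
      have "\<forall>j<m. C (n + j) = 0"
      proof (rule ccontr)
        assume "\<not> ?thesis"
        then obtain j where "j < m" "C (n + j) \<noteq> 0" by blast
        hence "wronskian m (\<lambda>j. mono_val (v2 j) id) = 0"
          using C(1) b0 by (intro wronskian_eq_0_if_relation[of m "\<lambda>j. C (n + j)" j]) (auto simp: b_def)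
        thus False using v2(2) by simp
      qed
      moreover obtain j where j: "j < n + m" "C j \<noteq> 0" using C(2) by blast
      ultimately have "j < n" by (metis add_diff_inverse_nat nat_add_left_cancel_less)
      have "s id = 0" using rel b0 q by simp
      hence "wronskian n (\<lambda>j. mono_val (v1 j) id) = 0"
        using C(1) j \<open>j < n\<close> by (intro wronskian_eq_0_if_relation[of n C j]) (auto simp: s_def)
      thus False using v1(2) by simp
    qed
    have poly: "R.poly_fun (int (r' + c * d * d)) (\<lambda>\<tau>. C j * mono_val w \<tau>)"
      if "j < n + m" "w \<in> monomials r'" for j w r'
      using R.poly_fun_R_mult[OF const_in_R poly_fun_mono_val[OF that(2)], of "C j"] C(1) that(1) by simp
    have b_poly: "R.poly_fun (int (r + c * d * d)) b"
      unfolding b_def by (intro R.poly_fun_sum poly v2) auto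
    have s_poly: "R.poly_fun (int (r + c * d + c * d * d)) s"
      unfolding s_def by (intro R.poly_fun_sum poly v1) auto
    obtain \<beta> B t' where \<beta>: "\<beta> \<noteq> 0" "int (degree \<beta>) \<le> int (fact d) * int (r + c * d * d)"
        "R.poly_fun t' B" "\<iota> \<beta> = b id * B id"
      by (rule nonzero_multiple_in_base[OF b_poly of_nat_0_le_iff b0])
    have "q dvd (p * \<beta>) ^ fact d"
    proof (rule dvd_power_if_integral_quotient[OF R.poly_fun_mult[OF s_poly \<beta>(3)] _ q])
      have "\<iota> (p * \<beta>) + \<iota> q * (s id * B id) = (\<iota> q * s id + \<iota> p * b id) * B id"
        by (simp add: hom_mult \<beta>(4) algebra_simps)
      thus "\<iota> (p * \<beta>) + \<iota> q * (s id * B id) = 0" by (simp add: rel)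
    qed
    hence "q dvd p0 ^ fact d * (a * \<beta>) ^ fact d"
      by (simp add: p(1) power_mult_distrib mult_ac)
    hence "q dvd (a * \<beta>) ^ fact d" by (rule dvd_power_mult_cancel[OF bez])
    hence "degree q \<le> degree ((a * \<beta>) ^ fact d)"
      using p(2) \<beta>(1) by (intro dvd_imp_degree_le) auto
    also have "\<dots> = fact d * (degree a + degree \<beta>)"
      using p(2) \<beta>(1) by (simp add: degree_power_eq degree_mult_eq)
    also have "\<dots> \<le> fact d * (degree a + fact d * (r + c * d * d))"
    proof -
      have "int (degree \<beta>) \<le> int (fact d * (r + c * d * d))" using \<beta>(2) by simp
      hence "degree \<beta> \<le> fact d * (r + c * d * d)" by (simp only: of_nat_le_iff)
      thus ?thesis by (intro mult_left_mono add_left_mono) auto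
    qed
    finally show False using large by simp
  qed
  thus ?thesis by (intro exI[of _ v]) (simp add: v_def v1 v2)
qed

section \<open>The approximation inequality\<close>

text \<open>
  The number \<open>y\<close> in the proof is the sum of the \<open>\<kappa>\<close>-th powers of the Wronskians for all choices of \<open>n + m\<close>
  monomials. All permutations of the roots preserve it, so it lies in \<open>k[T]\<close>. Permutations that fix \<open>x 0\<close> preserve
  its second form, where the weights of the columns bound its size at the distinguished place by \<open>\<kappa> * W\<close>. The
  inequality states that this bound is not negative.
\<close>

theorem approximation_gap:
  fixes r :: nat and e :: int
  defines "n \<equiv> rk (r + c * d)" and "m \<equiv> rk r"
  assumes q: "q \<noteq> 0" and p: "p = a * p0" "a \<noteq> 0" and bez: "u * p0 + u' * q = 1"
    and large: "degree q > fact d * (degree a + fact d * (r + c * d * d))"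
    and approx: "\<iota> p - \<iota> q * x 0 \<in> S (- e)"
  shows "int m * e \<le> int (n * degree q + (n + m) * (r + c * d + c * d * d + \<delta> * (n + m)))"
proof -
  define N where "N = n + m"
  define V where "V = (\<Pi>\<^sub>E j\<in>{..<N}. if j < n then monomials (r + c * d) else monomials r)"
  have finV: "finite V" unfolding V_def by (intro finite_PiE) (auto simp: finite_monomials)
  define w where "w = r + c * d + c * d * d"
  obtain v0 where v0: "\<forall>j<n. v0 j \<in> monomials (r + c * d)" "\<forall>j. n \<le> j \<longrightarrow> j < n + m \<longrightarrow> v0 j \<in> monomials r"
    "wronskian (n + m) (rational_cols p q n v0 id) \<noteq> 0"
    using exists_nonzero_wronskian[OF q p bez large, folded n_def m_def] by (elim exE conjE)
  have "restrict v0 {..<N} \<in> V"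
    unfolding V_def restrict_PiE_iff using v0(1,2) by (simp add: N_def)
  moreover have "wronskian N (rational_cols p q n (restrict v0 {..<N}) id) = wronskian N (rational_cols p q n v0 id)"
    by (rule wronskian_cong) (simp add: rational_cols_def)
  hence "wronskian N (rational_cols p q n (restrict v0 {..<N}) id) \<noteq> 0"
    using v0(3) by (simp only: N_def not_False_eq_True)
  ultimately have "\<exists>\<kappa>\<ge>1. (\<Sum>v\<in>V. wronskian N (rational_cols p q n v id) ^ \<kappa>) \<noteq> 0"
    by (rule exists_power_sum_nonzero[OF finV])
  then obtain \<kappa> where \<kappa>: "\<kappa> \<ge> 1" "(\<Sum>v\<in>V. wronskian N (rational_cols p q n v id) ^ \<kappa>) \<noteq> 0"
    by blast
  define y where "y = (\<Sum>v\<in>V. wronskian N (rational_cols p q n v id) ^ \<kappa>)"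

  have V_D: "v j \<in> (if j < n then monomials (r + c * d) else monomials r)" if "v \<in> V" "j < N" for v j
  proof -
    have "j \<in> {..<N}" using that(2) by (rule lessThan_iff[THEN iffD2])
    from PiE_mem[OF that(1)[unfolded V_def] this] show ?thesis .
  qed
  have V_arb: "v j = undefined" if "v \<in> V" "\<not> j < N" for v j
  proof -
    have "j \<notin> {..<N}" using that(2) by (simp only: lessThan_iff not_False_eq_True)
    from PiE_arb[OF that(1)[unfolded V_def] this] show ?thesis .
  qed
  have monomials_mono: "monomials r \<subseteq> monomials (r + c * d)" unfolding monomials_def by (intro Sigma_mono) simp_all
  have V_lo: "v j \<in> monomials (r + c * d)" if "v \<in> V" "j < n" for v j
    using V_D[of v j] that by (simp add: N_def)
  have V_hi: "v j \<in> monomials r" if "v \<in> V" "n \<le> j" "j < N" for v j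
    using V_D[of v j] that by simp
  have V_all: "v j \<in> monomials (r + c * d)" if "v \<in> V" "j < N" for v j
    using V_lo[OF that(1), of j] V_hi[OF that(1) _ that(2)] monomials_mono by (cases "j < n") auto
  have permute_V: "restrict (permute_exps \<tau> \<circ> v) {..<N} \<in> V" if \<tau>: "\<tau> permutes {..<d}" and v: "v \<in> V" for \<tau> v
    unfolding V_def restrict_PiE_iff
  proof
    fix j assume "j \<in> {..<N}"
    thus "(permute_exps \<tau> \<circ> v) j \<in> (if j < n then monomials (r + c * d) else monomials r)"
      using V_lo[OF v, of j] V_hi[OF v, of j] by (simp add: permute_exps_in_monomials[OF \<tau>])
  qed

  have sum_permute: "(\<Sum>v\<in>V. wronskian N (rational_cols p q n v \<tau>) ^ \<kappa>) = y" if \<tau>: "\<tau> permutes {..<d}" for \<tau>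
    unfolding y_def
  proof (rule sum.reindex_bij_witness[of _ "\<lambda>v. restrict (permute_exps (inv_into UNIV \<tau>) \<circ> v) {..<N}" "\<lambda>v. restrict (permute_exps \<tau> \<circ> v) {..<N}"], goal_cases)
    case (1 v)
    show ?case
    proof
      fix j show "restrict (permute_exps (inv_into UNIV \<tau>) \<circ> restrict (permute_exps \<tau> \<circ> v) {..<N}) {..<N} j = v j"
        using V_arb[OF 1, of j] by (cases "j < N") (simp_all add: permute_exps_inv1[OF \<tau>])
    qed
  next
    case (2 v)
    thus ?case by (rule permute_V[OF \<tau>])
  next
    case (3 v)
    show ?case
    proof
      fix j show "restrict (permute_exps \<tau> \<circ> restrict (permute_exps (inv_into UNIV \<tau>) \<circ> v) {..<N}) {..<N} j = v j"
        using V_arb[OF 3, of j] by (cases "j < N") (simp_all add: permute_exps_inv2[OF \<tau>])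
    qed
  next
    case (4 v)
    thus ?case by (rule permute_V[OF permutes_inv[OF \<tau>]])
  next
    case (5 v)
    have "wronskian N (rational_cols p q n (restrict (permute_exps \<tau> \<circ> v) {..<N}) id) = wronskian N (rational_cols p q n v \<tau>)"
      unfolding rational_cols_act[OF \<tau>, of p q n v] by (rule wronskian_cong) (simp add: rational_cols_def)
    thus ?case by simp
  qed

  have R\<iota>: "\<iota> p \<in> R (int (degree p))" for p by (rule R_\<iota>I) auto
  have val_poly: "R.poly_fun (int w) (mono_val (v j))" if "v \<in> V" "j < N" for v j
    using poly_fun_mono_val[OF V_all[OF that]] by (simp add: w_def)

  define T where "T = int (max (degree q) (degree p)) + int w"
  have "R.poly_fun (int \<kappa> * ((\<Sum>j<N. T) + int (\<delta> * N * N))) (\<lambda>\<tau>. \<Sum>v\<in>V. wronskian N (rational_cols p q n v \<tau>) ^ \<kappa>)"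
  proof (intro R.poly_fun_sum R.poly_fun_power R.poly_fun_wronskian)
    fix v j assume vj: "v \<in> V" "j < N"
    have "R.poly_fun T (\<lambda>\<tau>. \<iota> s * mono_val (v j) \<tau>)" if "s \<in> {p, q}" for s
      by (rule R.poly_fun_mono[OF R.poly_fun_R_mult[OF R\<iota> val_poly[OF vj]]]) (use that in \<open>auto simp: T_def\<close>)
    thus "R.poly_fun T (\<lambda>\<tau>. rational_cols p q n v \<tau> j)" by (auto simp: rational_cols_def)
  qed
  from R.poly_fun_invariant[OF this sum_permute] obtain \<phi> where \<phi>: "y = \<iota> \<phi>" by (auto simp: R_def)
  have "\<phi> \<noteq> 0" using \<kappa>(2) \<phi> by (auto simp: y_def)

  define W where "W = int n * (int (degree q) + int w) + int m * (- e + int w) + int (\<delta> * N * N)"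
  have weights: "(\<Sum>j<N. if j < n then int (degree q) + int w else - e + int w) =
      int n * (int (degree q) + int w) + int m * (- e + int w)"
    by (simp add: N_def sum_lessThan_add)
  have "S.poly_fun (int \<kappa> * W) (\<lambda>\<tau>. \<Sum>v\<in>V. wronskian N (small_cols p q n v \<tau>) ^ \<kappa>)"
    unfolding W_def weights[symmetric]
  proof (intro S.poly_fun_sum S.poly_fun_power S.poly_fun_wronskian)
    fix v j assume vj: "v \<in> V" "j < N"
    note val = S_poly_fun_if_R_poly_fun[OF val_poly[OF vj]]
    have "S.poly_fun (int (degree q) + int w) (\<lambda>\<tau>. \<iota> q * mono_val (v j) \<tau>)"
      by (rule S.poly_fun_R_mult[OF S_\<iota> val])
    moreover have "S.poly_fun (- e + int w) (\<lambda>\<tau>. (\<iota> p - \<iota> q * x 0) * mono_val (v j) \<tau>)"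
      by (rule S.poly_fun_R_mult[OF approx val])
    ultimately show "S.poly_fun (if j < n then int (degree q) + int w else - e + int w) (\<lambda>\<tau>. small_cols p q n v \<tau> j)"
      by (auto simp: small_cols_def)
  qed
  moreover have "(\<Sum>v\<in>V. wronskian N (small_cols p q n v \<tau>) ^ \<kappa>) = y" if "\<tau> permutes {1..<d}" for \<tau>
  proof -
    have \<tau>: "\<tau> permutes {..<d}" using S_permutes[OF that] by blast
    have "wronskian N (small_cols p q n v \<tau>) = wronskian N (rational_cols p q n v \<tau>)" if v: "v \<in> V" for v
      unfolding small_cols_act[OF \<tau>, of p q n v] rational_cols_act[OF \<tau>, of p q n v]
    proof (rule wronskian_rational_cols_eq_small_cols[where r = r, folded n_def, symmetric])
      show "(permute_exps \<tau> \<circ> v) j \<in> monomials (r + c * d)" if "j < n" for j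
        using V_lo[OF v that] permute_exps_in_monomials[OF \<tau>] by simp
      show "(permute_exps \<tau> \<circ> v) j \<in> monomials r" if "n \<le> j" "j < N" for j
        using V_hi[OF v that] permute_exps_in_monomials[OF \<tau>] by simp
      show "n \<le> N" by (simp add: N_def)
    qed
    hence "(\<Sum>v\<in>V. wronskian N (small_cols p q n v \<tau>) ^ \<kappa>) = (\<Sum>v\<in>V. wronskian N (rational_cols p q n v \<tau>) ^ \<kappa>)"
      by (intro sum.cong) auto
    thus ?thesis using sum_permute[OF \<tau>] by simp
  qed
  ultimately have "y \<in> S (int \<kappa> * W)" by (rule S.poly_fun_invariant)
  hence "int \<kappa> * W \<ge> 0" using S_nonneg[of \<phi>] \<phi> \<open>\<phi> \<noteq> 0\<close> by simp
  hence "W \<ge> 0" using \<kappa>(1) by (simp add: zero_le_mult_iff)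
  thus ?thesis by (simp add: W_def N_def w_def algebra_simps)
qed

end

section \<open>Hensel's lemma for power series\<close>

lemma poly_Taylor2:
  fixes F :: "'a::idom poly"
  shows "\<exists>r. poly F (y + h) = poly F y + h * poly (pderiv F) y + h ^ 2 * r"
proof (induction F)
  case (pCons a F)
  then obtain r where r: "poly F (y + h) = poly F y + h * poly (pderiv F) y + h ^ 2 * r" by blast
  have "poly (pCons a F) (y + h) = poly (pCons a F) y + h * poly (pderiv (pCons a F)) y +
      h ^ 2 * (poly (pderiv F) y + y * r + h * r)"
    by (simp only: poly_pCons pderiv_pCons poly_add r) (simp add: algebra_simps power2_eq_square)
  thus ?case by blast
qed simp

text \<open>
  Each step of the approximation corrects one further coefficient, which a linear equation determines because the
  derivative at the root of the reduced polynomial is invertible.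
\<close>

lemma fps_Hensel:
  fixes F :: "'k::field fps poly"
  assumes root: "poly (map_poly (\<lambda>f. fps_nth f 0) F) a = 0"
    and simple: "poly (pderiv (map_poly (\<lambda>f. fps_nth f 0) F)) a \<noteq> 0"
  shows "\<exists>y. fps_nth y 0 = a \<and> poly F y = 0"
proof -
  interpret ev: comm_ring_hom "\<lambda>f :: 'k fps. fps_nth f 0"
    by standard auto
  interpret evp: map_poly_comm_ring_hom "\<lambda>f :: 'k fps. fps_nth f 0" ..
  have nth0: "fps_nth (poly F y) 0 = poly (map_poly (\<lambda>f. fps_nth f 0) F) (fps_nth y 0)" for F :: "'k fps poly" and y
    by simp
  have pderiv_ev: "map_poly (\<lambda>f. fps_nth f 0) (pderiv F) = pderiv (map_poly (\<lambda>f. fps_nth f 0) F)"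
    by (rule poly_eqI) (simp add: coeff_pderiv ev.hom_mult ev.hom_of_nat)
  define g where "g = poly (pderiv (map_poly (\<lambda>f. fps_nth f 0) F)) a"
  have "\<exists>Y. \<forall>n. (fps_nth (Y n) 0 = a \<and> (\<forall>i\<le>n. fps_nth (poly F (Y n)) i = 0)) \<and>
      (\<forall>i\<le>n. fps_nth (Y (Suc n)) i = fps_nth (Y n) i)"
  proof (rule dependent_nat_choice)
    show "\<exists>y. fps_nth y 0 = a \<and> (\<forall>i\<le>0. fps_nth (poly F y) i = 0)"
      by (rule exI[of _ "fps_const a"]) (simp only: le_0_eq simp_thms nth0 fps_nth_fps_const if_True root)
  next
    fix y n assume y: "fps_nth y 0 = a \<and> (\<forall>i\<le>n. fps_nth (poly F y) i = 0)"
    define b where "b = - fps_nth (poly F y) (Suc n) / g"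
    define h where "h = fps_X ^ Suc n * fps_const b"
    obtain r where r: "poly F (y + h) = poly F y + h * poly (pderiv F) y + h ^ 2 * r"
      using poly_Taylor2[of F y h] by blast
    have h2: "h ^ 2 * r = fps_X ^ (2 * Suc n) * (fps_const (b ^ 2) * r)"
      by (simp add: h_def power_mult_distrib fps_const_power power_mult[symmetric] mult_ac del: power_Suc)
    have h1: "h * poly (pderiv F) y = fps_X ^ Suc n * (fps_const b * poly (pderiv F) y)"
      by (simp add: h_def mult.assoc del: power_Suc)
    have nth: "fps_nth (poly F (y + h)) i = fps_nth (poly F y) i + (if i = Suc n then b * g else 0)" if "i \<le> Suc n" for i
    proof -
      have "fps_nth (poly (pderiv F) y) 0 = g" using y by (simp only: nth0 pderiv_ev g_def)
      thus ?thesis unfolding r h1 h2 using that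
        by (simp add: fps_X_power_mult_nth del: power_Suc)
    qed
    have "fps_nth (poly F (y + h)) i = 0" if "i \<le> Suc n" for i
      using nth[OF that] y that simple by (auto simp: b_def g_def le_Suc_eq)
    moreover have "fps_nth (y + h) i = fps_nth y i" if "i \<le> n" for i
      using that by (simp add: h_def fps_X_power_mult_nth del: power_Suc)
    ultimately show "\<exists>y'. (fps_nth y' 0 = a \<and> (\<forall>i\<le>Suc n. fps_nth (poly F y') i = 0)) \<and>
        (\<forall>i\<le>n. fps_nth y' i = fps_nth y i)"
      using y by (intro exI[of _ "y + h"]) auto
  qed
  then obtain Y where Y: "\<And>n. fps_nth (Y n) 0 = a" "\<And>n i. i \<le> n \<Longrightarrow> fps_nth (poly F (Y n)) i = 0"
    "\<And>n i. i \<le> n \<Longrightarrow> fps_nth (Y (Suc n)) i = fps_nth (Y n) i" by blast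
  define y where "y = Abs_fps (\<lambda>n. fps_nth (Y n) n)"
  have stable: "fps_nth (Y (n + k)) n = fps_nth (Y n) n" for n k
    by (induction k) (simp_all add: Y(3))
  have "fps_nth (poly F y) n = 0" for n
  proof -
    have "fps_nth (y - Y n) i = 0" if "i \<le> n" for i
      using stable[of i "n - i"] that by (simp add: y_def)
    then obtain z where z: "y - Y n = fps_X ^ Suc n * z"
      using fps_shift_times_fps_X_power[of "Suc n" "y - Y n"]
      by (metis less_Suc_eq_le mult.commute subdegree_geI subdegree_0 fps_shift_zero mult_zero_right fps_zero_nth fps_ext)
    obtain r where r: "poly F (Y n + fps_X ^ Suc n * z) = poly F (Y n) +
        fps_X ^ Suc n * z * poly (pderiv F) (Y n) + (fps_X ^ Suc n * z) ^ 2 * r"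
      using poly_Taylor2 by blast
    have "poly F y = poly F (Y n) + fps_X ^ Suc n * (z * poly (pderiv F) (Y n) + z * (fps_X ^ Suc n * z) * r)"
      using r z by (simp add: algebra_simps power2_eq_square del: power_Suc)
    thus ?thesis using Y(2)[of n n] by (simp add: fps_X_power_mult_nth del: power_Suc)
  qed
  hence "poly F y = 0" by (intro fps_ext) simp
  moreover have "fps_nth y 0 = a" by (simp add: y_def Y(1))
  ultimately show ?thesis by blast
qed

section \<open>The valuation at infinity\<close>

definition val_ge :: "int \<Rightarrow> 'k::field fls \<Rightarrow> bool" where
  "val_ge n f \<longleftrightarrow> (\<forall>k<n. fls_nth f k = 0)"

lemma val_ge_iff: "val_ge n f \<longleftrightarrow> f = 0 \<or> n \<le> fls_subdegree f"
  unfolding val_ge_def using fls_subdegree_geI[of f n] by auto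

lemma val_ge_0 [simp]: "val_ge n 0"
  by (simp add: val_ge_def)

lemma val_ge_add: "val_ge n f \<Longrightarrow> val_ge n g \<Longrightarrow> val_ge n (f + g)"
  by (simp add: val_ge_def)

lemma val_ge_mult: "val_ge m f \<Longrightarrow> val_ge n g \<Longrightarrow> val_ge (m + n) (f * g)"
  by (cases "f = 0 \<or> g = 0") (auto simp: val_ge_iff)

lemma val_ge_mono: "val_ge n f \<Longrightarrow> m \<le> n \<Longrightarrow> val_ge m f"
  by (auto simp: val_ge_def)

lemma hom_fls_of_T_poly: "inj_idom_hom (fls_of_T_poly :: 'k::field poly \<Rightarrow> 'k fls)"
proof
  interpret const: comm_ring_hom "fls_const :: 'k \<Rightarrow> 'k fls"
    by standard (auto simp: fls_plus_const)
  interpret cp: map_poly_comm_ring_hom "fls_const :: 'k \<Rightarrow> 'k fls" ..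
  fix p q :: "'k poly"
  show "fls_of_T_poly (p + q) = fls_of_T_poly p + fls_of_T_poly q"
    by (simp add: fls_of_T_poly_def cp.hom_add)
  show "fls_of_T_poly (p * q) = fls_of_T_poly p * fls_of_T_poly q"
    by (simp add: fls_of_T_poly_def cp.hom_mult)
  show "fls_of_T_poly (1 :: 'k poly) = 1" "fls_of_T_poly (0 :: 'k poly) = 0"
    by (simp_all add: fls_of_T_poly_def)
  show "fls_of_T_poly p = 0 \<Longrightarrow> p = 0"
    using fls_abs_of_T_poly[of p 2] by (auto simp: fls_abs_def)
qed

lemma subdegree_fls_of_T_poly:
  assumes "p \<noteq> 0"
  shows "fls_subdegree (fls_of_T_poly p) = - int (degree p)"
proof (rule fls_subdegree_eqI)
  show "fls_nth (fls_of_T_poly p) (- int (degree p)) \<noteq> 0"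
    using assms by (simp add: fls_nth_of_T_poly)
qed (auto simp: fls_nth_of_T_poly intro: coeff_eq_0)

lemma val_ge_fls_of_T_poly: "val_ge n (fls_of_T_poly p) \<longleftrightarrow> p = 0 \<or> n \<le> - int (degree p)"
proof -
  interpret J: inj_idom_hom "fls_of_T_poly :: 'a poly \<Rightarrow> 'a fls" by (rule hom_fls_of_T_poly)
  show ?thesis by (cases "p = 0") (auto simp: val_ge_iff subdegree_fls_of_T_poly)
qed

text \<open>
  The derivation \<open>d/dT\<close>, written in the variable \<open>X = 1/T\<close> of the Laurent series.
\<close>

definition T_deriv :: "'k::field fls \<Rightarrow> 'k fls" where
  "T_deriv f = - (fls_X ^ 2 * fls_deriv f)"

lemma derivation_T_deriv: "derivation_field T_deriv"
  by standard (simp_all add: T_deriv_def algebra_simps)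

lemma val_ge_T_deriv: "val_ge n f \<Longrightarrow> val_ge n (T_deriv f)"
proof -
  assume "val_ge n f"
  hence "val_ge (n - 1) (fls_deriv f)" by (auto simp: val_ge_def)
  moreover have "val_ge 2 (fls_X ^ 2 :: 'a fls)" by (auto simp: val_ge_iff fls_subdegree_pow)
  ultimately have "val_ge (2 + (n - 1)) (fls_X ^ 2 * fls_deriv f)" by (rule val_ge_mult[rotated])
  thus ?thesis by (auto simp: T_deriv_def val_ge_def)
qed

lemma T_deriv_fls_of_T_poly: "T_deriv (fls_of_T_poly p) = fls_of_T_poly (pderiv p)"
proof (induction p)
  case 0
  show ?case by (simp add: T_deriv_def fls_of_T_poly_def)
next
  case (pCons a p)
  have X: "fls_X ^ 2 * fls_X_inv ^ 2 = (1 :: 'a fls)"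
    by (simp add: fls_X_inv_conv_shift_1 power2_eq_square fls_X_conv_shift_1 fls_times_both_shifted_simp)
  have pC: "fls_of_T_poly (pCons b q) = fls_const b + fls_X_inv * fls_of_T_poly q" for b and q :: "'a poly"
  proof -
    interpret const: comm_ring_hom "fls_const :: 'a \<Rightarrow> 'a fls"
      by standard (auto simp: fls_plus_const)
    show ?thesis by (simp add: fls_of_T_poly_def const.map_poly_pCons_hom)
  qed
  have add: "fls_of_T_poly (q + q') = fls_of_T_poly q + fls_of_T_poly q'" for q q' :: "'a poly"
    by (rule fls_eqI) (simp add: fls_nth_of_T_poly)
  have "T_deriv (fls_of_T_poly (pCons a p)) = fls_X_inv * T_deriv (fls_of_T_poly p) + fls_of_T_poly p * (fls_X ^ 2 * fls_X_inv ^ 2)"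
    by (simp add: pC T_deriv_def algebra_simps)
  also have "\<dots> = fls_of_T_poly (pderiv (pCons a p))"
    using pC[of 0 "pderiv p"] by (simp add: X pCons.IH pderiv_pCons add)
  finally show ?case .
qed

section \<open>Minimal equations over the polynomial ring\<close>

lemma derivation_of_poly_value:
  fixes \<iota> :: "'k::field poly \<Rightarrow> 'o::field"
  assumes "inj_idom_hom \<iota>" and "derivation_field D" and D\<iota>: "\<And>p. D (\<iota> p) = \<iota> (E p)" and E0: "E 0 = 0"
  shows "D (poly (map_poly \<iota> H) y) = poly (map_poly \<iota> (map_poly E H)) y + poly (map_poly \<iota> (pderiv H)) y * D y"
proof -
  interpret inj_idom_hom \<iota> by fact
  interpret derivation_field D by fact
  interpret mp: map_poly_inj_idom_hom \<iota> ..
  have E: "map_poly E (pCons a H) = pCons (E a) (map_poly E H)" for a H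
    by (rule poly_eqI) (simp add: coeff_map_poly E0 coeff_pCons split: nat.splits)
  show ?thesis
    by (induction H) (simp_all add: D_add D_mult D\<iota> E map_poly_pCons_hom pderiv_pCons mp.hom_add algebra_simps)
qed

text \<open>
  \<open>A\<close> is integral over \<open>k[T]\<close>, and \<open>P\<close> is a monic equation of least degree among all nonzero polynomials over
  \<open>k[T]\<close>.
\<close>

locale min_poly =
  fixes A :: "'k::field_char_0 fls" and P :: "'k poly poly"
  assumes P_monic: "lead_coeff P = 1" and P_root: "poly (map_poly fls_of_T_poly P) A = 0"
    and P_min: "H \<noteq> 0 \<Longrightarrow> poly (map_poly fls_of_T_poly H) A = 0 \<Longrightarrow> degree P \<le> degree H"
begin

sublocale J: inj_idom_hom "fls_of_T_poly :: 'k poly \<Rightarrow> 'k fls"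
  by (rule hom_fls_of_T_poly)

sublocale Jp: map_poly_inj_idom_hom "fls_of_T_poly :: 'k poly \<Rightarrow> 'k fls" ..

lemma degree_P: "degree P \<ge> 1"
proof (rule ccontr)
  assume "\<not> ?thesis"
  hence "degree P = 0" by simp
  then obtain a where "P = [:a:]" by (auto elim: degree_eq_zeroE)
  thus False using P_monic P_root by simp
qed

text \<open>
  \<open>P\<close> is irreducible over \<open>k(T)\<close>, so relations of one of its roots hold for all of them, in whatever field they
  lie. Pseudo-division by an equation \<open>P1\<close> of least degree for \<open>y\<close> takes the place of a greatest common divisor
  over \<open>k(T)\<close>.
\<close>

lemma root_at_place_imp_root:
  fixes \<iota> :: "'k poly \<Rightarrow> 'o::field"
  assumes hom: "inj_idom_hom \<iota>" and root: "poly (map_poly \<iota> P) y = 0" and H: "poly (map_poly \<iota> H) y = 0"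
  shows "poly (map_poly fls_of_T_poly H) A = 0"
proof -
  interpret i: inj_idom_hom \<iota> by fact
  interpret ip: map_poly_inj_idom_hom \<iota> ..
  define Z where "Z = {H. H \<noteq> 0 \<and> poly (map_poly \<iota> H) y = 0}"
  have "P \<in> Z" using root P_monic by (auto simp: Z_def)
  define P1 where "P1 = arg_min degree (\<lambda>H. H \<in> Z)"
  have P1: "P1 \<in> Z" "\<And>H. H \<in> Z \<Longrightarrow> degree P1 \<le> degree H"
    unfolding P1_def using arg_min_natI[of "\<lambda>H. H \<in> Z" P degree] arg_min_nat_le[of "\<lambda>H. H \<in> Z" _ degree] \<open>P \<in> Z\<close>
    by blast+
  have "P1 \<noteq> 0" using P1 by (auto simp: Z_def)
  have div: "\<exists>a Q. a \<noteq> 0 \<and> Polynomial.smult a H = P1 * Q" if "poly (map_poly \<iota> H) y = 0" for H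
  proof -
    obtain a Q where aQ: "a \<noteq> 0" "Polynomial.smult a H = P1 * Q + pseudo_mod H P1"
      using pseudo_mod(1)[OF \<open>P1 \<noteq> 0\<close>] by blast
    have "pseudo_mod H P1 = Polynomial.smult a H - P1 * Q" using aQ by simp
    hence "poly (map_poly \<iota> (pseudo_mod H P1)) y = 0"
      using that P1(1) by (simp add: ip.hom_minus ip.hom_mult i.map_poly_hom_smult Z_def)
    hence "pseudo_mod H P1 \<noteq> 0 \<Longrightarrow> pseudo_mod H P1 \<in> Z" by (simp add: Z_def)
    hence "pseudo_mod H P1 = 0"
      using P1(2)[of "pseudo_mod H P1"] pseudo_mod(2)[OF \<open>P1 \<noteq> 0\<close>, of H] by linarith
    thus ?thesis using aQ by auto
  qed
  have degP1: "degree P1 \<ge> 1"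
  proof (rule ccontr)
    assume "\<not> ?thesis"
    hence "degree P1 = 0" by simp
    then obtain a where "P1 = [:a:]" by (auto elim: degree_eq_zeroE)
    thus False using P1(1) by (auto simp: Z_def)
  qed
  have ev_smult: "poly (map_poly fls_of_T_poly (Polynomial.smult a H)) A = fls_of_T_poly a * poly (map_poly fls_of_T_poly H) A" for a H
    by (simp add: J.map_poly_hom_smult)
  have ev_mult: "poly (map_poly fls_of_T_poly (H * Q)) A = poly (map_poly fls_of_T_poly H) A * poly (map_poly fls_of_T_poly Q) A" for H Q
    by (simp add: Jp.hom_mult)
  have P1A: "poly (map_poly fls_of_T_poly P1) A = 0"
  proof -
    obtain a Q where aQ: "a \<noteq> 0" "Polynomial.smult a P = P1 * Q" using div[OF root] by blast
    have "poly (map_poly fls_of_T_poly P1) A * poly (map_poly fls_of_T_poly Q) A = 0"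
      using ev_smult[of a P] ev_mult[of P1 Q] aQ(2) P_root by simp
    moreover have "poly (map_poly fls_of_T_poly Q) A \<noteq> 0"
    proof
      assume 0: "poly (map_poly fls_of_T_poly Q) A = 0"
      have "P \<noteq> 0" using P_monic by auto
      hence "Q \<noteq> 0" using aQ by auto
      hence "degree P \<le> degree Q" using P_min 0 by blast
      moreover have "degree P = degree P1 + degree Q"
        using aQ \<open>P1 \<noteq> 0\<close> \<open>Q \<noteq> 0\<close> by (metis degree_mult_eq degree_smult_eq)
      ultimately show False using degP1 by simp
    qed
    ultimately show ?thesis by simp
  qed
  obtain a Q where aQ: "a \<noteq> 0" "Polynomial.smult a H = P1 * Q" using div[OF H] by blast
  have "fls_of_T_poly a * poly (map_poly fls_of_T_poly H) A = 0"
    using ev_smult[of a H] ev_mult[of P1 Q] aQ(2) P1A by simp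
  thus ?thesis using aQ(1) by simp
qed

text \<open>
  In characteristic zero \<open>P\<close> and its derivative have no common factor over \<open>k(T)\<close>. A combination of both that
  has least degree divides \<open>P\<close> up to a constant of \<open>k(T)\<close>, so it has degree zero by the irreducibility of \<open>P\<close>.
\<close>

lemma separable: "\<exists>\<Delta> u v. \<Delta> \<noteq> 0 \<and> u * P + v * pderiv P = [:\<Delta>:]"
proof -
  define Z where "Z = {H. H \<noteq> 0 \<and> (\<exists>u v. H = u * P + v * pderiv P)}"
  have P0: "P \<noteq> 0" using P_monic by auto
  moreover have "P = 1 * P + 0 * pderiv P" by simp
  ultimately have "P \<in> Z" unfolding Z_def by blast
  have "pderiv P \<noteq> 0" using degree_P by (simp add: pderiv_eq_0_iff)
  moreover have "pderiv P = 0 * P + 1 * pderiv P" by simp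
  ultimately have P'Z: "pderiv P \<in> Z" unfolding Z_def by blast
  define P1 where "P1 = arg_min degree (\<lambda>H. H \<in> Z)"
  have P1: "P1 \<in> Z" "\<And>H. H \<in> Z \<Longrightarrow> degree P1 \<le> degree H"
    unfolding P1_def using arg_min_natI[of "\<lambda>H. H \<in> Z" P degree] arg_min_nat_le[of "\<lambda>H. H \<in> Z" _ degree] \<open>P \<in> Z\<close>
    by blast+
  have "P1 \<noteq> 0" using P1 by (auto simp: Z_def)
  obtain u1 v1 where uv1: "P1 = u1 * P + v1 * pderiv P" using P1 by (auto simp: Z_def)
  have "degree P1 < degree P" using P1(2)[OF P'Z] degree_pderiv[of P] degree_P by simp
  obtain a Q where aQ: "a \<noteq> 0" "Polynomial.smult a P = P1 * Q + pseudo_mod P P1"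
    using pseudo_mod(1)[OF \<open>P1 \<noteq> 0\<close>] by blast
  have "pseudo_mod P P1 = ([:a:] - Q * u1) * P + (- Q * v1) * pderiv P"
  proof -
    have "pseudo_mod P P1 = [:a:] * P - P1 * Q" using aQ by simp
    thus ?thesis by (subst (asm) (2) uv1) (simp add: algebra_simps)
  qed
  hence "pseudo_mod P P1 \<noteq> 0 \<Longrightarrow> pseudo_mod P P1 \<in> Z" unfolding Z_def by blast
  hence "pseudo_mod P P1 = 0"
    using P1(2)[of "pseudo_mod P P1"] pseudo_mod(2)[OF \<open>P1 \<noteq> 0\<close>, of P] by linarith
  hence eq: "Polynomial.smult a P = P1 * Q" using aQ by simp
  have "Q \<noteq> 0" using eq aQ P0 by auto
  have degs: "degree P = degree P1 + degree Q"
    using aQ eq \<open>P1 \<noteq> 0\<close> \<open>Q \<noteq> 0\<close> by (metis degree_mult_eq degree_smult_eq)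
  have "poly (map_poly fls_of_T_poly P1) A * poly (map_poly fls_of_T_poly Q) A = poly (map_poly fls_of_T_poly (Polynomial.smult a P)) A"
    unfolding eq by (simp add: Jp.hom_mult)
  also have "\<dots> = 0" using P_root by (simp add: J.map_poly_hom_smult)
  finally have "poly (map_poly fls_of_T_poly P1) A = 0 \<or> poly (map_poly fls_of_T_poly Q) A = 0" by simp
  hence "degree P \<le> degree P1 \<or> degree P \<le> degree Q"
    using P_min \<open>P1 \<noteq> 0\<close> \<open>Q \<noteq> 0\<close> by blast
  hence "degree P1 = 0" using \<open>degree P1 < degree P\<close> degs by simp
  then obtain \<Delta> where "P1 = [:\<Delta>:]" by (auto elim: degree_eq_zeroE)
  thus ?thesis using uv1 \<open>P1 \<noteq> 0\<close> by auto
qed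

end

section \<open>Expansion of the conjugates at an ordinary point\<close>

lemma distinct_roots_alg_closed:
  fixes p :: "'k::alg_closed_field poly"
  assumes "p \<noteq> 0" and sep: "\<And>a. poly p a = 0 \<Longrightarrow> poly (pderiv p) a \<noteq> 0"
  shows "card {a. poly p a = 0} = degree p"
proof -
  obtain M where M: "size M = degree p" "p = Polynomial.smult (lead_coeff p) (\<Prod>x\<in>#M. [:-x, 1:])"
    using alg_closed_imp_factorization[OF assms(1)] by blast
  have lc: "lead_coeff p \<noteq> 0" using assms(1) by simp
  have roots: "{a. poly p a = 0} = set_mset M"
  proof -
    have "poly p a = lead_coeff p * (\<Prod>x\<in>#M. a - x)" for a
      by (subst M(2)) (simp add: poly_prod_mset image_mset.compositionality comp_def)
    thus ?thesis using lc by auto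
  qed
  have "count M a \<le> 1" for a
  proof (rule ccontr)
    assume "\<not> ?thesis"
    hence "{#a, a#} \<subseteq># M" by (simp add: subseteq_mset_def)
    then obtain M' where M': "M = {#a, a#} + M'" by (metis subset_mset.le_iff_add)
    define h where "h = Polynomial.smult (lead_coeff p) (\<Prod>x\<in>#M'. [:-x, 1:])"
    have "p = [:-a, 1:] * ([:-a, 1:] * h)"
      by (subst M(2)) (simp add: M' h_def mult_ac)
    moreover have "poly ([:-a, 1:] * ([:-a, 1:] * h)) a = 0" "poly (pderiv ([:-a, 1:] * ([:-a, 1:] * h))) a = 0"
      by (simp_all add: pderiv_mult del: mult_pCons_left)
    ultimately show False using sep[of a] by metis
  qed
  hence "M = mset_set (set_mset M)"
    by (intro multiset_eqI) (metis count_eq_zero_iff count_mset_set(1) count_mset_set(3) finite_set_mset le_neq_implies_less less_one)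
  hence "card (set_mset M) = size M" by (metis size_mset_set)
  thus ?thesis using M(1) roots by simp
qed

text \<open>
  At a point \<open>t\<^sub>0\<close> with \<open>\<Delta> t\<^sub>0 \<noteq> 0\<close>, the polynomial \<open>P\<close> specializes to one with distinct roots. These lift to
  power series in \<open>T - t\<^sub>0\<close>, which form a differential field with constants \<open>k\<close>. The element \<open>r (x 0)\<close> belongs to
  \<open>S t\<close> if \<open>r A\<close> has size at most \<open>t\<close> at infinity; all properties of \<open>S\<close> hold because evaluation at \<open>x 0\<close> and
  at \<open>A\<close> are compatible with the derivations, and because every relation of \<open>x 0\<close> holds for \<open>A\<close>.
\<close>

theorem exists_conjugates:
  fixes A :: "'k::{alg_closed_field, field_char_0} fls"
  assumes "min_poly A P"
  shows "\<exists>(\<iota> :: 'k poly \<Rightarrow> 'k fls) D x d c \<delta> g \<Delta> S. conjugates \<iota> D x d c \<delta> P g \<Delta> S \<and>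
    (\<forall>p q e. val_ge e (fls_of_T_poly p - fls_of_T_poly q * A) \<longrightarrow> \<iota> p - \<iota> q * x 0 \<in> S (- e))"
proof -
  interpret min_poly A P by fact
  define d where "d = degree P"
  obtain \<Delta> u v where \<Delta>: "\<Delta> \<noteq> 0" "u * P + v * pderiv P = [:\<Delta>:]" using separable by blast
  have "finite {t. poly \<Delta> t = 0}" using \<Delta>(1) by (rule poly_roots_finite)
  then obtain t0 where t0: "poly \<Delta> t0 \<noteq> 0"
    using infinite_UNIV_char_0[where 'a = 'k] by (metis (mono_tags) UNIV_eq_I mem_Collect_eq)

  define \<kappa> :: "'k poly \<Rightarrow> 'k fps" where "\<kappa> p = fps_of_poly (pcompose p [:t0, 1:])" for p
  define \<iota> :: "'k poly \<Rightarrow> 'k fls" where "\<iota> p = fps_to_fls (\<kappa> p)" for p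
  interpret \<kappa>: inj_idom_hom \<kappa>
  proof
    show "\<kappa> x = 0 \<Longrightarrow> x = 0" for x
      by (simp add: \<kappa>_def pcompose_eq_0_iff)
  qed (simp_all add: \<kappa>_def pcompose_add pcompose_mult fps_of_poly_add fps_of_poly_mult pcompose_1)
  interpret \<iota>: inj_idom_hom \<iota>
    by standard (simp_all add: \<iota>_def \<kappa>.hom_add \<kappa>.hom_mult fls_times_fps_to_fls)
  interpret \<kappa>p: map_poly_inj_idom_hom \<kappa> ..
  interpret \<iota>p: map_poly_inj_idom_hom \<iota> ..
  have \<kappa>0: "fps_nth (\<kappa> p) 0 = poly p t0" for p
    by (simp add: \<kappa>_def poly_0_coeff_0[symmetric] poly_pcompose)
  have \<iota>_const: "\<iota> [:a:] = fls_const a" for a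
    by (simp add: \<iota>_def \<kappa>_def fps_of_poly_const)
  have \<iota>_deriv: "fls_deriv (\<iota> p) = \<iota> (pderiv p)" for p
    by (simp add: \<iota>_def \<kappa>_def fls_deriv_fps_to_fls fps_of_poly_pderiv[symmetric] pderiv_pcompose pderiv_pCons)

  interpret ev: comm_ring_hom "\<lambda>p :: 'k poly. poly p t0" by standard auto
  interpret evp: map_poly_comm_ring_hom "\<lambda>p :: 'k poly. poly p t0" ..
  define P0 where "P0 = map_poly (\<lambda>p. poly p t0) P"
  have P0_coeff: "coeff P0 j = poly (coeff P j) t0" for j by (simp add: P0_def)
  have pderiv_P0: "pderiv P0 = map_poly (\<lambda>p. poly p t0) (pderiv P)"
    by (rule poly_eqI) (simp add: P0_def coeff_pderiv)
  have degP0: "degree P0 = d"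
  proof (rule antisym)
    show "degree P0 \<le> d" unfolding P0_def d_def by (rule degree_map_poly_le)
    show "d \<le> degree P0" by (rule le_degree) (use P_monic in \<open>simp add: P0_coeff d_def\<close>)
  qed
  have "P0 \<noteq> 0" using degP0 degree_P d_def by auto
  moreover have sep: "poly (pderiv P0) a \<noteq> 0" if "poly P0 a = 0" for a
  proof
    assume 0: "poly (pderiv P0) a = 0"
    have "map_poly (\<lambda>p. poly p t0) (u * P + v * pderiv P) = [:poly \<Delta> t0:]"
      unfolding \<Delta>(2) by (rule poly_eqI) (simp add: coeff_map_poly coeff_pCons split: nat.splits)
    hence "map_poly (\<lambda>p. poly p t0) u * P0 + map_poly (\<lambda>p. poly p t0) v * pderiv P0 = [:poly \<Delta> t0:]"
      by (simp only: evp.hom_add evp.hom_mult P0_def[symmetric] pderiv_P0[symmetric])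
    hence "poly [:poly \<Delta> t0:] a = poly (map_poly (\<lambda>p. poly p t0) u) a * poly P0 a + poly (map_poly (\<lambda>p. poly p t0) v) a * poly (pderiv P0) a"
      by (metis poly_add poly_mult)
    thus False using t0 0 that by simp
  qed
  ultimately have card: "card {a. poly P0 a = 0} = d"
    using distinct_roots_alg_closed[of P0] degP0 by simp
  then obtain \<rho> where \<rho>: "bij_betw \<rho> {..<d} {a. poly P0 a = 0}"
    using ex_bij_betw_nat_finite[of "{a. poly P0 a = 0}"] poly_roots_finite[OF \<open>P0 \<noteq> 0\<close>]
    by (auto simp: lessThan_atLeast0)
  have lift: "\<exists>y. fps_nth y 0 = a \<and> poly (map_poly \<kappa> P) y = 0" if "poly P0 a = 0" for a
  proof (rule fps_Hensel)
    have "map_poly (\<lambda>f. fps_nth f 0) (map_poly \<kappa> P) = P0"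
      by (rule poly_eqI) (simp add: coeff_map_poly P0_coeff \<kappa>0)
    thus "poly (map_poly (\<lambda>f. fps_nth f 0) (map_poly \<kappa> P)) a = 0"
      "poly (pderiv (map_poly (\<lambda>f. fps_nth f 0) (map_poly \<kappa> P))) a \<noteq> 0"
      using that sep[OF that] by simp_all
  qed
  define Y where "Y i = (SOME y. fps_nth y 0 = \<rho> i \<and> poly (map_poly \<kappa> P) y = 0)" for i
  have Y: "fps_nth (Y i) 0 = \<rho> i \<and> poly (map_poly \<kappa> P) (Y i) = 0" if "i < d" for i
    unfolding Y_def by (rule someI_ex, rule lift) (use bij_betwE[OF \<rho>] that in auto)
  define x where "x i = fps_to_fls (Y i)" for i
  interpret f2l: comm_ring_hom "fps_to_fls :: 'k fps \<Rightarrow> 'k fls"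
    by standard (simp_all add: fls_times_fps_to_fls)
  have x_root: "poly (map_poly \<iota> P) (x i) = 0" if "i < d" for i
  proof -
    have "map_poly \<iota> P = map_poly fps_to_fls (map_poly \<kappa> P)"
      by (rule poly_eqI) (simp add: coeff_map_poly \<iota>_def)
    thus ?thesis using Y[OF that] by (simp add: x_def)
  qed
  have x_inj: "inj_on x {..<d}"
  proof (rule inj_onI)
    fix i j assume ij: "i \<in> {..<d}" "j \<in> {..<d}" "x i = x j"
    hence "\<rho> i = \<rho> j" using Y[of i] Y[of j] by (simp add: x_def)
    thus "i = j" using bij_betw_imp_inj_on[OF \<rho>] ij by (auto dest: inj_onD)
  qed
  have lead: "coeff P d = 1" using P_monic by (simp add: d_def)
  have map_P: "map_poly \<iota> P = (\<Prod>i<d. [:- x i, 1:])"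
  proof (rule poly_eqI_degree_lead_coeff[where A = "x ` {..<d}" and n = d])
    show "coeff (map_poly \<iota> P) d = coeff (\<Prod>i<d. [:- x i, 1:]) d"
    proof -
      have "degree (\<Prod>i<d. [:- x i, 1:]) = d" by (subst degree_prod_sum_eq) auto
      moreover have "lead_coeff (\<Prod>i<d. [:- x i, 1:]) = 1" by (subst lead_coeff_prod) simp
      ultimately show ?thesis by (simp add: lead)
    qed
    show "card (x ` {..<d}) \<ge> d" by (simp add: card_image x_inj)
    show "degree (map_poly \<iota> P) \<le> d" by (simp add: d_def)
    show "degree (\<Prod>i<d. [:- x i, 1:]) \<le> d" by (subst degree_prod_sum_eq) auto
  next
    fix z assume "z \<in> x ` {..<d}"
    thus "poly (map_poly \<iota> P) z = poly (\<Prod>i<d. [:- x i, 1:]) z"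
      using x_root by (auto simp: poly_prod)
  qed

  \<comment> \<open>The same derivation \<open>\<Delta> * d/dT\<close> in the variables \<open>T - t0\<close> and \<open>1 / T\<close>.\<close>
  define D where "D f = \<iota> \<Delta> * fls_deriv f" for f
  define D' where "D' f = fls_of_T_poly \<Delta> * T_deriv f" for f
  define E where "E p = \<Delta> * pderiv p" for p
  have derD: "derivation_field D" by standard (simp_all add: D_def algebra_simps)
  have derD': "derivation_field D'"
    using derivation_field.D_add[OF derivation_T_deriv[where 'a = 'k]] derivation_field.D_mult[OF derivation_T_deriv[where 'a = 'k]]
    by unfold_locales (simp_all add: D'_def algebra_simps)
  have D\<iota>: "D (\<iota> p) = \<iota> (E p)" for p by (simp add: D_def \<iota>_deriv E_def \<iota>.hom_mult)
  have D'J: "D' (fls_of_T_poly p) = fls_of_T_poly (E p)" for p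
    by (simp add: D'_def T_deriv_fls_of_T_poly E_def J.hom_mult)
  have E0: "E 0 = 0" by (simp add: E_def)
  \<comment> \<open>Differentiating \<open>P y = 0\<close> and multiplying by the cofactor \<open>v\<close> of \<open>pderiv P\<close> expresses \<open>\<Delta> * y'\<close>
    as a polynomial in \<open>y\<close>.\<close>
  define g where "g = - v * map_poly pderiv P"
  have root_deriv: "F y = poly (map_poly j g) y"
    if "inj_idom_hom j" "derivation_field D0" and D0j: "\<And>p. D0 (j p) = j (pderiv p)"
      and F: "\<And>f. F f = j \<Delta> * D0 f" and y: "poly (map_poly j P) y = 0"
    for j :: "'k poly \<Rightarrow> 'k fls" and D0 F y
  proof -
    interpret j: inj_idom_hom j by fact
    interpret jp: map_poly_inj_idom_hom j ..
    interpret derivation_field D0 by fact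
    have "poly (map_poly j (u * P + v * pderiv P)) y = j \<Delta>"
      by (simp add: \<Delta>(2) j.map_poly_pCons_hom)
    hence vP: "poly (map_poly j v) y * poly (map_poly j (pderiv P)) y = j \<Delta>"
      by (simp only: jp.hom_add jp.hom_mult poly_add poly_mult y) simp
    have "0 = poly (map_poly j (map_poly pderiv P)) y + poly (map_poly j (pderiv P)) y * D0 y"
      using derivation_of_poly_value[OF that(1,2) D0j, of P y] y by simp
    hence P': "poly (map_poly j (pderiv P)) y * D0 y = - poly (map_poly j (map_poly pderiv P)) y"
      by (simp add: eq_neg_iff_add_eq_0 add.commute)
    have "F y = poly (map_poly j v) y * (poly (map_poly j (pderiv P)) y * D0 y)"
      by (simp add: F vP[symmetric])
    also have "\<dots> = poly (map_poly j g) y"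
      unfolding P' g_def by (simp add: jp.hom_mult jp.hom_uminus)
    finally show ?thesis .
  qed
  have "derivation_field (fls_deriv :: 'k fls \<Rightarrow> _)" by standard (simp_all add: algebra_simps)
  hence Dx: "D (x i) = poly (map_poly \<iota> g) (x i)" if "i < d" for i
    using root_deriv[OF \<iota>.inj_idom_hom_axioms _ \<iota>_deriv D_def x_root[OF that]] by blast
  have D'A: "D' A = poly (map_poly fls_of_T_poly g) A"
    by (rule root_deriv[OF J.inj_idom_hom_axioms derivation_T_deriv T_deriv_fls_of_T_poly D'_def P_root])

  \<comment> \<open>Large enough to bound both the size of \<open>A\<close> and the weights of the coefficients of \<open>P\<close>.\<close>
  define c where "c = 1 + nat (- fls_subdegree A) + (\<Sum>j\<le>d. degree (coeff P j))"
  define \<delta> where "\<delta> = degree \<Delta> + (\<Sum>j\<le>degree g. degree (coeff g j) + c * j)"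
  define S where "S t = {poly (map_poly \<iota> r) (x 0) | r. val_ge (- t) (poly (map_poly fls_of_T_poly r) A)}" for t
  have S_I: "val_ge (- t) (poly (map_poly fls_of_T_poly r) A) \<Longrightarrow> poly (map_poly \<iota> r) (x 0) \<in> S t" for r t
    by (auto simp: S_def)
  have d_pos: "d \<ge> 1" using degree_P by (simp add: d_def)
  have "conjugates \<iota> D x d c \<delta> P g \<Delta> S"
  proof (intro conjugates.intro conjugates_axioms.intro)
    show "inj_idom_hom \<iota>" by (rule \<iota>.inj_idom_hom_axioms)
    show "derivation_field D" by (rule derD)
    show "D (\<iota> p) = \<iota> (\<Delta> * pderiv p)" for p by (simp add: D\<iota> E_def)
    show "\<exists>a. y = \<iota> [:a:]" if "D y = 0" for y
    proof -
      have "fls_deriv y = 0" using that \<Delta>(1) by (simp add: D_def)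
      thus ?thesis using fls_deriv_eq_0_iff[of y] by (auto simp: \<iota>_const)
    qed
    show "map_poly \<iota> P = (\<Prod>i<d. [:- x i, 1:])" by (rule map_P)
    show "i < d \<Longrightarrow> D (x i) = poly (map_poly \<iota> g) (x i)" for i by (rule Dx)
    show "1 \<le> d" by (rule d_pos)
    show "1 \<le> c" by (simp add: c_def)
    show "degree (coeff P (d - j)) \<le> c * j" if "j \<le> d" for j
    proof (cases "j = 0")
      case True
      thus ?thesis by (simp add: lead)
    next
      case False
      have "degree (coeff P (d - j)) \<le> (\<Sum>j\<le>d. degree (coeff P j))"
        by (rule member_le_sum) auto
      also have "\<dots> \<le> c * 1" by (simp add: c_def)
      also have "\<dots> \<le> c * j" using False by (intro mult_left_mono) auto
      finally show ?thesis .
    qed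
    show "degree (coeff g j) + c * j \<le> c + \<delta>" if "coeff g j \<noteq> 0" for j
    proof -
      have "degree (coeff g j) + c * j \<le> (\<Sum>j\<le>degree g. degree (coeff g j) + c * j)"
        using le_degree[OF that] by (intro member_le_sum[of j "{..degree g}" "\<lambda>j. degree (coeff g j) + c * j"]) auto
      thus ?thesis by (simp add: \<delta>_def)
    qed
    show "degree \<Delta> \<le> \<delta>" by (simp add: \<delta>_def)
    show "\<iota> p \<in> S (int (degree p))" for p
      using S_I[of "int (degree p)" "[:p:]"] by (simp add: \<iota>.map_poly_pCons_hom J.map_poly_pCons_hom val_ge_fls_of_T_poly)
    show "x 0 \<in> S (int c)"
    proof -
      have "- int c \<le> fls_subdegree A" unfolding c_def by linarith
      hence "val_ge (- int c) A" by (simp add: val_ge_iff)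
      thus ?thesis
        using S_I[of "int c" "[:0, 1:]"] by (simp add: \<iota>.map_poly_pCons_hom J.map_poly_pCons_hom)
    qed
    show "D y \<in> S (t + int \<delta>)" if "y \<in> S t" for y t
    proof -
      from that obtain r where r: "y = poly (map_poly \<iota> r) (x 0)" "val_ge (- t) (poly (map_poly fls_of_T_poly r) A)"
        by (auto simp: S_def)
      define r' where "r' = map_poly E r + pderiv r * g"
      have "D y = poly (map_poly \<iota> r') (x 0)"
        using derivation_of_poly_value[OF \<iota>.inj_idom_hom_axioms derD D\<iota> E0, of r "x 0"] Dx[of 0] d_pos
        by (simp add: r r'_def \<iota>p.hom_add \<iota>p.hom_mult)
      moreover have "D' (poly (map_poly fls_of_T_poly r) A) = poly (map_poly fls_of_T_poly r') A"
        using derivation_of_poly_value[OF J.inj_idom_hom_axioms derD' D'J E0, of r A] D'A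
        by (simp add: r'_def Jp.hom_add Jp.hom_mult)
      moreover have v: "val_ge (- int (degree \<Delta>) + - t) (D' (poly (map_poly fls_of_T_poly r) A))"
        unfolding D'_def by (intro val_ge_mult val_ge_T_deriv r) (simp add: val_ge_fls_of_T_poly)
      moreover have "val_ge (- (t + int \<delta>)) (D' (poly (map_poly fls_of_T_poly r) A))"
        by (rule val_ge_mono[OF v]) (simp add: \<delta>_def sum_nonneg)
      ultimately show ?thesis
        using S_I[of "t + int \<delta>" r'] by (simp only:)
    qed
    show "0 \<le> t" if "\<iota> p \<in> S t" "p \<noteq> 0" for p t
    proof -
      from that obtain r where r: "\<iota> p = poly (map_poly \<iota> r) (x 0)" "val_ge (- t) (poly (map_poly fls_of_T_poly r) A)"
        by (auto simp: S_def)
      have "poly (map_poly \<iota> (r - [:p:])) (x 0) = 0" by (simp add: r(1) \<iota>p.hom_minus \<iota>.map_poly_pCons_hom)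
      hence "poly (map_poly fls_of_T_poly (r - [:p:])) A = 0"
        using root_at_place_imp_root[OF \<iota>.inj_idom_hom_axioms x_root[of 0]] d_pos by simp
      hence "poly (map_poly fls_of_T_poly r) A = fls_of_T_poly p" by (simp add: Jp.hom_minus J.map_poly_pCons_hom)
      thus ?thesis using r(2) that(2) by (simp add: val_ge_fls_of_T_poly)
    qed
    show "weighted_subrings S"
    proof
      fix s t :: int and y z :: "'k fls" and a :: rat
      show "0 \<in> S t" using S_I[of t 0] by simp
      show "of_rat a \<in> S 0"
        using S_I[of 0 "[:[:of_rat a:]:]"] of_rat_eq_poly_hom[OF \<iota>.inj_idom_hom_axioms, of a]
        by (simp add: val_ge_fls_of_T_poly \<iota>.map_poly_pCons_hom J.map_poly_pCons_hom)
      show "y + z \<in> S t" if "y \<in> S t" "z \<in> S t"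
      proof -
        obtain r1 r2 where r: "y = poly (map_poly \<iota> r1) (x 0)" "val_ge (- t) (poly (map_poly fls_of_T_poly r1) A)"
          "z = poly (map_poly \<iota> r2) (x 0)" "val_ge (- t) (poly (map_poly fls_of_T_poly r2) A)"
          using \<open>y \<in> S t\<close> \<open>z \<in> S t\<close> unfolding S_def by blast
        show ?thesis using S_I[of t "r1 + r2"] val_ge_add[OF r(2,4)]
          by (simp add: r(1,3) \<iota>p.hom_add Jp.hom_add)
      qed
      show "y * z \<in> S (s + t)" if "y \<in> S s" "z \<in> S t"
      proof -
        obtain r1 r2 where r: "y = poly (map_poly \<iota> r1) (x 0)" "val_ge (- s) (poly (map_poly fls_of_T_poly r1) A)"
          "z = poly (map_poly \<iota> r2) (x 0)" "val_ge (- t) (poly (map_poly fls_of_T_poly r2) A)"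
          using \<open>y \<in> S s\<close> \<open>z \<in> S t\<close> unfolding S_def by blast
        show ?thesis using S_I[of "s + t" "r1 * r2"] val_ge_mult[OF r(2,4)]
          by (simp add: r(1,3) \<iota>p.hom_mult Jp.hom_mult)
      qed
      show "s \<le> t \<Longrightarrow> y \<in> S s \<Longrightarrow> y \<in> S t"
        unfolding S_def using val_ge_mono[of "- s" _ "- t"] by auto
    qed
  qed
  moreover have "\<iota> p - \<iota> q * x 0 \<in> S (- e)" if "val_ge e (fls_of_T_poly p - fls_of_T_poly q * A)" for p q e
    using S_I[of "- e" "[:p, - q:]"] that by (simp add: \<iota>.map_poly_pCons_hom J.map_poly_pCons_hom \<iota>.hom_uminus J.hom_uminus mult.commute)
  ultimately show ?thesis by blast
qed

section \<open>Convergents\<close>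

text \<open>
  Numerators of the convergents, with the same shift of indices by two as the denominators.
\<close>

fun cf_num_shifted :: "'a::field fls \<Rightarrow> nat \<Rightarrow> 'a poly" where
  "cf_num_shifted \<alpha> 0 = 0"
| "cf_num_shifted \<alpha> (Suc 0) = 1"
| "cf_num_shifted \<alpha> (Suc (Suc i)) =
     cf_partial_quotient \<alpha> i * cf_num_shifted \<alpha> (Suc i) + cf_num_shifted \<alpha> i"

lemma cf_determinant:
  "cf_num_shifted \<alpha> (Suc n) * cf_denom_shifted \<alpha> n - cf_num_shifted \<alpha> n * cf_denom_shifted \<alpha> (Suc n) = (- 1) ^ n"
  by (induction n) (simp_all add: algebra_simps)

lemma cf_bezout:
  obtains u v where "u * cf_num_shifted \<alpha> (Suc n) + v * cf_denom_shifted \<alpha> (Suc n) = 1"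
proof
  have "(- 1) ^ n * cf_denom_shifted \<alpha> n * cf_num_shifted \<alpha> (Suc n) + (- ((- 1) ^ n * cf_num_shifted \<alpha> n)) * cf_denom_shifted \<alpha> (Suc n)
    = (- 1) ^ n * (cf_num_shifted \<alpha> (Suc n) * cf_denom_shifted \<alpha> n - cf_num_shifted \<alpha> n * cf_denom_shifted \<alpha> (Suc n))"
    by (simp add: algebra_simps)
  thus "(- 1) ^ n * cf_denom_shifted \<alpha> n * cf_num_shifted \<alpha> (Suc n) + (- ((- 1) ^ n * cf_num_shifted \<alpha> n)) * cf_denom_shifted \<alpha> (Suc n) = 1"
    by (simp add: cf_determinant flip: power_mult_distrib)
qed

lemma val_ge_fls_minus_T_floor: "val_ge 1 (f - fls_of_T_poly (fls_T_floor f))"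
  by (auto simp: val_ge_def fls_nth_of_T_poly coeff_fls_T_floor)

locale irrational_series =
  fixes \<alpha> :: "'a::field fls"
  assumes irrational: "\<alpha> \<notin> T_rat_funs"
begin

sublocale J: inj_idom_hom "fls_of_T_poly :: 'a poly \<Rightarrow> 'a fls"
  by (rule hom_fls_of_T_poly)

abbreviation "cq \<equiv> cf_complete_quotient \<alpha>"
abbreviation "pq \<equiv> cf_partial_quotient \<alpha>"
abbreviation "den \<equiv> cf_denom_shifted \<alpha>"
abbreviation "num \<equiv> cf_num_shifted \<alpha>"

text \<open>
  These are the numbers \<open>q\<^sub>i \<alpha> - p\<^sub>i\<close> with the index shifted by two. They satisfy the same recursion as \<open>q\<^sub>i\<close> and \<open>p\<^sub>i\<close>.
\<close>

definition remainder :: "nat \<Rightarrow> 'a fls" where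
  "remainder n = fls_of_T_poly (den n) * \<alpha> - fls_of_T_poly (num n)"

lemma remainder_rec: "remainder (Suc (Suc n)) = fls_of_T_poly (pq n) * remainder (Suc n) + remainder n"
  by (simp add: remainder_def J.hom_add J.hom_mult algebra_simps)

lemma remainder_nonzero: "den n \<noteq> 0 \<Longrightarrow> remainder n \<noteq> 0"
proof
  assume "den n \<noteq> 0" "remainder n = 0"
  hence "\<alpha> = fls_of_T_poly (num n) / fls_of_T_poly (den n)"
    by (simp add: remainder_def field_simps)
  thus False using irrational \<open>den n \<noteq> 0\<close> by (auto simp: T_rat_funs_def)
qed

text \<open>
  Each remainder is the previous one divided by minus the complete quotient. Hence its size is the inverse of the
  product of the sizes of the complete quotients, which is the size of the next denominator, because from index 1 on a
  complete quotient has the same positive degree as its polynomial part.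
\<close>

lemma cf_invariant:
  "remainder (Suc n) * cq n = - remainder n \<and> remainder (Suc n) \<noteq> 0 \<and>
   den (Suc (Suc n)) \<noteq> 0 \<and> (den (Suc n) = 0 \<or> degree (den (Suc n)) < degree (den (Suc (Suc n)))) \<and>
   fls_subdegree (remainder (Suc n)) = int (degree (den (Suc (Suc n))))  \<and>
   (n > 0 \<longrightarrow> den (Suc n) \<noteq> 0 \<and> pq n \<noteq> 0 \<and> degree (pq n) > 0 \<and> fls_subdegree (cq n) = - int (degree (pq n)))"
proof (induction n)
  case 0
  show ?case by (simp add: remainder_def)
next
  case (Suc n)
  note [simp del] = cf_complete_quotient.simps(2)
  define f where "f = cq n - fls_of_T_poly (pq n)"
  have rem: "remainder (Suc (Suc n)) = - (remainder (Suc n) * f)"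
    using Suc.IH by (simp add: remainder_rec f_def algebra_simps)
  have nz: "remainder (Suc (Suc n)) \<noteq> 0" using Suc.IH remainder_nonzero by blast
  hence f0: "f \<noteq> 0" using rem by auto
  have cq_Suc: "cq (Suc n) = 1 / f" by (simp add: f_def cf_partial_quotient_def cf_complete_quotient.simps(2))
  have 1: "remainder (Suc (Suc n)) * cq (Suc n) = - remainder (Suc n)"
    unfolding rem cq_Suc using f0 by simp
  have "fls_subdegree f \<ge> 1"
    using val_ge_fls_minus_T_floor[of "cq n"] f0 by (simp add: f_def cf_partial_quotient_def val_ge_iff)
  hence sub_cq: "fls_subdegree (cq (Suc n)) \<le> - 1" and cq0: "cq (Suc n) \<noteq> 0"
    unfolding cq_Suc using f0 by (simp_all add: fls_divide_subdegree)
  define k where "k = nat (- fls_subdegree (cq (Suc n)))"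
  have k: "fls_subdegree (cq (Suc n)) = - int k" "k \<ge> 1" using sub_cq by (auto simp: k_def)
  have coeff_pq: "coeff (pq (Suc n)) j = fls_nth (cq (Suc n)) (- int j)" for j
    by (simp add: cf_partial_quotient_def coeff_fls_T_floor)
  have "degree (pq (Suc n)) = k"
  proof (rule antisym)
    show "degree (pq (Suc n)) \<le> k" by (rule degree_le) (simp add: coeff_pq k(1))
    show "k \<le> degree (pq (Suc n))"
      using nth_fls_subdegree_nonzero[OF cq0] by (intro le_degree) (simp add: coeff_pq k(1))
  qed
  moreover have "pq (Suc n) \<noteq> 0" using calculation k by auto
  ultimately have deg_pq: "pq (Suc n) \<noteq> 0" "degree (pq (Suc n)) = k" by auto
  have den2: "den (Suc (Suc n)) \<noteq> 0" using Suc.IH by blast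
  have deg_prod: "degree (pq (Suc n) * den (Suc (Suc n))) = k + degree (den (Suc (Suc n)))"
    using deg_pq den2 by (simp add: degree_mult_eq)
  have lt: "degree (den (Suc n)) < degree (pq (Suc n) * den (Suc (Suc n)))"
    using Suc.IH k(2) unfolding deg_prod by (cases "den (Suc n) = 0") auto
  have deg_den: "degree (den (Suc (Suc (Suc n)))) = k + degree (den (Suc (Suc n)))"
    using degree_add_eq_left[OF lt] by (simp only: cf_denom_shifted.simps(3)[of \<alpha> "Suc n"] deg_prod)
  have "den (Suc (Suc (Suc n))) \<noteq> 0" using deg_den k(2) by auto
  moreover have "fls_subdegree (remainder (Suc (Suc n))) = int (degree (den (Suc (Suc (Suc n)))))"
  proof -
    have "fls_subdegree (remainder (Suc (Suc n))) + fls_subdegree (cq (Suc n)) = fls_subdegree (remainder (Suc n))"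
      using 1 nz cq0 by (metis fls_subdegree_mult fls_uminus_subdegree)
    thus ?thesis using Suc.IH k deg_den by simp
  qed
  ultimately show ?case
    using 1 nz den2 deg_den deg_pq k by simp
qed

lemma degree_den_strict_mono: "degree (den (n + 2)) < degree (den (n + 3))"
  using cf_invariant[of "Suc n"]
  by (auto simp: numeral_eq_Suc simp del: cf_denom_shifted.simps cf_complete_quotient.simps)

lemma den_nonzero: "den (n + 2) \<noteq> 0"
  using cf_invariant[of n] by (simp del: cf_denom_shifted.simps cf_complete_quotient.simps)

lemma val_remainder: "fls_subdegree (remainder (n + 2)) = int (degree (den (n + 3)))"
  using cf_invariant[of "Suc n"]
  by (auto simp: numeral_eq_Suc simp del: cf_denom_shifted.simps cf_complete_quotient.simps)

end

section \<open>Base change of Laurent series\<close>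

definition fls_map :: "('a::zero \<Rightarrow> 'b::zero) \<Rightarrow> 'a fls \<Rightarrow> 'b fls" where
  "fls_map h f = Abs_fls (\<lambda>n. h (fls_nth f n))"

lemma fls_nth_map:
  assumes "h 0 = 0"
  shows "fls_nth (fls_map h f) n = h (fls_nth f n)"
proof -
  have "\<forall>\<^sub>\<infinity>n. h (fls_nth f (- int n)) = 0"
    using MOST_mono[OF MOST_fls_neg_nth_eq_0[of f]] assms by (metis (mono_tags, lifting))
  thus ?thesis unfolding fls_map_def by (simp add: nth_Abs_fls)
qed

lemma fls_subdegree_map:
  assumes "h 0 = 0" "\<And>a. h a = 0 \<Longrightarrow> a = 0"
  shows "fls_subdegree (fls_map h f) = fls_subdegree f"
proof (cases "f = 0")
  case True
  have "fls_map h f = 0" by (rule fls_eqI) (simp add: fls_nth_map assms True)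
  thus ?thesis using True by simp
next
  case False
  show ?thesis
  proof (rule fls_subdegree_eqI)
    show "fls_nth (fls_map h f) (fls_subdegree f) \<noteq> 0"
      using assms(2)[of "fls_nth f (fls_subdegree f)"] False by (auto simp: fls_nth_map assms(1))
  qed (simp add: fls_nth_map assms(1))
qed

lemma inj_idom_hom_fls_map:
  fixes h :: "'a::field \<Rightarrow> 'b::field"
  assumes "inj_idom_hom h"
  shows "inj_idom_hom (fls_map h)"
proof -
  interpret h: inj_idom_hom h by fact
  have nth: "fls_nth (fls_map h f) n = h (fls_nth f n)" for f n by (rule fls_nth_map) simp
  have sub: "fls_subdegree (fls_map h f) = fls_subdegree f" for f
    by (rule fls_subdegree_map) simp_all
  show ?thesis
  proof
    fix f g :: "'a fls"
    show "fls_map h 0 = 0" "fls_map h 1 = 1" "fls_map h (f + g) = fls_map h f + fls_map h g"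
      by (rule fls_eqI; simp add: nth h.hom_add)+
    show "fls_map h (f * g) = fls_map h f * fls_map h g"
      by (rule fls_eqI) (simp add: nth fls_times_nth(2) sub h.hom_sum h.hom_mult)
    show "f = 0" if "fls_map h f = 0"
      using that by (metis fls_eqI fls_zero_nth h.hom_0 nth)
  qed
qed

lemma fls_map_of_T_poly:
  assumes "h 0 = 0"
  shows "fls_map h (fls_of_T_poly p) = fls_of_T_poly (map_poly h p)"
  by (rule fls_eqI) (simp add: fls_nth_map assms fls_nth_of_T_poly coeff_map_poly)

section \<open>Degree gaps between convergents\<close>

lemma algebraic_imp_integral_relation:
  fixes \<alpha> :: "'a::field fls"
  assumes "is_minimal_poly T_rat_funs \<alpha> P"
  shows "\<exists>H. H \<noteq> 0 \<and> poly (map_poly fls_of_T_poly H) \<alpha> = 0"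
proof -
  interpret J: inj_idom_hom "fls_of_T_poly :: 'a poly \<Rightarrow> 'a fls" by (rule hom_fls_of_T_poly)
  have "\<forall>n. \<exists>a b. b \<noteq> 0 \<and> coeff P n = fls_of_T_poly a / fls_of_T_poly b"
    using assms unfolding is_minimal_poly_def T_rat_funs_def by blast
  then obtain a b where ab: "\<And>n. b n \<noteq> 0" "\<And>n. coeff P n = fls_of_T_poly (a n) / fls_of_T_poly (b n)" by metis
  define B where "B = (\<Prod>n\<le>degree P. b n)"
  define B' where "B' n = (\<Prod>m\<in>{..degree P} - {n}. b m)" for n
  define H where "H = (\<Sum>n\<le>degree P. monom (a n * B' n) n)"
  have B0: "B \<noteq> 0" using ab(1) by (simp add: B_def)
  have BB': "B = b n * B' n" if "n \<le> degree P" for n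
    using that by (simp add: B_def B'_def prod.remove)
  have "map_poly fls_of_T_poly H = Polynomial.smult (fls_of_T_poly B) P"
  proof (rule poly_eqI)
    fix n
    have cH: "coeff H n = (if n \<le> degree P then a n * B' n else 0)"
      by (simp add: H_def coeff_sum)
    show "coeff (map_poly fls_of_T_poly H) n = coeff (Polynomial.smult (fls_of_T_poly B) P) n"
    proof (cases "n \<le> degree P")
      case True
      thus ?thesis using ab(1)[of n] by (simp add: cH ab(2) BB'[OF True] J.hom_mult)
    next
      case False
      thus ?thesis by (simp add: cH coeff_eq_0)
    qed
  qed
  moreover have "P \<noteq> 0" "poly P \<alpha> = 0" using assms by (auto simp: is_minimal_poly_def)
  ultimately have "map_poly fls_of_T_poly H \<noteq> 0" "poly (map_poly fls_of_T_poly H) \<alpha> = 0"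
    using B0 by simp_all
  thus ?thesis by (intro exI[of _ H]) auto
qed

lemma algebraic_imp_irrational:
  fixes \<alpha> :: "'a::field fls"
  assumes "algebraic_of_degree T_rat_funs \<alpha> d" "d \<ge> 2"
  shows "\<alpha> \<notin> T_rat_funs"
proof
  assume rat: "\<alpha> \<in> T_rat_funs"
  then obtain a b where "b \<noteq> 0" "\<alpha> = fls_of_T_poly a / fls_of_T_poly b" by (auto simp: T_rat_funs_def)
  interpret J: inj_idom_hom "fls_of_T_poly :: 'a poly \<Rightarrow> 'a fls" by (rule hom_fls_of_T_poly)
  obtain P where P: "is_minimal_poly T_rat_funs \<alpha> P" "degree P = d"
    using assms(1) by (auto simp: algebraic_of_degree_def)
  have "- \<alpha> = fls_of_T_poly (- a) / fls_of_T_poly b"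
    using \<open>\<alpha> = _\<close> by (simp add: J.hom_uminus)
  hence "- \<alpha> \<in> T_rat_funs" using \<open>b \<noteq> 0\<close> by (auto simp: T_rat_funs_def)
  moreover have "fls_of_T_poly p / fls_of_T_poly 1 \<in> T_rat_funs" for p :: "'a poly"
    unfolding T_rat_funs_def by (rule CollectI, rule exI[of _ p], rule exI[of _ 1]) simp
  from this[of 1] this[of 0] have "(1 :: 'a fls) \<in> T_rat_funs" "(0 :: 'a fls) \<in> T_rat_funs" by simp_all
  ultimately have "\<forall>n. coeff [:- \<alpha>, 1:] n \<in> T_rat_funs"
    by (auto simp: coeff_pCons split: nat.splits)
  moreover have "poly [:- \<alpha>, 1:] \<alpha> = 0" by simp
  ultimately have "degree P \<le> degree [:- \<alpha>, 1:]"
    using P(1) unfolding is_minimal_poly_def by (metis one_neq_zero pCons_eq_0_iff)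
  thus False using P(2) assms(2) by simp
qed

text \<open>
  Multiplying \<open>A\<close> by the leading coefficient \<open>a\<close> of an equation of least degree \<open>n\<close>, and the equation by the
  power \<open>a ^ (n - 1)\<close>, gives a monic equation.
\<close>

lemma exists_integral_multiple:
  fixes A :: "'k::field_char_0 fls"
  assumes "H \<noteq> 0" "poly (map_poly fls_of_T_poly H) A = 0"
  shows "\<exists>a P. a \<noteq> 0 \<and> min_poly (fls_of_T_poly a * A) P"
proof -
  interpret J: inj_idom_hom "fls_of_T_poly :: 'k poly \<Rightarrow> 'k fls" by (rule hom_fls_of_T_poly)
  interpret Jp: map_poly_inj_idom_hom "fls_of_T_poly :: 'k poly \<Rightarrow> 'k fls" ..
  define Z where "Z = {H. H \<noteq> 0 \<and> poly (map_poly fls_of_T_poly H) A = 0}"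
  define P0 where "P0 = arg_min degree (\<lambda>H. H \<in> Z)"
  have "H \<in> Z" using assms by (simp add: Z_def)
  have P0: "P0 \<in> Z" "\<And>H. H \<in> Z \<Longrightarrow> degree P0 \<le> degree H"
    unfolding P0_def using arg_min_natI[of "\<lambda>H. H \<in> Z" H degree] arg_min_nat_le[of "\<lambda>H. H \<in> Z" _ degree] \<open>H \<in> Z\<close>
    by blast+
  define n where "n = degree P0"
  define a where "a = lead_coeff P0"
  have a0: "a \<noteq> 0" using P0(1) by (simp add: a_def Z_def)
  have n1: "n \<ge> 1"
  proof (rule ccontr)
    assume "\<not> ?thesis"
    hence "degree P0 = 0" by (simp add: n_def)
    then obtain b where "P0 = [:b:]" by (auto elim: degree_eq_zeroE)
    thus False using P0(1) by (auto simp: Z_def J.map_poly_pCons_hom)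
  qed
  define P where "P = monom 1 n + (\<Sum>i<n. monom (coeff P0 i * a ^ (n - 1 - i)) i)"
  have cP: "coeff P i = (if i = n then 1 else if i < n then coeff P0 i * a ^ (n - 1 - i) else 0)" for i
    by (auto simp: P_def coeff_sum)
  have degP: "degree P = n"
    by (rule antisym, rule degree_le) (auto simp: cP intro: le_degree)
  have "min_poly (fls_of_T_poly a * A) P"
  proof
    show "lead_coeff P = 1" by (simp add: degP cP)
  next
    let ?J = "fls_of_T_poly :: 'k poly \<Rightarrow> 'k fls"
    have "poly (map_poly ?J P) (?J a * A) = (?J a * A) ^ n + (\<Sum>i<n. ?J (coeff P0 i) * ?J a ^ (n - 1 - i) * (?J a * A) ^ i)"
      by (simp add: poly_altdef degP lessThan_Suc_atMost[symmetric] cP J.hom_mult J.hom_power)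
    also have "(\<Sum>i<n. ?J (coeff P0 i) * ?J a ^ (n - 1 - i) * (?J a * A) ^ i) = ?J a ^ (n - 1) * (\<Sum>i<n. ?J (coeff P0 i) * A ^ i)"
      unfolding sum_distrib_left
    proof (rule sum.cong)
      fix i assume "i \<in> {..<n}"
      hence "?J a ^ (n - 1) = ?J a ^ (n - 1 - i) * ?J a ^ i" by (simp flip: power_add)
      thus "?J (coeff P0 i) * ?J a ^ (n - 1 - i) * (?J a * A) ^ i = ?J a ^ (n - 1) * (?J (coeff P0 i) * A ^ i)"
        by (simp add: power_mult_distrib mult_ac)
    qed simp
    also have "(?J a * A) ^ n = ?J a ^ (n - 1) * (?J a * A ^ n)"
      using n1 by (cases n) (simp_all add: power_mult_distrib mult_ac)
    also have "?J a ^ (n - 1) * (?J a * A ^ n) + ?J a ^ (n - 1) * (\<Sum>i<n. ?J (coeff P0 i) * A ^ i) =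
        ?J a ^ (n - 1) * (\<Sum>i\<le>n. ?J (coeff P0 i) * A ^ i)"
      by (simp add: lessThan_Suc_atMost[symmetric] a_def n_def algebra_simps)
    also have "(\<Sum>i\<le>n. ?J (coeff P0 i) * A ^ i) = poly (map_poly ?J P0) A"
      by (simp add: poly_altdef n_def)
    also have "\<dots> = 0" using P0(1) by (simp add: Z_def)
    finally show "poly (map_poly ?J P) (?J a * A) = 0" by simp
  next
    fix H :: "'k poly poly"
    assume H: "H \<noteq> 0" "poly (map_poly fls_of_T_poly H) (fls_of_T_poly a * A) = 0"
    define H' where "H' = pcompose H [:0, a:]"
    have deg: "degree H' = degree H" using a0 by (simp add: H'_def degree_pcompose)
    have "H' \<noteq> 0"
      using H(1) a0 by (simp add: H'_def pcompose_eq_0_iff)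
    moreover have "poly (map_poly fls_of_T_poly H') A = 0"
      using H(2) by (simp add: H'_def J.map_poly_pcompose poly_pcompose J.map_poly_pCons_hom mult.commute)
    ultimately have "n \<le> degree H'" using P0(2)[of H'] by (simp add: Z_def n_def)
    thus "degree P \<le> degree H" by (simp add: degP deg)
  qed
  thus ?thesis using a0 by blast
qed

lemma alg_closure_relation:
  fixes \<alpha> :: "'a::field fls"
  assumes "H \<noteq> 0" "poly (map_poly fls_of_T_poly H) \<alpha> = 0"
  shows "\<exists>H. H \<noteq> 0 \<and> poly (map_poly fls_of_T_poly H) (fls_map to_ac \<alpha>) = 0"
proof -
  interpret ac: inj_idom_hom "to_ac :: 'a \<Rightarrow> 'a alg_closure" by standard auto
  interpret acp: map_poly_inj_idom_hom "to_ac :: 'a \<Rightarrow> 'a alg_closure" ..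
  interpret acpp: map_poly_inj_idom_hom "map_poly (to_ac :: 'a \<Rightarrow> 'a alg_closure)" ..
  interpret F: inj_idom_hom "fls_map (to_ac :: 'a \<Rightarrow> 'a alg_closure)"
    by (rule inj_idom_hom_fls_map) (rule ac.inj_idom_hom_axioms)
  have "map_poly fls_of_T_poly (map_poly (map_poly to_ac) H) = map_poly (fls_map to_ac) (map_poly fls_of_T_poly H)"
    by (rule poly_eqI) (simp add: coeff_map_poly fls_map_of_T_poly fls_of_T_poly_def[of 0])
  hence "poly (map_poly fls_of_T_poly (map_poly (map_poly to_ac) H)) (fls_map to_ac \<alpha>) = fls_map to_ac 0"
    using assms(2) by simp
  thus ?thesis using assms(1) by (intro exI[of _ "map_poly (map_poly to_ac) H"]) auto
qed

text \<open>
  Applies \<open>approximation_gap\<close> to the convergents \<open>p / q\<close> of \<open>\<alpha>\<close>, after extension of the constants: \<open>a * p / q\<close>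
  approximates the integral multiple \<open>a * \<alpha>\<close>, and \<open>p\<close> is coprime to \<open>q\<close>. The constant \<open>K\<close> collects the errors,
  which are at most quadratic in \<open>r\<close>.
\<close>

theorem convergent_degree_gaps:
  fixes \<alpha> :: "'a::field_char_0 fls"
  assumes alg: "algebraic_of_degree T_rat_funs \<alpha> d" and "d \<ge> 2"
  defines "D \<equiv> \<lambda>i. degree (cf_denom \<alpha> i)"
  shows "\<exists>\<rho> :: nat \<Rightarrow> nat. \<exists>K s. s \<ge> 1 \<and> (\<forall>r\<ge>1. 1 \<le> \<rho> r \<and> \<rho> r \<le> K * r) \<and>
    (\<forall>r\<ge>1. \<forall>i. K * (r + 1) < D i \<longrightarrow> \<rho> r * D (Suc i) \<le> \<rho> (r + s) * D i + K * (r + 1) ^ 2)"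
proof -
  interpret irrational_series \<alpha>
    by standard (rule algebraic_imp_irrational[OF alg \<open>d \<ge> 2\<close>])
  obtain P1 where "is_minimal_poly T_rat_funs \<alpha> P1"
    using alg by (auto simp: algebraic_of_degree_def)
  then obtain H1 where "H1 \<noteq> 0" "poly (map_poly fls_of_T_poly H1) \<alpha> = 0"
    using algebraic_imp_integral_relation by blast
  then obtain H where H: "H \<noteq> 0" "poly (map_poly fls_of_T_poly H) (fls_map to_ac \<alpha>) = 0"
    using alg_closure_relation by blast
  obtain a P where a: "a \<noteq> 0" and P: "min_poly (fls_of_T_poly a * fls_map to_ac \<alpha>) P"
    using exists_integral_multiple[OF H] by blast
  define A where "A = fls_of_T_poly a * fls_map to_ac \<alpha>"
  obtain \<iota> :: "'a alg_closure poly \<Rightarrow> 'a alg_closure fls" and D' x e c \<delta> g \<Delta> S where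
    conj: "conjugates \<iota> D' x e c \<delta> P g \<Delta> S" and
    S: "\<forall>p q e. val_ge e (fls_of_T_poly p - fls_of_T_poly q * A) \<longrightarrow> \<iota> p - \<iota> q * x 0 \<in> S (- e)"
    using exists_conjugates[OF P] unfolding A_def by (elim exE conjE)
  interpret C: conjugates \<iota> D' x e c \<delta> P g \<Delta> S by (rule conj)
  interpret ac: inj_idom_hom "to_ac :: 'a \<Rightarrow> 'a alg_closure" by standard auto
  interpret acp: map_poly_inj_idom_hom "to_ac :: 'a \<Rightarrow> 'a alg_closure" ..
  interpret F: inj_idom_hom "fls_map (to_ac :: 'a \<Rightarrow> 'a alg_closure)"
    by (rule inj_idom_hom_fls_map) (rule ac.inj_idom_hom_axioms)
  interpret J': inj_idom_hom "fls_of_T_poly :: 'a alg_closure poly \<Rightarrow> _" by (rule hom_fls_of_T_poly)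

  define s where "s = c * e"
  define k where "k = e ^ e * (s + 2)"
  define w where "w = 1 + s + c * e * e + \<delta> * k"
  define K where "K = e ^ e + fact e * (degree a + fact e * (1 + c * e * e)) + (k * w + e ^ e * degree a)"
  have gap: "C.rk r * D (Suc i) \<le> C.rk (r + s) * D i + K * (r + 1) ^ 2" if r: "r \<ge> 1" and large: "K * (r + 1) < D i" for r i
  proof -
    \<comment> \<open>The index \<open>i + 2\<close> undoes the shift in the definition of the denominators.\<close>
    define q where "q = map_poly to_ac (den (i + 2))"
    define p0 where "p0 = map_poly to_ac (num (i + 2))"
    have degq: "degree q = D i" by (simp add: q_def D_def cf_denom_def)
    have q0: "q \<noteq> 0" using den_nonzero[of i] by (simp add: q_def)
    obtain u v where "u * num (Suc (i + 1)) + v * den (Suc (i + 1)) = 1" by (rule cf_bezout)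
    hence "map_poly to_ac (u * num (i + 2) + v * den (i + 2)) = (1 :: 'a alg_closure poly)" by simp
    hence bez: "map_poly to_ac u * p0 + map_poly to_ac v * q = 1"
      by (simp only: acp.hom_add acp.hom_mult p0_def q_def)
    have "val_ge (int (D (Suc i))) (remainder (i + 2))"
      using val_remainder[of i] by (simp add: val_ge_iff D_def cf_denom_def numeral_eq_Suc)
    moreover have "fls_subdegree (fls_map to_ac f) = fls_subdegree f" for f :: "'a fls"
      by (rule fls_subdegree_map) auto
    ultimately have "val_ge (int (D (Suc i))) (fls_map to_ac (remainder (i + 2)))"
      by (simp add: val_ge_iff)
    hence "val_ge (- int (degree a) + int (D (Suc i))) (- fls_of_T_poly a * fls_map to_ac (remainder (i + 2)))"
      by (intro val_ge_mult) (simp_all add: val_ge_fls_of_T_poly flip: J'.hom_uminus)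
    also have "- fls_of_T_poly a * fls_map to_ac (remainder (i + 2)) = fls_of_T_poly (a * p0) - fls_of_T_poly q * A"
      by (simp add: remainder_def F.hom_minus F.hom_mult fls_map_of_T_poly J'.hom_mult A_def p0_def q_def algebra_simps
          del: cf_denom_shifted.simps cf_num_shifted.simps)
    finally have approx: "\<iota> (a * p0) - \<iota> q * x 0 \<in> S (- (- int (degree a) + int (D (Suc i))))"
      using S by blast
    have thr: "fact e * (degree a + fact e * (r + c * e * e)) < degree q"
    proof -
      have "fact e * (degree a + fact e * (r + c * e * e)) \<le> fact e * (degree a * (r + 1) + fact e * ((1 + c * e * e) * (r + 1)))"
        by (intro mult_left_mono add_mono) (simp_all add: algebra_simps)
      also have "\<dots> = fact e * (degree a + fact e * (1 + c * e * e)) * (r + 1)" by (simp add: algebra_simps)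
      also have "\<dots> \<le> K * (r + 1)" by (intro mult_right_mono) (simp_all add: K_def)
      finally show ?thesis using large degq by simp
    qed
    define N where "N = C.rk (r + s) + C.rk r"
    have "int (C.rk r) * (- int (degree a) + int (D (Suc i))) \<le>
        int (C.rk (r + s) * D i + N * (r + s + c * e * e + \<delta> * N))"
      using C.approximation_gap[OF q0 refl a bez thr approx] by (simp only: degq N_def s_def)
    hence "int (C.rk r * D (Suc i)) \<le> int (C.rk (r + s) * D i + N * (r + s + c * e * e + \<delta> * N) + C.rk r * degree a)"
      by (simp add: algebra_simps)
    hence main: "C.rk r * D (Suc i) \<le> C.rk (r + s) * D i + (N * (r + s + c * e * e + \<delta> * N) + C.rk r * degree a)"
      by (simp only: of_nat_le_iff add.assoc)
    have "N \<le> e ^ e * (r + s) + e ^ e * r"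
      unfolding N_def by (intro add_mono C.rk_le)
    also have "\<dots> \<le> e ^ e * ((s + 2) * (r + 1))"
      unfolding distrib_left[symmetric] by (intro mult_left_mono) (simp_all add: algebra_simps)
    finally have N: "N \<le> k * (r + 1)" by (simp only: k_def mult.assoc)
    have "r + s + c * e * e + \<delta> * N \<le> (1 + s + c * e * e) * (r + 1) + \<delta> * (k * (r + 1))"
      by (intro add_mono mult_left_mono N) (simp_all add: algebra_simps)
    also have "\<dots> = w * (r + 1)" by (simp add: w_def algebra_simps)
    finally have "N * (r + s + c * e * e + \<delta> * N) \<le> (k * (r + 1)) * (w * (r + 1))"
      by (intro mult_mono N) simp_all
    moreover have "C.rk r * degree a \<le> (e ^ e * (r + 1)) * (degree a * (r + 1))"
      using C.rk_le[of r] by (intro mult_mono) (auto simp: algebra_simps)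
    ultimately have "N * (r + s + c * e * e + \<delta> * N) + C.rk r * degree a \<le> (k * w + e ^ e * degree a) * (r + 1) ^ 2"
      by (simp add: power2_eq_square algebra_simps)
    also have "\<dots> \<le> K * (r + 1) ^ 2" by (intro mult_right_mono) (simp_all add: K_def)
    finally show ?thesis using main by linarith
  qed
  have "C.rk r \<le> K * r" for r
    using C.rk_le[of r] by (rule order_trans) (simp add: K_def)
  moreover have "s \<ge> 1" using C.d_pos C.c_pos by (simp add: s_def)
  ultimately show ?thesis using C.rk_ge_1 gap by blast
qed

section \<open>Growth of the denominators\<close>

text \<open>
  The growth lemma is stated for natural logarithms; the change to base \<open>\<mu>\<close> affects the constant, and adding 1 to
  it makes the inequality strict.
\<close>

theorem theorem18:
  fixes \<mu> :: real and \<alpha> :: "'a::field_char_0 fls" and d :: nat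
  assumes "\<mu> > 1"
    and "algebraic_of_degree T_rat_funs \<alpha> d"
    and "d \<ge> 2"
  shows "\<exists>C::real. \<forall>i::nat. i \<ge> 2 \<longrightarrow>
           log \<mu> (log \<mu> (fls_abs \<mu> (fls_of_T_poly (cf_denom \<alpha> i))))
             < C * real i / sqrt (log \<mu> (real i))"
proof -
  define D where "D i = degree (cf_denom \<alpha> i)" for i
  interpret irrational_series \<alpha>
    by standard (rule algebraic_imp_irrational[OF assms(2,3)])
  have mono: "D i < D (Suc i)" for i
    using degree_den_strict_mono[of i] by (simp add: D_def cf_denom_def numeral_eq_Suc)
  obtain \<rho> :: "nat \<Rightarrow> nat" and K s where gaps: "s \<ge> 1" "\<forall>r\<ge>1. 1 \<le> \<rho> r \<and> \<rho> r \<le> K * r"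
    "\<forall>r\<ge>1. \<forall>i. K * (r + 1) < D i \<longrightarrow> \<rho> r * D (Suc i) \<le> \<rho> (r + s) * D i + K * (r + 1) ^ 2"
    using convergent_degree_gaps[OF assms(2,3)] unfolding D_def by blast
  have "\<exists>c>0. \<forall>i\<ge>2. ln (real (D i)) \<le> c * real i / sqrt (ln (real i))"
    by (rule log_growth_from_gaps[where D = D and \<rho> = \<rho> and K = K and s = s]) (use mono gaps in blast)+
  then obtain c where c: "c > 0" "\<And>i. i \<ge> 2 \<Longrightarrow> ln (real (D i)) \<le> c * real i / sqrt (ln (real i))" by blast
  define l where "l = ln \<mu>"
  have l: "l > 0" using assms(1) by (simp add: l_def)
  define C where "C = c / (l * sqrt l) + 1"
  have "log \<mu> (log \<mu> (fls_abs \<mu> (fls_of_T_poly (cf_denom \<alpha> i)))) < C * real i / sqrt (log \<mu> (real i))"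
    if i: "i \<ge> 2" for i
  proof -
    have "cf_denom \<alpha> i \<noteq> 0" using den_nonzero[of i] by (simp add: cf_denom_def)
    hence "log \<mu> (fls_abs \<mu> (fls_of_T_poly (cf_denom \<alpha> i))) = real (D i)"
      using assms(1) by (simp add: fls_abs_of_T_poly D_def log_nat_power)
    hence "log \<mu> (log \<mu> (fls_abs \<mu> (fls_of_T_poly (cf_denom \<alpha> i)))) = ln (real (D i)) / l"
      by (simp add: log_def l_def)
    also have "\<dots> \<le> (c * real i / sqrt (ln (real i))) / l"
      using c(2)[OF i] l by (intro divide_right_mono) auto
    also have "sqrt (ln (real i)) = sqrt l * sqrt (log \<mu> (real i))"
      using l by (simp add: log_def l_def flip: real_sqrt_mult)
    also have "c * real i / (sqrt l * sqrt (log \<mu> (real i))) / l = c / (l * sqrt l) * real i / sqrt (log \<mu> (real i))"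
      by (simp add: mult_ac)
    also have "\<dots> < C * real i / sqrt (log \<mu> (real i))"
    proof -
      have "log \<mu> (real i) > 0" using assms(1) i by simp
      thus ?thesis using i by (intro divide_strict_right_mono mult_strict_right_mono) (simp_all add: C_def)
    qed
    finally show ?thesis .
  qed
  thus ?thesis by blast
qed

end
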